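(* Let $n \geq 3$ and $r\geq 2$, and let $C_n$ be the cycle graph on $n$ vertices. The following are equivalent: (1) $\Sigma_r(C_n)$ is vertex decomposable; (2) $\Sigma_r(C_n)$ is shellable; (3) $\Sigma_r(C_n)$ is Cohen–Macaulay (over a field $\mathbb K$); (4) $n \leq r+2$; (5) the clutter $\mathrm{Con}_r(C_n)$ is co-chordal.
   Context: $\mathrm{Con}_r(G)$ is the $r$-uniform clutter on $V(G)$ whose circuits are the $r$-subsets $W$ with $G[W]$ connected; $\Sigma_r(G)$ is the simplicial complex generated by $V(G)\setminus W$ for such $W$. For a $d$-uniform clutter $\mathcal H$: a clique is a vertex set all of whose $d$-subsets are circuits; $\mathcal N_{\mathcal H}[Z]=Z\cup\{x\notin Z: x\in\mathcal E\subseteq Z\cup\{x\}\text{ for some circuit }\mathcal E\}$; a $(d-1)$-subset $Z$ is a simplicial maximal subcircuit if $\mathcal N_{\mathcal H}[Z]$ is a clique; $\mathcal H\setminus_d Z$ keeps the circuits not containing $Z$; $\mathcal H$ is chordal if it has no circuits or has a simplicial maximal subcircuit $Z$ with $\mathcal H\setminus_d Z$ chordal; co-chordal means the complement clutter (circuits = $d$-subsets that are not circuits) is chordal. Vertex decomposable, shellable and Cohen–Macaulay have their standard meanings. *)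

theory Defs
  imports
    "Graph_Theory.Pair_Digraph"
    "Graph_Theory.Digraph_Component"
    "HOL-Algebra.QuotRing"
    "HOL-Library.Poly_Mapping"
    "HOL-Library.Extended_Nat"
begin

section \<open>Graphs\<close>

text \<open>A simple graph is represented by the symmetric digraph that has both arcs
  \<open>(u, v)\<close> and \<open>(v, u)\<close> for every edge.\<close>

definition cycle_graph :: "nat \<Rightarrow> (nat, nat \<times> nat) pre_digraph" where
  "cycle_graph n = with_proj
     \<lparr> pverts = {0..<n},
       parcs = {(i, j). i < n \<and> j < n \<and> (j = (i + 1) mod n \<or> i = (j + 1) mod n)} \<rparr>"


section \<open>Uniform clutters\<close>

text \<open>A \<open>d\<close>-uniform clutter is given by its vertex set \<open>V\<close> and its set \<open>C\<close> of circuits,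
  which are \<open>d\<close>-subsets of \<open>V\<close>.\<close>

definition Con :: "nat \<Rightarrow> ('a, 'b) pre_digraph \<Rightarrow> 'a set set" where
  "Con r G = {W. W \<subseteq> verts G \<and> card W = r \<and> connected (G \<restriction> W)}"

definition clutter_complement :: "nat \<Rightarrow> 'a set \<Rightarrow> 'a set set \<Rightarrow> 'a set set" where
  "clutter_complement d V C = {F. F \<subseteq> V \<and> card F = d \<and> F \<notin> C}"

definition clutter_clique :: "nat \<Rightarrow> 'a set \<Rightarrow> 'a set set \<Rightarrow> 'a set \<Rightarrow> bool" where
  "clutter_clique d V C S \<longleftrightarrow> S \<subseteq> V \<and> (\<forall>F. F \<subseteq> S \<and> card F = d \<longrightarrow> F \<in> C)"

definition closed_neighborhood :: "'a set set \<Rightarrow> 'a set \<Rightarrow> 'a set" where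
  "closed_neighborhood C Z = Z \<union> {x. x \<notin> Z \<and> (\<exists>E\<in>C. x \<in> E \<and> E \<subseteq> Z \<union> {x})}"

text \<open>A set \<open>Z\<close> contained in no circuit qualifies vacuously. Deleting it changes nothing,
  so such sets have no effect on the least fixed point \<open>chordal_clutter\<close>.\<close>

definition simplicial_maximal_subcircuit ::
    "nat \<Rightarrow> 'a set \<Rightarrow> 'a set set \<Rightarrow> 'a set \<Rightarrow> bool" where
  "simplicial_maximal_subcircuit d V C Z \<longleftrightarrow>
     Z \<subseteq> V \<and> finite Z \<and> card Z = d - 1 \<and> clutter_clique d V C (closed_neighborhood C Z)"

definition clutter_deletion :: "'a set set \<Rightarrow> 'a set \<Rightarrow> 'a set set" where
  "clutter_deletion C Z = {E \<in> C. \<not> Z \<subseteq> E}"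

inductive chordal_clutter :: "nat \<Rightarrow> 'a set \<Rightarrow> 'a set set \<Rightarrow> bool" for d V where
  no_circuits: "chordal_clutter d V {}"
| delete: "\<lbrakk>simplicial_maximal_subcircuit d V C Z; chordal_clutter d V (clutter_deletion C Z)\<rbrakk>
    \<Longrightarrow> chordal_clutter d V C"

definition cochordal_clutter :: "nat \<Rightarrow> 'a set \<Rightarrow> 'a set set \<Rightarrow> bool" where
  "cochordal_clutter d V C \<longleftrightarrow> chordal_clutter d V (clutter_complement d V C)"


section \<open>Simplicial complexes\<close>

text \<open>A simplicial complex is given by its set of faces. The void complex \<open>{}\<close> (no faces at
  all) is distinguished from \<open>{{}}\<close>; it is the value of \<open>Sigma_complex r G\<close> when no
  \<open>r\<close>-subset induces a connected subgraph.\<close>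

definition Sigma_complex :: "nat \<Rightarrow> ('a, 'b) pre_digraph \<Rightarrow> 'a set set" where
  "Sigma_complex r G = {F. \<exists>W\<in>Con r G. F \<subseteq> verts G - W}"

definition facets :: "'a set set \<Rightarrow> 'a set set" where
  "facets \<Delta> = {F \<in> \<Delta>. \<forall>G\<in>\<Delta>. F \<subseteq> G \<longrightarrow> F = G}"

definition vertex_link :: "'a set set \<Rightarrow> 'a \<Rightarrow> 'a set set" where
  "vertex_link \<Delta> v = {F. v \<notin> F \<and> insert v F \<in> \<Delta>}"

definition vertex_deletion :: "'a set set \<Rightarrow> 'a \<Rightarrow> 'a set set" where
  "vertex_deletion \<Delta> v = {F \<in> \<Delta>. v \<notin> F}"

text \<open>Vertex decomposability in the sense of Bjoerner and Wachs (purity is not required).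
  By convention the void complex counts as a simplex.\<close>

inductive vertex_decomposable :: "'a set set \<Rightarrow> bool" where
  void: "vertex_decomposable {}"
| simplex: "finite F \<Longrightarrow> vertex_decomposable (Pow F)"
| shed: "\<lbrakk>{v} \<in> \<Delta>;
     facets (vertex_link \<Delta> v) \<inter> facets (vertex_deletion \<Delta> v) = {};
     vertex_decomposable (vertex_link \<Delta> v);
     vertex_decomposable (vertex_deletion \<Delta> v)\<rbrakk>
    \<Longrightarrow> vertex_decomposable \<Delta>"

text \<open>A shelling is an ordering \<open>F\<^sub>0, F\<^sub>1, \<dots>\<close> of the facets such that, for each \<open>j > 0\<close>, the
  complex \<open>\<langle>F\<^sub>0, \<dots>, F\<^bsub>j-1\<^esub>\<rangle> \<inter> \<langle>F\<^sub>j\<rangle>\<close> is pure of dimension \<open>dim F\<^sub>j - 1\<close>.\<close>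

definition shelling :: "'a set set \<Rightarrow> 'a set list \<Rightarrow> bool" where
  "shelling \<Delta> Fs \<longleftrightarrow> distinct Fs \<and> set Fs = facets \<Delta> \<and>
     (\<forall>j. 0 < j \<and> j < length Fs \<longrightarrow>
        (\<forall>G \<in> facets ((\<Union>i<j. Pow (Fs ! i)) \<inter> Pow (Fs ! j)). card G + 1 = card (Fs ! j)))"

definition shellable :: "'a set set \<Rightarrow> bool" where
  "shellable \<Delta> \<longleftrightarrow> (\<exists>Fs. shelling \<Delta> Fs)"


section \<open>Cohen--Macaulay complexes\<close>

definition krull_dim :: "('a, 'm) ring_scheme \<Rightarrow> enat" where
  "krull_dim R = Sup {enat n | n. \<exists>P :: nat \<Rightarrow> 'a set.
     (\<forall>i\<le>n. primeideal (P i) R) \<and> (\<forall>i<n. P i \<subset> P (Suc i))}"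

definition regular_sequence :: "('a, 'm) ring_scheme \<Rightarrow> 'a list \<Rightarrow> bool" where
  "regular_sequence R xs \<longleftrightarrow> set xs \<subseteq> carrier R \<and>
     (\<forall>i<length xs. \<forall>a\<in>carrier R.
        xs ! i \<otimes>\<^bsub>R\<^esub> a \<in> Idl\<^bsub>R\<^esub> (set (take i xs)) \<longrightarrow> a \<in> Idl\<^bsub>R\<^esub> (set (take i xs))) \<and>
     Idl\<^bsub>R\<^esub> (set xs) \<noteq> carrier R"

definition depth :: "('a, 'm) ring_scheme \<Rightarrow> 'a set \<Rightarrow> enat" where
  "depth R I = Sup {enat (length xs) | xs. regular_sequence R xs \<and> set xs \<subseteq> I}"

text \<open>The polynomial ring over the field \<open>'k\<close> in the variables \<open>x\<^sub>v\<close>, \<open>v \<in> V\<close>: its elements are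
  finitely supported maps from monomials (themselves finitely supported exponent vectors)
  to \<open>'k\<close>.\<close>

definition polynomial_ring ::
    "'k::field itself \<Rightarrow> 'v set \<Rightarrow> (('v \<Rightarrow>\<^sub>0 nat) \<Rightarrow>\<^sub>0 'k) ring" where
  "polynomial_ring _ V =
     \<lparr> carrier = {p. \<forall>m \<in> Poly_Mapping.keys p. Poly_Mapping.keys m \<subseteq> V},
       monoid.mult = (*), one = 1, zero = 0, add = (+) \<rparr>"

definition var :: "'v \<Rightarrow> (('v \<Rightarrow>\<^sub>0 nat) \<Rightarrow>\<^sub>0 'k::field)" where
  "var v = Poly_Mapping.single (Poly_Mapping.single v 1) 1"

definition stanley_reisner_ideal ::
    "'k::field itself \<Rightarrow> 'v set \<Rightarrow> 'v set set \<Rightarrow> (('v \<Rightarrow>\<^sub>0 nat) \<Rightarrow>\<^sub>0 'k) set" where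
  "stanley_reisner_ideal K V \<Delta> =
     Idl\<^bsub>polynomial_ring K V\<^esub> {\<Prod>v\<in>F. var v | F. F \<subseteq> V \<and> finite F \<and> F \<notin> \<Delta>}"

definition stanley_reisner_ring ::
    "'k::field itself \<Rightarrow> 'v set \<Rightarrow> 'v set set \<Rightarrow> (('v \<Rightarrow>\<^sub>0 nat) \<Rightarrow>\<^sub>0 'k) set ring" where
  "stanley_reisner_ring K V \<Delta> = polynomial_ring K V Quot stanley_reisner_ideal K V \<Delta>"

definition irrelevant_ideal ::
    "'k::field itself \<Rightarrow> 'v set \<Rightarrow> 'v set set \<Rightarrow> (('v \<Rightarrow>\<^sub>0 nat) \<Rightarrow>\<^sub>0 'k) set set" where
  "irrelevant_ideal K V \<Delta> =
     Idl\<^bsub>stanley_reisner_ring K V \<Delta>\<^esub>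
       ((\<lambda>v. stanley_reisner_ideal K V \<Delta> +>\<^bsub>polynomial_ring K V\<^esub> var v) ` V)"

text \<open>The complex \<open>\<Delta>\<close> on the vertex set \<open>V\<close> is Cohen--Macaulay over \<open>K\<close> if the standard graded
  algebra \<open>K[\<Delta>]\<close> is, i.e. if its depth with respect to the graded maximal ideal equals its
  Krull dimension. For the void complex \<open>K[\<Delta>]\<close> is the zero ring; both sides are then \<open>Sup {} = 0\<close>,
  in accordance with the convention that the zero ring is Cohen--Macaulay.\<close>

definition cohen_macaulay :: "'k::field itself \<Rightarrow> 'v set \<Rightarrow> 'v set set \<Rightarrow> bool" where
  "cohen_macaulay K V \<Delta> \<longleftrightarrow>
     depth (stanley_reisner_ring K V \<Delta>) (irrelevant_ideal K V \<Delta>) =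
     krull_dim (stanley_reisner_ring K V \<Delta>)"

end

theory Submission
  imports Defs "HOL-Library.Z2"
begin

text \<open>
  Write \<open>m = n - r\<close>. The facets of the complex are the \<open>n\<close> arcs of \<open>m\<close> consecutive vertices of
  the cycle. For \<open>m \<le> 2\<close> it is void, a point set or a cycle, and everything holds: the
  elementary symmetric polynomials of degree 1 and 2, the latter restricted to edges, form a regular
  sequence. For \<open>m \<ge> 3\<close> everything fails.

  Shellability: of the two neighbours of the last arc in a shelling, the later one meets an earlier
  arc in a face that only the last arc could cover.

  Cohen--Macaulayness: Koszul cohomology with respect to (powers of) the variables vanishes below
  the length of any regular sequence in the irrelevant ideal, while it is nonzero in a degree below
  \<open>m\<close>. If \<open>n \<le> 2 r + 1\<close> the complex has the cohomology of a circle; otherwise two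
  disjoint non-adjacent \<open>r\<close>-arcs produce a disconnected link. The Krull dimension is \<open>m\<close> by counting
  monomials: the chain of primes yields too many linearly independent polynomials of bounded degree.

  Chordality of the complementary clutter: homology classes of the clique complex in dimension at
  least \<open>r - 1\<close> survive deletions, and Alexander duality turns the circle into such a class. If
  \<open>n \<ge> 2 r + 2\<close>, no subset of the union of the two \<open>r\<close>-arcs is ever simplicial.
\<close>

section \<open>Ideals, regular sequences and Koszul cohomology\<close>

text \<open>The only implication proved in general is from vertex decomposable to shellable; every
  other condition is compared directly with the inequality \<open>n \<le> r + 2\<close>.

  The threshold \<open>2 r + 2\<close> is the least length of a cycle with room for two
  \<open>r\<close>-arcs separated by a gap on either side. Below it a facet has
  \<open>n - r \<le> r + 1\<close> vertices, so two of its vertices differ by at least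
  \<open>r + 1\<close> exactly when the facet runs through the cut between \<open>n - 1\<close> and
  \<open>0\<close> on its way from one to the other. That criterion makes the circle class an
  explicit function on pairs, and no homotopy type has to be computed.

  The two Koszul classes have degrees \<open>2\<close> and \<open>n - 2 r + 1\<close>. These lie
  below \<open>n - r\<close> because of \<open>r + 3 \<le> n\<close> and of
  \<open>2 \<le> r\<close>, respectively. Both classes are detected by a coefficient that would have
  to be \<open>0\<close> and \<open>1\<close> at once, so the argument works over every field.

  Polynomials have variables indexed by all natural numbers. The ideal used in place of the
  Stanley--Reisner ideal absorbs the variables that are not vertices, so that computations take
  place in a type-class ring without carrier conditions.\<close>

definition ideal_set :: "'a::comm_ring_1 set \<Rightarrow> bool" where
  "ideal_set J \<longleftrightarrow> 0 \<in> J \<and> (\<forall>a\<in>J. \<forall>b\<in>J. a + b \<in> J) \<and> (\<forall>a\<in>J. \<forall>c. c * a \<in> J)"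

lemma ideal_setD:
  assumes "ideal_set J"
  shows ideal_set_zero: "0 \<in> J"
    and ideal_set_add: "\<And>a b. a \<in> J \<Longrightarrow> b \<in> J \<Longrightarrow> a + b \<in> J"
    and ideal_set_mult_left: "\<And>a c. a \<in> J \<Longrightarrow> c * a \<in> J"
    and ideal_set_mult_right: "\<And>a c. a \<in> J \<Longrightarrow> a * c \<in> J"
  using assms unfolding ideal_set_def by (auto simp: mult.commute)

lemma ideal_set_uminus: "ideal_set J \<Longrightarrow> a \<in> J \<Longrightarrow> - a \<in> J"
  using ideal_set_mult_left[of J a "-1"] by simp

lemma ideal_set_diff: "ideal_set J \<Longrightarrow> a \<in> J \<Longrightarrow> b \<in> J \<Longrightarrow> a - b \<in> J"
  using ideal_set_add[of J a "- b"] ideal_set_uminus[of J b] by simp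

lemma ideal_set_sum: "ideal_set J \<Longrightarrow> (\<And>i. i \<in> A \<Longrightarrow> g i \<in> J) \<Longrightarrow> sum g A \<in> J"
  by (induction A rule: infinite_finite_induct) (auto simp: ideal_set_zero ideal_set_add)

definition add_gen :: "'a::comm_ring_1 set \<Rightarrow> 'a \<Rightarrow> 'a set" where
  "add_gen J f = {j + f * a | j a. j \<in> J}"

lemma subset_add_gen: "J \<subseteq> add_gen J f"
proof
  fix j assume "j \<in> J"
  then have "j + f * 0 \<in> add_gen J f" unfolding add_gen_def by blast
  then show "j \<in> add_gen J f" by simp
qed

lemma ideal_set_add_gen:
  assumes "ideal_set J" shows "ideal_set (add_gen J f)"
  unfolding ideal_set_def
proof (intro conjI ballI allI)
  show "0 \<in> add_gen J f"
    using subset_add_gen[of J f] ideal_set_zero[OF assms] by blast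
next
  fix a b assume "a \<in> add_gen J f" "b \<in> add_gen J f"
  then obtain j c j' c' where "a = j + f * c" "b = j' + f * c'" "j \<in> J" "j' \<in> J"
    unfolding add_gen_def by blast
  then have "a + b = (j + j') + f * (c + c')" "j + j' \<in> J"
    using ideal_set_add[OF assms] by (simp_all add: algebra_simps)
  then show "a + b \<in> add_gen J f" unfolding add_gen_def by blast
next
  fix a c assume "a \<in> add_gen J f"
  then obtain j d where "a = j + f * d" "j \<in> J" unfolding add_gen_def by blast
  then have "c * a = c * j + f * (c * d)" "c * j \<in> J"
    using ideal_set_mult_left[OF assms] by (simp_all add: distrib_left mult.left_commute)
  then show "c * a \<in> add_gen J f" unfolding add_gen_def by blast
qed

lemma gen_in_add_gen:
  assumes "ideal_set J" shows "f \<in> add_gen J f"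
proof -
  have "0 + f * 1 \<in> add_gen J f" using ideal_set_zero[OF assms] unfolding add_gen_def by blast
  then show ?thesis by simp
qed

lemma add_gen_minimal: "ideal_set I \<Longrightarrow> J \<subseteq> I \<Longrightarrow> f \<in> I \<Longrightarrow> add_gen J f \<subseteq> I"
  unfolding add_gen_def by (auto intro!: ideal_set_add ideal_set_mult_right)

fun adjoin :: "'a::comm_ring_1 set \<Rightarrow> 'a list \<Rightarrow> 'a set" where
  "adjoin J [] = J"
| "adjoin J (f # fs) = adjoin (add_gen J f) fs"

text \<open>The recursion enlarges the ideal instead of passing to quotient rings; inductions on a
  sequence therefore run with \<open>J\<close> arbitrary. The base case records that the last
  quotient is nonzero.\<close>

fun regular_list :: "'a::comm_ring_1 set \<Rightarrow> 'a list \<Rightarrow> bool" where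
  "regular_list J [] \<longleftrightarrow> 1 \<notin> J"
| "regular_list J (f # fs) \<longleftrightarrow> (\<forall>a. f * a \<in> J \<longrightarrow> a \<in> J) \<and> regular_list (add_gen J f) fs"

lemma ideal_set_adjoin: "ideal_set J \<Longrightarrow> ideal_set (adjoin J fs)"
  by (induction fs arbitrary: J) (auto simp: ideal_set_add_gen)

lemma subset_adjoin: "J \<subseteq> adjoin J fs"
proof (induction fs arbitrary: J)
  case (Cons f fs)
  then show ?case using subset_add_gen[of J f] by fastforce
qed simp

lemma gen_in_adjoin: "ideal_set J \<Longrightarrow> set fs \<subseteq> adjoin J fs"
proof (induction fs arbitrary: J)
  case (Cons f fs)
  then show ?case
    using ideal_set_add_gen[of J f] gen_in_add_gen[of J f] subset_adjoin[of "add_gen J f" fs] by auto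
qed simp

lemma adjoin_minimal: "ideal_set I \<Longrightarrow> J \<subseteq> I \<Longrightarrow> set fs \<subseteq> I \<Longrightarrow> adjoin J fs \<subseteq> I"
proof (induction fs arbitrary: J)
  case (Cons f fs)
  then show ?case using Cons.IH[of "add_gen J f"] add_gen_minimal[of I J f] by simp
qed simp

lemma regular_list_iff_nth:
  "regular_list J fs \<longleftrightarrow>
     (\<forall>i<length fs. \<forall>a. fs ! i * a \<in> adjoin J (take i fs) \<longrightarrow> a \<in> adjoin J (take i fs)) \<and>
     1 \<notin> adjoin J fs"
  by (induction fs arbitrary: J) (simp, simp add: All_less_Suc2 conj_assoc)

section \<open>Prime ideals and chains of primes\<close>

definition prime_set :: "'a::comm_ring_1 set \<Rightarrow> bool" where
  "prime_set Q \<longleftrightarrow> ideal_set Q \<and> 1 \<notin> Q \<and> (\<forall>a b. a * b \<in> Q \<longrightarrow> a \<in> Q \<or> b \<in> Q)"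

text \<open>Krull's argument: an ideal maximal among those disjoint from a multiplicative set is
  prime. If neither factor lay in it, enlarging by each factor would meet \<open>S\<close>, and the
  product of the two elements found would lie in both.\<close>

lemma exists_prime_avoiding:
  assumes J: "ideal_set J" and S: "1 \<in> S" "\<And>a b. a \<in> S \<Longrightarrow> b \<in> S \<Longrightarrow> a * b \<in> S"
    and disj: "J \<inter> S = {}"
  obtains Q where "prime_set Q" "J \<subseteq> Q" "Q \<inter> S = {}"
proof -
  define A where "A = {I. ideal_set I \<and> J \<subseteq> I \<and> I \<inter> S = {}}"
  have "\<exists>M\<in>A. \<forall>X\<in>A. M \<subseteq> X \<longrightarrow> X = M"
  proof (rule subset_Zorn_nonempty)
    show "A \<noteq> {}" using J disj unfolding A_def by blast
  next
    fix C assume C: "C \<noteq> {}" "subset.chain A C"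
    have "ideal_set (\<Union>C)" unfolding ideal_set_def
    proof (intro conjI ballI allI)
      show "0 \<in> \<Union>C" using C unfolding subset_chain_def A_def by (auto simp: ideal_set_def)
    next
      fix a b assume "a \<in> \<Union>C" "b \<in> \<Union>C"
      then obtain X Y where "X \<in> C" "Y \<in> C" "a \<in> X" "b \<in> Y" by blast
      then obtain Z where "Z \<in> C" "a \<in> Z" "b \<in> Z" using C(2) unfolding subset_chain_def by blast
      moreover have "ideal_set Z" using \<open>Z \<in> C\<close> C(2) unfolding subset_chain_def A_def by blast
      ultimately show "a + b \<in> \<Union>C" using ideal_set_add by blast
    next
      fix a c assume "a \<in> \<Union>C"
      then obtain Z where "Z \<in> C" "a \<in> Z" by blast
      moreover have "ideal_set Z" using \<open>Z \<in> C\<close> C(2) unfolding subset_chain_def A_def by blast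
      ultimately show "c * a \<in> \<Union>C" using ideal_set_mult_left by blast
    qed
    then show "\<Union>C \<in> A" using C unfolding subset_chain_def A_def by blast
  qed
  then obtain M where M: "M \<in> A" "\<And>X. X \<in> A \<Longrightarrow> M \<subseteq> X \<Longrightarrow> X = M" by blast
  have iM: "ideal_set M" "J \<subseteq> M" "M \<inter> S = {}" using M(1) unfolding A_def by auto
  have meets: "\<exists>j c. j \<in> M \<and> j + a * c \<in> S" if "a \<notin> M" for a
  proof -
    have "add_gen M a \<noteq> M" using gen_in_add_gen[OF iM(1), of a] that by blast
    then have "add_gen M a \<notin> A" using M(2) subset_add_gen[of M a] by blast
    then have "add_gen M a \<inter> S \<noteq> {}"
      unfolding A_def using ideal_set_add_gen[OF iM(1)] subset_add_gen[of M a] iM(2) by auto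
    then show ?thesis unfolding add_gen_def by blast
  qed
  have "prime_set M" unfolding prime_set_def
  proof (intro conjI allI impI)
    show "ideal_set M" "1 \<notin> M" using iM S by auto
  next
    fix a b assume ab: "a * b \<in> M"
    show "a \<in> M \<or> b \<in> M"
    proof (rule ccontr)
      assume "\<not> ?thesis"
      then obtain j c j' c' where jc: "j \<in> M" "j + a * c \<in> S" "j' \<in> M" "j' + b * c' \<in> S"
        using meets[of a] meets[of b] by blast
      have "(j + a * c) * (j' + b * c') = (j' + b * c') * j + (a * c) * j' + (c * c') * (a * b)"
        by (simp add: algebra_simps)
      also have "\<dots> \<in> M"
        using jc ab ideal_set_add[OF iM(1)] ideal_set_mult_left[OF iM(1)] by metis
      finally show False using S(2)[OF jc(2,4)] iM(3) by blast
    qed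
  qed
  then show thesis using that iM by blast
qed

text \<open>This is the inequality between depth and dimension. The chain grows downwards: below a
  chain starting over \<open>add_gen J f\<close> a further prime is inserted that contains
  \<open>J\<close> but not \<open>f\<close>.\<close>

lemma regular_list_prime_chain:
  assumes "ideal_set J" "regular_list J fs"
  shows "\<exists>P. (\<forall>i\<le>length fs. prime_set (P i)) \<and> (\<forall>i<length fs. P i \<subset> P (Suc i)) \<and> J \<subseteq> P 0"
  using assms
proof (induction fs arbitrary: J)
  case Nil
  then obtain Q where "prime_set Q" "J \<subseteq> Q"
    using exists_prime_avoiding[of J "{1}"] by auto
  then show ?case by (intro exI[of _ "\<lambda>_. Q"]) auto
next
  case (Cons f fs)
  have reg: "f * a \<in> J \<Longrightarrow> a \<in> J" for a using Cons.prems by auto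
  obtain P where P: "\<forall>i\<le>length fs. prime_set (P i)" "\<forall>i<length fs. P i \<subset> P (Suc i)"
      "add_gen J f \<subseteq> P 0"
    using Cons.IH[OF ideal_set_add_gen[OF Cons.prems(1)], of f] Cons.prems(2) by auto
  have P0: "prime_set (P 0)" using P by auto
  \<comment> \<open>A prime disjoint from \<open>S\<close> lies inside \<open>P 0\<close> (take
    \<open>k = 0\<close>) and misses \<open>f\<close> (take \<open>s = 1\<close>,
    \<open>k = 1\<close>). Disjointness of \<open>S\<close> from \<open>J\<close> is where
    regularity of \<open>f\<close> enters.\<close>
  define S where "S = {s * f ^ k | s k. s \<notin> P 0}"
  have "J \<inter> S = {}"
  proof -
    have "s * f ^ k \<in> J \<Longrightarrow> s \<in> J" for s k
    proof (induction k arbitrary: s)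
      case (Suc k)
      then show ?case using reg[of "s * f ^ k"] by (simp add: algebra_simps)
    qed simp
    moreover have "J \<subseteq> P 0" using P(3) subset_add_gen by blast
    ultimately show ?thesis unfolding S_def by blast
  qed
  moreover have "1 \<in> S" unfolding S_def using P0 by (force simp: prime_set_def intro: exI[of _ 1] exI[of _ 0])
  moreover have "a * b \<in> S" if ab: "a \<in> S" "b \<in> S" for a b
  proof -
    obtain s k s' k' where "a = s * f ^ k" "b = s' * f ^ k'" "s \<notin> P 0" "s' \<notin> P 0"
      using ab unfolding S_def by blast
    then have "a * b = (s * s') * f ^ (k + k')" "s * s' \<notin> P 0"
      using P0 unfolding prime_set_def by (auto simp: power_add algebra_simps)
    then show ?thesis unfolding S_def by blast
  qed
  ultimately obtain Q where Q: "prime_set Q" "J \<subseteq> Q" "Q \<inter> S = {}"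
    using exists_prime_avoiding[of J S] Cons.prems by blast
  have "Q \<subseteq> P 0" using Q(3) unfolding S_def by (force intro: exI[of _ 0])
  moreover have "f \<notin> Q"
  proof -
    have "1 * f ^ 1 \<in> S" unfolding S_def using P0 unfolding prime_set_def by blast
    then show ?thesis using Q(3) by auto
  qed
  moreover have "f \<in> P 0" using P(3) gen_in_add_gen[of J f] Cons.prems by auto
  ultimately have "Q \<subset> P 0" by blast
  then show ?case
    using P(1,2) Q(1,2) by (intro exI[of _ "\<lambda>i. case i of 0 \<Rightarrow> Q | Suc k \<Rightarrow> P k"]) (auto split: nat.split)
qed

section \<open>The Koszul complex\<close>

definition ksgn :: "nat \<Rightarrow> nat set \<Rightarrow> 'a::comm_ring_1" where
  "ksgn s S = (-1) ^ card {t\<in>S. t < s}"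

text \<open>Exterior multiplication by the sum of all \<open>y s\<close> times the basis vector of
  \<open>s\<close>, in coordinates: \<open>w S\<close> is the coefficient of the basis element of
  \<open>S\<close>. Degrees are not part of the data; only the values on sets of the relevant
  cardinality matter.\<close>

definition kd :: "(nat \<Rightarrow> 'a::comm_ring_1) \<Rightarrow> (nat set \<Rightarrow> 'a) \<Rightarrow> nat set \<Rightarrow> 'a" where
  "kd y w S = (\<Sum>s\<in>S. ksgn s S * y s * w (S - {s}))"

lemma ksgn_square [simp]: "ksgn s S * ksgn s S = 1"
  unfolding ksgn_def by (simp flip: power_mult_distrib)

lemma ksgn_remove:
  assumes "finite S" "t \<in> S"
  shows "ksgn s (S - {t}) = (if t < s then - ksgn s S else ksgn s S)"
proof (cases "t < s")
  case True
  have "{u\<in>S. u < s} = insert t {u\<in>S - {t}. u < s}" using assms True by auto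
  then have "card {u\<in>S. u < s} = Suc (card {u\<in>S - {t}. u < s})" using assms by simp
  then show ?thesis using True by (simp add: ksgn_def)
next
  case False
  then have "{u\<in>S - {t}. u < s} = {u\<in>S. u < s}" by auto
  then show ?thesis using False by (simp add: ksgn_def)
qed

lemma ksgn_remove_self: "ksgn s (S - {s}) = ksgn s S"
proof -
  have "{u\<in>S - {s}. u < s} = {u\<in>S. u < s}" by auto
  then show ?thesis by (simp add: ksgn_def)
qed

text \<open>The sum is split into \<open>s < t\<close> and \<open>t < s\<close> and the halves are
  matched. Showing that it equals its own negative would not suffice in characteristic two.\<close>

lemma sum_antisymmetric:
  fixes g :: "nat \<Rightarrow> nat \<Rightarrow> 'a::comm_ring_1"
  assumes "finite S" "\<And>s t. s \<in> S \<Longrightarrow> t \<in> S \<Longrightarrow> s < t \<Longrightarrow> g t s = - g s t"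
  shows "(\<Sum>s\<in>S. \<Sum>t\<in>S - {s}. g s t) = 0"
proof -
  have "(\<Sum>t\<in>S - {s}. g s t) = (\<Sum>t\<in>S. if s < t then g s t else 0) + (\<Sum>t\<in>S. if t < s then g s t else 0)" for s
  proof -
    have "(\<Sum>t\<in>S - {s}. g s t) = (\<Sum>t\<in>S. (if s < t then g s t else 0) + (if t < s then g s t else 0))"
      using assms(1) by (intro sum.mono_neutral_cong_left) auto
    then show ?thesis by (simp add: sum.distrib)
  qed
  then have "(\<Sum>s\<in>S. \<Sum>t\<in>S - {s}. g s t) =
      (\<Sum>s\<in>S. \<Sum>t\<in>S. if s < t then g s t else 0) + (\<Sum>s\<in>S. \<Sum>t\<in>S. if t < s then g s t else 0)"
    by (simp add: sum.distrib)
  also have "(\<Sum>s\<in>S. \<Sum>t\<in>S. if t < s then g s t else 0) = (\<Sum>t\<in>S. \<Sum>s\<in>S. if t < s then g s t else 0)"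
    by (rule sum.swap)
  also have "\<dots> = (\<Sum>s\<in>S. \<Sum>t\<in>S. - (if s < t then g s t else 0))"
    by (intro sum.cong refl) (use assms(2) in auto)
  finally show ?thesis by (simp add: sum_negf)
qed

lemma kd_kd:
  assumes "finite S" shows "kd y (kd y w) S = 0"
proof -
  have "kd y (kd y w) S =
     (\<Sum>s\<in>S. \<Sum>t\<in>S - {s}. (ksgn s S * y s) * (ksgn t (S - {s}) * y t * w (S - {s} - {t})))"
    unfolding kd_def by (simp add: sum_distrib_left)
  also have "\<dots> = 0"
  proof (rule sum_antisymmetric)
    fix s t assume "s \<in> S" "t \<in> S" "s < t"
    moreover have "S - {t} - {s} = S - {s} - {t}" by auto
    ultimately show "ksgn t S * y t * (ksgn s (S - {t}) * y s * w (S - {t} - {s})) =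
        - (ksgn s S * y s * (ksgn t (S - {s}) * y t * w (S - {s} - {t})))"
      using assms by (simp add: ksgn_remove algebra_simps)
  qed fact
  finally show ?thesis .
qed

text \<open>Contraction with the basis vector of \<open>v\<close>.\<close>

definition kh :: "nat \<Rightarrow> (nat set \<Rightarrow> 'a::comm_ring_1) \<Rightarrow> nat set \<Rightarrow> 'a" where
  "kh v w S = (if v \<in> S then 0 else ksgn v S * w (insert v S))"

text \<open>Contraction is a homotopy from multiplication by \<open>y v\<close> to zero, so every
  \<open>y v\<close> annihilates Koszul cohomology. If \<open>v\<close> lies in \<open>S\<close>
  only the summand of \<open>v\<close> survives; otherwise all other summands cancel in
  pairs.\<close>

lemma kd_homotopy:
  fixes w :: "nat set \<Rightarrow> 'a::comm_ring_1"
  assumes "finite S" shows "kd y (kh v w) S + kh v (kd y w) S = y v * w S"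
proof (cases "v \<in> S")
  case True
  have "kd y (kh v w) S = (\<Sum>s\<in>S. if s = v then y v * w S else 0)"
    unfolding kd_def
  proof (rule sum.cong)
    fix s assume "s \<in> S"
    then show "ksgn s S * y s * kh v w (S - {s}) = (if s = v then y v * w S else 0)"
      using True by (auto simp: kh_def ksgn_remove_self insert_absorb mult_ac)
  qed simp
  then show ?thesis using True assms by (simp add: kh_def)
next
  case False
  let ?T = "insert v S"
  have rem: "(ksgn s S :: 'a) = (if v < s then - ksgn s ?T else ksgn s ?T)" for s
    using ksgn_remove[of ?T v s] False assms by simp
  have rem': "(ksgn v ?T :: 'a) = ksgn v S" using rem[of v] by simp
  have "kh v (kd y w) S = ksgn v S * (\<Sum>s\<in>?T. ksgn s ?T * y s * w (?T - {s}))"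
    using False by (simp add: kh_def kd_def)
  also have "\<dots> = ksgn v S * (ksgn v ?T * y v * w S + (\<Sum>s\<in>S. ksgn s ?T * y s * w (?T - {s})))"
    using False assms by simp
  also have "\<dots> = y v * w S + (\<Sum>s\<in>S. ksgn v S * (ksgn s ?T * y s * w (?T - {s})))"
    using ksgn_square[of v S, where 'a='a] rem'
    by (simp add: distrib_left sum_distrib_left flip: mult.assoc)
  finally have 1: "kh v (kd y w) S = \<dots>" .
  have "kd y (kh v w) S = (\<Sum>s\<in>S. - (ksgn v S * (ksgn s ?T * y s * w (?T - {s}))))"
    unfolding kd_def
  proof (rule sum.cong)
    fix s assume s: "s \<in> S"
    have "insert v (S - {s}) = ?T - {s}" using False s by auto
    then show "ksgn s S * y s * kh v w (S - {s}) = - (ksgn v S * (ksgn s ?T * y s * w (?T - {s})))"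
      using False s assms rem[of s] by (auto simp: kh_def ksgn_remove mult_ac)
  qed simp
  then show ?thesis using 1 by (simp add: sum_negf)
qed

lemma kd_linear:
  "kd y (\<lambda>S. a * w S + b * w' S) S = a * kd y w S + b * kd y w' S"
  unfolding kd_def by (simp add: sum_distrib_left sum.distrib algebra_simps)

lemma kd_mult: "kd y (\<lambda>S. a * w S) S = a * kd y w S"
  using kd_linear[of y a w 0 w S] by simp

lemma kd_diff: "kd y (\<lambda>S. w S - w' S) S = kd y w S - kd y w' S"
  using kd_linear[of y 1 w "-1" w' S] by simp

lemma kd_add: "kd y (\<lambda>S. w S + w' S) S = kd y w S + kd y w' S"
  using kd_linear[of y 1 w 1 w' S] by simp

lemma kd_in_ideal:
  assumes "ideal_set J" "\<And>s. s \<in> S \<Longrightarrow> w (S - {s}) \<in> J" shows "kd y w S \<in> J"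
  unfolding kd_def using assms by (intro ideal_set_sum ideal_set_mult_left) auto

definition kcocycle :: "nat set \<Rightarrow> (nat \<Rightarrow> 'a::comm_ring_1) \<Rightarrow> 'a set \<Rightarrow> nat \<Rightarrow> (nat set \<Rightarrow> 'a) \<Rightarrow> bool" where
  "kcocycle V y J i w \<longleftrightarrow> (\<forall>S. S \<subseteq> V \<and> card S = Suc i \<longrightarrow> kd y w S \<in> J)"

definition kboundary :: "nat set \<Rightarrow> (nat \<Rightarrow> 'a::comm_ring_1) \<Rightarrow> 'a set \<Rightarrow> nat \<Rightarrow> (nat set \<Rightarrow> 'a) \<Rightarrow> bool" where
  "kboundary V y J i w \<longleftrightarrow> (\<exists>z. \<forall>S. S \<subseteq> V \<and> card S = i \<longrightarrow> w S - kd y z S \<in> J)"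

text \<open>This is the annihilator of the cohomology class of \<open>w\<close>. Being an ideal, it
  can be fed into the hypothesis that some power of \<open>f\<close> lies in every ideal containing
  \<open>J\<close> and the \<open>y v\<close>.\<close>

lemma ideal_set_kboundary:
  assumes "ideal_set J" shows "ideal_set {g. kboundary V y J i (\<lambda>S. g * w S)}"
  unfolding ideal_set_def kboundary_def mem_Collect_eq
proof (intro conjI ballI allI)
  have "\<forall>S. S \<subseteq> V \<and> card S = i \<longrightarrow> 0 * w S - kd y (\<lambda>_. 0) S \<in> J"
    using assms by (simp add: kd_def ideal_set_zero)
  then show "\<exists>z. \<forall>S. S \<subseteq> V \<and> card S = i \<longrightarrow> 0 * w S - kd y z S \<in> J" by blast
next
  fix a b
  assume "a \<in> {g. \<exists>z. \<forall>S. S \<subseteq> V \<and> card S = i \<longrightarrow> g * w S - kd y z S \<in> J}"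
    and "b \<in> {g. \<exists>z. \<forall>S. S \<subseteq> V \<and> card S = i \<longrightarrow> g * w S - kd y z S \<in> J}"
  then obtain z z' where z: "\<forall>S. S \<subseteq> V \<and> card S = i \<longrightarrow> a * w S - kd y z S \<in> J"
      "\<forall>S. S \<subseteq> V \<and> card S = i \<longrightarrow> b * w S - kd y z' S \<in> J"
    by blast
  have "(a + b) * w S - kd y (\<lambda>S. z S + z' S) S = (a * w S - kd y z S) + (b * w S - kd y z' S)" for S
    by (simp add: kd_add algebra_simps)
  then have "\<forall>S. S \<subseteq> V \<and> card S = i \<longrightarrow> (a + b) * w S - kd y (\<lambda>S. z S + z' S) S \<in> J"
    using z ideal_set_add[OF assms] by metis
  then show "\<exists>z. \<forall>S. S \<subseteq> V \<and> card S = i \<longrightarrow> (a + b) * w S - kd y z S \<in> J" by blast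
next
  fix a c
  assume "a \<in> {g. \<exists>z. \<forall>S. S \<subseteq> V \<and> card S = i \<longrightarrow> g * w S - kd y z S \<in> J}"
  then obtain z where z: "\<forall>S. S \<subseteq> V \<and> card S = i \<longrightarrow> a * w S - kd y z S \<in> J" by blast
  have "(c * a) * w S - kd y (\<lambda>S. c * z S) S = c * (a * w S - kd y z S)" for S
    by (simp add: kd_mult algebra_simps)
  then have "\<forall>S. S \<subseteq> V \<and> card S = i \<longrightarrow> (c * a) * w S - kd y (\<lambda>S. c * z S) S \<in> J"
    using z ideal_set_mult_left[OF assms] by metis
  then show "\<exists>z. \<forall>S. S \<subseteq> V \<and> card S = i \<longrightarrow> (c * a) * w S - kd y z S \<in> J" by blast
qed

lemma kboundary_gen:
  assumes "finite V" "ideal_set J" "kcocycle V y J i w" "v \<in> V"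
  shows "kboundary V y J i (\<lambda>S. y v * w S)"
  unfolding kboundary_def
proof (intro exI[of _ "kh v w"] allI impI)
  fix S assume S: "S \<subseteq> V \<and> card S = i"
  then have fin: "finite S" using assms finite_subset by blast
  have "y v * w S - kd y (kh v w) S = kh v (kd y w) S"
    using kd_homotopy[OF fin, of y v w] by (simp add: algebra_simps)
  also have "\<dots> \<in> J"
  proof (cases "v \<in> S")
    case False
    then have "card (insert v S) = Suc i" "insert v S \<subseteq> V" using S fin assms by auto
    then have "kd y w (insert v S) \<in> J" using assms unfolding kcocycle_def by blast
    then show ?thesis using False assms by (simp add: kh_def ideal_set_mult_left)
  qed (simp add: kh_def ideal_set_zero assms)
  finally show "y v * w S - kd y (kh v w) S \<in> J" .
qed

text \<open>Injectivity of multiplication by \<open>f\<close> on degree \<open>i\<close> cohomology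
  modulo \<open>J\<close>: in the long exact sequence its kernel comes from degree
  \<open>i - 1\<close> modulo \<open>add_gen J f\<close>, where \<open>exact\<close> makes every
  class trivial. The connecting map is unwound by hand.\<close>

lemma kboundary_cancel:
  assumes V: "finite V" and J: "ideal_set J" and reg: "\<And>a. f * a \<in> J \<Longrightarrow> a \<in> J"
    and w: "kcocycle V y J i w" and fw: "kboundary V y J i (\<lambda>S. f * w S)"
    and exact: "\<And>j z. i = Suc j \<Longrightarrow> kcocycle V y (add_gen J f) j z \<Longrightarrow> kboundary V y (add_gen J f) j z"
  shows "kboundary V y J i w"
proof -
  obtain z where z: "\<And>S. S \<subseteq> V \<Longrightarrow> card S = i \<Longrightarrow> f * w S - kd y z S \<in> J"
    using fw unfolding kboundary_def by blast
  have fin: "S \<subseteq> V \<Longrightarrow> finite S" for S using V finite_subset by blast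
  show ?thesis
  proof (cases i)
    case 0
    \<comment> \<open>There are no boundaries in degree zero: the differential is an empty sum on
      the empty set.\<close>
    have "f * w {} \<in> J" using z[of "{}"] 0 by (simp add: kd_def)
    then have "w {} \<in> J" by (rule reg)
    moreover have "S = {}" if "S \<subseteq> V" "card S = 0" for S using that fin by auto
    ultimately have "\<forall>S. S \<subseteq> V \<and> card S = i \<longrightarrow> w S - kd y (\<lambda>_. 0) S \<in> J"
      using 0 by (auto simp: kd_def)
    then show ?thesis unfolding kboundary_def by blast
  next
    case (Suc j)
    \<comment> \<open>The cochain \<open>z\<close> has boundary \<open>f * w\<close> modulo
      \<open>J\<close>, which vanishes modulo \<open>f\<close>.\<close>
    have "kcocycle V y (add_gen J f) j z" unfolding kcocycle_def
    proof (intro allI impI)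
      fix S assume S: "S \<subseteq> V \<and> card S = Suc j"
      have "kd y z S = - (f * w S - kd y z S) + f * w S" by simp
      moreover have "- (f * w S - kd y z S) \<in> J" using z[of S] S Suc J by (simp only: ideal_set_uminus)
      ultimately show "kd y z S \<in> add_gen J f" unfolding add_gen_def by blast
    qed
    then obtain u where u: "\<And>S. S \<subseteq> V \<Longrightarrow> card S = j \<Longrightarrow> z S - kd y u S \<in> add_gen J f"
      using exact[OF Suc, of z] unfolding kboundary_def by auto
    \<comment> \<open>Modulo \<open>J\<close>, \<open>z - kd y u\<close> is a multiple of
      \<open>f\<close>, and \<open>t\<close> is a chosen quotient. Applying \<open>kd\<close>
      removes \<open>u\<close>, and cancelling \<open>f\<close> leaves \<open>t\<close> as a
      primitive of \<open>w\<close>.\<close>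
    define t where "t S = (SOME a. \<exists>e\<in>J. z S - kd y u S = e + f * a)" for S
    have t: "z S - kd y u S - f * t S \<in> J" if S: "S \<subseteq> V" "card S = j" for S
    proof -
      have "\<exists>a. \<exists>e\<in>J. z S - kd y u S = e + f * a" using u[OF S] unfolding add_gen_def by blast
      then have "\<exists>e\<in>J. z S - kd y u S = e + f * t S" unfolding t_def by (rule someI_ex)
      then show ?thesis by auto
    qed
    have "w S - kd y t S \<in> J" if S: "S \<subseteq> V" "card S = i" for S
    proof (rule reg)
      have "kd y (\<lambda>S. z S - kd y u S - f * t S) S \<in> J"
      proof (rule kd_in_ideal[OF J])
        fix s assume "s \<in> S"
        then show "z (S - {s}) - kd y u (S - {s}) - f * t (S - {s}) \<in> J"
          using S Suc fin[OF S(1)] by (intro t) auto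
      qed
      moreover have "kd y (\<lambda>S. z S - kd y u S - f * t S) S = kd y z S - f * kd y t S"
        by (simp add: kd_diff kd_mult kd_kd fin[OF S(1)])
      ultimately have "(f * w S - kd y z S) + (kd y z S - f * kd y t S) \<in> J"
        using ideal_set_add[OF J z[OF S]] by metis
      then show "f * (w S - kd y t S) \<in> J" by (simp add: algebra_simps)
    qed
    then show ?thesis unfolding kboundary_def by blast
  qed
qed

text \<open>The grade sensitivity of the Koszul complex, with the sequence \<open>y\<close> only generating an
  ideal up to radical: each \<open>f\<close> acts injectively on the cohomology by the long exact sequence
  of \<open>f\<close>, while a power of \<open>f\<close> annihilates it.\<close>

lemma koszul_vanishing:
  assumes "finite V" "ideal_set J" "regular_list J fs" "i < length fs"
    and "\<And>f I. f \<in> set fs \<Longrightarrow> ideal_set I \<Longrightarrow> J \<subseteq> I \<Longrightarrow> y ` V \<subseteq> I \<Longrightarrow> \<exists>k. f ^ k \<in> I"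
    and "kcocycle V y J i w"
  shows "kboundary V y J i w"
  using assms(2-)
proof (induction fs arbitrary: J i w)
  case (Cons f fs)
  have reg: "f * a \<in> J \<Longrightarrow> a \<in> J" for a using Cons.prems(2) by auto
  have rad: "\<exists>k. g ^ k \<in> I" if "g \<in> set fs" "ideal_set I" "add_gen J f \<subseteq> I" "y ` V \<subseteq> I" for g I
    using Cons.prems(4)[of g I] that subset_add_gen[of J f] by (auto simp: subset_iff)
  have exact: "kboundary V y (add_gen J f) j z"
    if "i = Suc j" "kcocycle V y (add_gen J f) j z" for j z
    using Cons.IH[OF ideal_set_add_gen[OF Cons.prems(1)], of f j z] Cons.prems(2,3) that rad by auto
  let ?A = "{g. kboundary V y J i (\<lambda>S. g * w S)}"
  have "J \<subseteq> ?A"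
  proof
    fix a assume "a \<in> J"
    then have "\<forall>S. S \<subseteq> V \<and> card S = i \<longrightarrow> a * w S - kd y (\<lambda>_. 0) S \<in> J"
      using ideal_set_mult_right[OF Cons.prems(1)] by (simp add: kd_def)
    then show "a \<in> ?A" unfolding kboundary_def by blast
  qed
  moreover have "y ` V \<subseteq> ?A"
    using kboundary_gen[OF assms(1) Cons.prems(1,5)] by blast
  ultimately obtain k where k: "f ^ k \<in> ?A"
    using Cons.prems(4)[of f ?A] ideal_set_kboundary[OF Cons.prems(1), of V y i w] by (force simp del: mem_Collect_eq)
  \<comment> \<open>The power of \<open>f\<close> is stripped off one factor at a time:
    \<open>f ^ k * w\<close> is again a cocycle, so cancellation applies to it.\<close>
  have "f ^ k \<in> ?A \<Longrightarrow> 1 \<in> ?A" for k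
  proof (induction k)
    case (Suc k)
    have "kcocycle V y J i (\<lambda>S. f ^ k * w S)"
      using Cons.prems(1,5) unfolding kcocycle_def by (auto simp: kd_mult ideal_set_mult_left)
    moreover have "kboundary V y J i (\<lambda>S. f * (f ^ k * w S))"
      using Suc.prems by (simp add: mult.assoc)
    ultimately have "kboundary V y J i (\<lambda>S. f ^ k * w S)"
      using kboundary_cancel[OF assms(1) Cons.prems(1) reg _ _ exact] by blast
    then show ?case using Suc.IH by simp
  qed simp
  then show ?case using k by simp
qed simp

section \<open>Stanley--Reisner ideals and dimension\<close>

abbreviation "lkp \<equiv> Poly_Mapping.lookup"
abbreviation "kys \<equiv> Poly_Mapping.keys"
abbreviation "sngl \<equiv> Poly_Mapping.single"

lemma keys_plus_nat: "kys (a + b :: 'v \<Rightarrow>\<^sub>0 nat) = kys a \<union> kys b"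
  by (auto simp: in_keys_iff lookup_add)

lemma sum_single_keys: "(\<Sum>m\<in>kys p. sngl m (lkp p m)) = p"
proof (rule poly_mapping_eqI)
  fix k
  have "lkp (\<Sum>m\<in>kys p. sngl m (lkp p m)) k = (\<Sum>m\<in>kys p. if m = k then lkp p k else 0)"
    unfolding lookup_sum by (intro sum.cong) (auto simp: lookup_single when_def)
  then show "lkp (\<Sum>m\<in>kys p. sngl m (lkp p m)) k = lkp p k"
    by (auto simp: in_keys_iff)
qed

definition squarefree_monom :: "'v set \<Rightarrow> ('v \<Rightarrow>\<^sub>0 nat)" where
  "squarefree_monom A = (\<Sum>v\<in>A. sngl v 1)"

lemma lookup_squarefree_monom:
  "finite A \<Longrightarrow> lkp (squarefree_monom A) v = (if v \<in> A then 1 else 0)"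
  unfolding squarefree_monom_def lookup_sum lookup_single when_def by simp

lemma keys_squarefree_monom: "finite A \<Longrightarrow> kys (squarefree_monom A) = A"
  by (auto simp: in_keys_iff lookup_squarefree_monom split: if_splits)

lemma prod_var: "(\<Prod>v\<in>A. var v :: ('v \<Rightarrow>\<^sub>0 nat) \<Rightarrow>\<^sub>0 'k::field) = sngl (squarefree_monom A) 1"
  by (induction A rule: infinite_finite_induct)
    (auto simp: squarefree_monom_def var_def mult_single)

lemma var_neq_zero: "var v \<noteq> (0 :: ('v \<Rightarrow>\<^sub>0 nat) \<Rightarrow>\<^sub>0 'k::field)"
proof
  assume "var v = (0 :: ('v \<Rightarrow>\<^sub>0 nat) \<Rightarrow>\<^sub>0 'k)"
  then have "lkp (var v :: ('v \<Rightarrow>\<^sub>0 nat) \<Rightarrow>\<^sub>0 'k) (sngl v 1) = 0" by simp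
  then show False by (simp add: var_def)
qed

lemma monom_split_var:
  assumes "v \<in> kys m"
  shows "sngl m c = var v * (sngl (m - sngl v 1) c :: ('v \<Rightarrow>\<^sub>0 nat) \<Rightarrow>\<^sub>0 'k::field)"
proof -
  have "sngl v 1 + (m - sngl v 1) = m"
    using assms by (intro poly_mapping_eqI)
      (auto simp: lookup_add lookup_minus lookup_single when_def in_keys_iff)
  then show ?thesis by (simp add: var_def mult_single)
qed

type_synonym 'k mpoly = "(nat \<Rightarrow>\<^sub>0 nat) \<Rightarrow>\<^sub>0 'k"

text \<open>Membership is a condition on supports of monomials. For a complex on \<open>V\<close>
  every variable outside \<open>V\<close> belongs to the ideal, so the quotient is that of the
  polynomial ring on \<open>V\<close>.\<close>

definition sr_ideal :: "nat set set \<Rightarrow> ('k::field) mpoly set" where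
  "sr_ideal \<Delta> = {p. \<forall>m\<in>kys p. kys m \<notin> \<Delta>}"

definition down_closed :: "'a set set \<Rightarrow> bool" where
  "down_closed \<Delta> \<longleftrightarrow> (\<forall>A\<in>\<Delta>. \<forall>B. B \<subseteq> A \<longrightarrow> B \<in> \<Delta>)"

lemma down_closed_Pow [simp]: "down_closed (Pow F)"
  unfolding down_closed_def by auto

lemma ideal_set_sr_ideal:
  assumes "down_closed \<Delta>" shows "ideal_set (sr_ideal \<Delta> :: ('k::field) mpoly set)"
  unfolding ideal_set_def sr_ideal_def
proof (intro conjI ballI allI CollectI)
  fix a b :: "'k mpoly" and m
  assume "a \<in> {p. \<forall>m\<in>kys p. kys m \<notin> \<Delta>}" "b \<in> {p. \<forall>m\<in>kys p. kys m \<notin> \<Delta>}" "m \<in> kys (a + b)"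
  then show "kys m \<notin> \<Delta>" using Poly_Mapping.keys_add[of a b] by blast
next
  fix a c :: "'k mpoly" and m
  assume a: "a \<in> {p. \<forall>m\<in>kys p. kys m \<notin> \<Delta>}" and m: "m \<in> kys (c * a)"
  obtain x y where "m = x + y" "y \<in> kys a" using keys_mult[of c a] m by blast
  then have "kys y \<subseteq> kys m" "kys y \<notin> \<Delta>" using a by (auto simp: keys_plus_nat)
  then show "kys m \<notin> \<Delta>" using assms unfolding down_closed_def by blast
qed simp

section \<open>Setting the variables outside a set to zero\<close>

definition restr :: "nat set \<Rightarrow> ('k::field) mpoly \<Rightarrow> ('k mpoly)" where
  "restr F p = Poly_Mapping.mapp (\<lambda>m c. c when kys m \<subseteq> F) p"

lemma lookup_restr: "lkp (restr F p) m = (if kys m \<subseteq> F then lkp p m else 0)"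
  unfolding restr_def lookup_mapp by (simp add: when_def in_keys_iff)

lemma keys_restr: "kys (restr F p) = {m \<in> kys p. kys m \<subseteq> F}"
proof (rule Set.set_eqI)
  fix m
  show "m \<in> kys (restr F p) \<longleftrightarrow> m \<in> {m \<in> kys p. kys m \<subseteq> F}"
    using in_keys_iff[of m "restr F p"] in_keys_iff[of m p] lookup_restr[of F p m] by auto
qed

lemma restr_add: "restr F (p + q) = restr F p + restr F q"
  by (intro poly_mapping_eqI) (simp add: lookup_restr lookup_add)

lemma restr_diff: "restr F (p - q) = restr F p - restr F q"
  by (intro poly_mapping_eqI) (simp add: lookup_restr lookup_minus)

lemma restr_zero [simp]: "restr F 0 = 0"
  by (intro poly_mapping_eqI) (simp add: lookup_restr)

lemma restr_sum: "restr F (sum g A) = (\<Sum>a\<in>A. restr F (g a))"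
  by (induction A rule: infinite_finite_induct) (auto simp: restr_add)

lemma restr_one [simp]: "restr F 1 = 1"
  by (intro poly_mapping_eqI) (auto simp: lookup_restr lookup_one when_def)

lemma restr_restr: "restr F (restr G p) = restr (F \<inter> G) p"
  by (intro poly_mapping_eqI) (auto simp: lookup_restr)

lemma restr_single: "restr F (sngl m c) = (if kys m \<subseteq> F then sngl m c else 0)"
  by (intro poly_mapping_eqI) (auto simp: lookup_restr lookup_single when_def)

lemma restr_var: "restr F (var v) = (if v \<in> F then var v else 0)"
  by (simp add: var_def restr_single)

lemma restr_eq_zero_iff: "restr F p = 0 \<longleftrightarrow> p \<in> sr_ideal (Pow F)"
  unfolding sr_ideal_def poly_mapping_eq_iff fun_eq_iff by (auto simp: lookup_restr in_keys_iff)

lemma restr_id: "(\<And>m. m \<in> kys p \<Longrightarrow> kys m \<subseteq> F) \<Longrightarrow> restr F p = p"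
  by (intro poly_mapping_eqI) (auto simp: lookup_restr in_keys_iff)

lemma diff_restr_in_sr_ideal: "p - restr F p \<in> sr_ideal (Pow F)"
  unfolding restr_eq_zero_iff[symmetric] by (simp add: restr_diff restr_restr)

text \<open>Modulo the ideal of the simplex \<open>F\<close> both sides agree, and the right-hand
  side is already supported on \<open>F\<close>. Thus \<open>restr F\<close> is a ring endomorphism
  with that ideal as kernel.\<close>

lemma restr_mult: "restr F (p * q) = restr F p * restr F q"
proof -
  have I: "ideal_set (sr_ideal (Pow F) :: ('k::field) mpoly set)"
    by (intro ideal_set_sr_ideal) simp
  have "p * q - restr F p * restr F q = (p - restr F p) * q + restr F p * (q - restr F q)"
    by (simp add: algebra_simps)
  also have "\<dots> \<in> sr_ideal (Pow F)"
    by (intro ideal_set_add[OF I] ideal_set_mult_left[OF I] ideal_set_mult_right[OF I] diff_restr_in_sr_ideal)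
  finally have "restr F (p * q) = restr F (restr F p * restr F q)"
    unfolding restr_eq_zero_iff[symmetric] by (simp add: restr_diff)
  also have "\<dots> = restr F p * restr F q"
  proof (rule restr_id)
    fix m assume "m \<in> kys (restr F p * restr F q)"
    then obtain x y where "m = x + y" "x \<in> kys (restr F p)" "y \<in> kys (restr F q)"
      using keys_mult[of "restr F p" "restr F q"] by blast
    then show "kys m \<subseteq> F" by (simp add: keys_plus_nat keys_restr)
  qed
  finally show ?thesis .
qed

text \<open>The Stanley--Reisner ideal is the intersection of the ideals of the facets; identities
  modulo it may be checked facet by facet.\<close>

lemma sr_ideal_iff_restr:
  assumes "\<And>A. A \<in> \<Delta> \<longleftrightarrow> (\<exists>F\<in>\<F>. A \<subseteq> F)"
  shows "p \<in> sr_ideal \<Delta> \<longleftrightarrow> (\<forall>F\<in>\<F>. restr F p = 0)"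
  unfolding restr_eq_zero_iff unfolding sr_ideal_def by (auto simp: assms)

lemma prime_set_sr_ideal_Pow: "prime_set (sr_ideal (Pow F) :: ('k::field) mpoly set)"
  unfolding prime_set_def
proof (intro conjI allI impI)
  show "ideal_set (sr_ideal (Pow F) :: ('k::field) mpoly set)"
    by (intro ideal_set_sr_ideal) simp
qed (auto simp: restr_mult simp flip: restr_eq_zero_iff)

lemma sr_ideal_antimono: "\<Delta> \<subseteq> \<Delta>' \<Longrightarrow> sr_ideal \<Delta>' \<subseteq> sr_ideal \<Delta>"
  unfolding sr_ideal_def by auto

text \<open>Adding the variables of \<open>F\<close> one by one to the ideal of the simplex. This
  gives the lower bound for the Krull dimension.\<close>

lemma sr_prime_chain:
  assumes "finite F"
  shows "\<exists>P :: nat \<Rightarrow> ('k::field) mpoly set.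
    (\<forall>i\<le>card F. prime_set (P i)) \<and> (\<forall>i<card F. P i \<subset> P (Suc i)) \<and> P 0 = sr_ideal (Pow F)"
proof -
  obtain xs where xs: "set xs = F" "distinct xs" "length xs = card F"
    using assms finite_distinct_list distinct_card by metis
  define P where "P i = (sr_ideal (Pow (set (drop i xs))) :: 'k mpoly set)" for i
  have "P i \<subset> P (Suc i)" if i: "i < card F" for i
  proof -
    have d: "drop i xs = xs ! i # drop (Suc i) xs" using i xs by (simp add: Cons_nth_drop_Suc)
    have "distinct (drop i xs)" using xs by simp
    then have "xs ! i \<notin> set (drop (Suc i) xs)" unfolding d by simp
    then have "var (xs ! i) \<in> P (Suc i)" "var (xs ! i) \<notin> P i"
      unfolding P_def restr_eq_zero_iff[symmetric] restr_var using d by (auto simp: var_neq_zero)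
    moreover have "P i \<subseteq> P (Suc i)" unfolding P_def by (intro sr_ideal_antimono) (auto simp: d)
    ultimately show ?thesis by blast
  qed
  moreover have "prime_set (P i)" for i unfolding P_def by (rule prime_set_sr_ideal_Pow)
  moreover have "P 0 = sr_ideal (Pow F)" unfolding P_def using xs by simp
  ultimately show ?thesis by blast
qed

section \<open>Dimension by counting independent polynomials\<close>

interpretation pvs: vector_space "\<lambda>(c::'k::field) (p :: 'k mpoly). sngl 0 c * p"
  by unfold_locales (auto simp: algebra_simps single_add mult_single simp flip: mult.assoc)

text \<open>Linear independence over the field of the residue classes modulo \<open>Q\<close>,
  constants being embedded as multiples of the empty monomial.\<close>

definition indep_mod :: "('k::field) mpoly set \<Rightarrow> 'k mpoly set \<Rightarrow> bool" where
  "indep_mod Q B \<longleftrightarrow>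
     finite B \<and> (\<forall>c. (\<Sum>b\<in>B. sngl 0 (c b) * b) \<in> Q \<longrightarrow> (\<forall>b\<in>B. c b = 0))"

text \<open>In a relation modulo \<open>Q'\<close>, reduction modulo \<open>Q\<close> removes the
  multiples of \<open>f\<close> and forces the coefficients on \<open>B\<close> to vanish; then
  \<open>f\<close> can be cancelled because \<open>Q'\<close> is prime.\<close>

lemma indep_mod_step:
  fixes B C Q Q' :: "('k::field) mpoly set"
  assumes Q': "prime_set Q'" and Q: "ideal_set Q" "Q' \<subseteq> Q" and f: "f \<in> Q" "f \<notin> Q'"
    and B: "indep_mod Q B" and C: "indep_mod Q' C"
  shows "indep_mod Q' (B \<union> (*) f ` C)" "card (B \<union> (*) f ` C) = card B + card C"
proof -
  have fin: "finite B" "finite C" using B C unfolding indep_mod_def by auto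
  have I': "ideal_set Q'" using Q' unfolding prime_set_def by blast
  have "f \<noteq> 0" using f ideal_set_zero[OF I'] by blast
  then have inj: "inj_on ((*) f) C" by (auto simp: inj_on_def)
  have disj: "B \<inter> (*) f ` C = {}"
  proof (rule ccontr)
    assume "\<not> ?thesis"
    then obtain y where y: "f * y \<in> B" by blast
    have "(\<Sum>b\<in>B. sngl 0 (if b = f * y then 1 else 0) * b) = (\<Sum>b\<in>B. if b = f * y then f * y else 0)"
      by (intro sum.cong) auto
    also have "\<dots> = f * y" using y fin by simp
    also have "\<dots> \<in> Q" using f Q ideal_set_mult_right by blast
    finally have "\<forall>b\<in>B. (if b = f * y then 1 else 0) = (0::'k)"
      using B unfolding indep_mod_def by (elim conjE allE[of _ "\<lambda>b. if b = f * y then 1 else 0"]) blast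
    then show False using y by auto
  qed
  show "card (B \<union> (*) f ` C) = card B + card C"
    using disj fin inj by (simp add: card_Un_disjoint card_image)
  show "indep_mod Q' (B \<union> (*) f ` C)" unfolding indep_mod_def
  proof (intro conjI allI impI)
    show "finite (B \<union> (*) f ` C)" using fin by simp
  next
    fix c assume c: "(\<Sum>b\<in>B \<union> (*) f ` C. sngl 0 (c b) * b) \<in> Q'"
    let ?s = "\<Sum>b\<in>B. sngl 0 (c b) * b" and ?t = "\<Sum>y\<in>C. sngl 0 (c (f * y)) * y"
    have "(\<Sum>b\<in>B \<union> (*) f ` C. sngl 0 (c b) * b) = ?s + (\<Sum>b\<in>(*) f ` C. sngl 0 (c b) * b)"
      using fin disj by (simp add: sum.union_disjoint)
    also have "(\<Sum>b\<in>(*) f ` C. sngl 0 (c b) * b) = f * ?t"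
      using inj by (simp add: sum.reindex sum_distrib_left mult.left_commute)
    finally have st: "?s + f * ?t \<in> Q'" using c by simp
    have "f * ?t \<in> Q" using f Q ideal_set_mult_right by blast
    then have "?s \<in> Q" using ideal_set_diff[OF Q(1), of "?s + f * ?t" "f * ?t"] st Q by auto
    then have cB: "\<forall>b\<in>B. c b = 0" using B unfolding indep_mod_def by blast
    then have "f * ?t \<in> Q'" using st by simp
    then have "?t \<in> Q'" using Q' f unfolding prime_set_def by blast
    then have "\<forall>y\<in>C. c (f * y) = 0" using C unfolding indep_mod_def by (auto dest: spec[of _ "\<lambda>y. c (f * y)"])
    with cB show "\<forall>b\<in>B \<union> (*) f ` C. c b = 0" by auto
  qed
qed

text \<open>Bounding each exponent separately instead of the total degree makes the number of
  available monomials a plain power, while bounds still add under multiplication.\<close>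

definition poly_box :: "nat set \<Rightarrow> nat \<Rightarrow> ('k::field) mpoly set" where
  "poly_box F D = {p. \<forall>m\<in>kys p. kys m \<subseteq> F \<and> (\<forall>v. lkp m v \<le> D)}"

lemma poly_box_mono: "D \<le> D' \<Longrightarrow> poly_box F D \<subseteq> poly_box F D'"
  unfolding poly_box_def by (blast intro: order_trans)

lemma poly_box_mult:
  assumes "p \<in> poly_box F D" "q \<in> poly_box F D'" shows "p * q \<in> poly_box F (D + D')"
  unfolding poly_box_def
proof (intro CollectI ballI)
  fix m assume "m \<in> kys (p * q)"
  then obtain x y where "m = x + y" "x \<in> kys p" "y \<in> kys q"
    using keys_mult[of p q] by blast
  then show "kys m \<subseteq> F \<and> (\<forall>v. lkp m v \<le> D + D')"
    using assms unfolding poly_box_def by (auto simp: keys_plus_nat lookup_add intro!: add_mono)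
qed

lemma poly_box_exists:
  assumes "\<And>m. m \<in> kys p \<Longrightarrow> kys m \<subseteq> F" shows "\<exists>D. p \<in> poly_box F D"
proof -
  have "lkp m v \<le> Max (insert 0 (\<Union>m\<in>kys p. lkp m ` kys m))" if "m \<in> kys p" for m v
  proof (cases "v \<in> kys m")
    case True
    then show ?thesis using that by (intro Max_ge) auto
  qed (simp add: in_keys_iff)
  then show ?thesis using assms unfolding poly_box_def by blast
qed

text \<open>The set built is \<open>B\<close> together with its multiples by \<open>f\<close>,
  \<open>f ^ 2\<close>, up to \<open>f ^ (N - 1)\<close>.\<close>

lemma indep_mod_iterate:
  fixes B Q Q' :: "('k::field) mpoly set"
  assumes Q': "prime_set Q'" and Q: "ideal_set Q" "Q' \<subseteq> Q" and f: "f \<in> Q" "f \<notin> Q'" "f \<in> poly_box F e"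
    and B: "indep_mod Q B" "B \<subseteq> poly_box F D"
  shows "\<exists>C. indep_mod Q' C \<and> card C = N * card B \<and> C \<subseteq> poly_box F (D + N * e)"
proof (induction N)
  case 0
  show ?case by (intro exI[of _ "{}"]) (simp add: indep_mod_def)
next
  case (Suc N)
  then obtain C where C: "indep_mod Q' C" "card C = N * card B" "C \<subseteq> poly_box F (D + N * e)" by blast
  have "(*) f ` C \<subseteq> poly_box F (e + (D + N * e))" using C f poly_box_mult by blast
  moreover have "B \<subseteq> poly_box F (e + (D + N * e))"
    using B(2) poly_box_mono[of D "e + (D + N * e)" F] by (auto simp: subset_iff)
  ultimately show ?case
    using indep_mod_step[OF Q' Q f(1,2) B(1) C(1)] C(2)
    by (intro exI[of _ "B \<union> (*) f ` C"]) (auto simp: algebra_simps)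
qed

text \<open>Each strict inclusion multiplies the number of independent polynomials by
  \<open>N\<close> but adds only \<open>N * e\<close> to the degree bound.\<close>

lemma indep_mod_chain:
  fixes P :: "nat \<Rightarrow> ('k::field) mpoly set"
  assumes "\<And>i. i \<le> k \<Longrightarrow> prime_set (P i)"
    and "\<And>i. i < k \<Longrightarrow> P i \<subseteq> P (Suc i) \<and> f i \<in> P (Suc i) \<and> f i \<notin> P i \<and> f i \<in> poly_box F e"
  shows "\<exists>B. indep_mod (P 0) B \<and> card B = N ^ k \<and> B \<subseteq> poly_box F (k * (N * e))"
  using assms
proof (induction k arbitrary: P f)
  case 0
  have "indep_mod (P 0) {1}" unfolding indep_mod_def
  proof (intro conjI allI impI)
    fix c :: "_ \<Rightarrow> 'k" assume "(\<Sum>b\<in>{1}. sngl 0 (c b) * b) \<in> P 0"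
    then have c: "sngl 0 (c 1) \<in> P 0" by simp
    have P0: "prime_set (P 0)" using 0 by simp
    have "c 1 = 0"
    proof (rule ccontr)
      assume "c 1 \<noteq> 0"
      then have "sngl 0 (inverse (c 1)) * sngl 0 (c 1) = (1 :: 'k mpoly)"
        by (simp add: mult_single)
      then have "1 \<in> P 0" using c P0 ideal_set_mult_left unfolding prime_set_def by metis
      then show False using P0 unfolding prime_set_def by blast
    qed
    then show "\<forall>b\<in>{1}. c b = 0" by simp
  qed simp
  moreover have "1 \<in> poly_box F 0" unfolding poly_box_def by simp
  ultimately show ?case by (intro exI[of _ "{1}"]) auto
next
  case (Suc k)
  have "\<exists>B. indep_mod (P (Suc 0)) B \<and> card B = N ^ k \<and> B \<subseteq> poly_box F (k * (N * e))"
    using Suc.IH[of "\<lambda>i. P (Suc i)" "\<lambda>i. f (Suc i)"] Suc.prems by simp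
  then obtain B where B: "indep_mod (P (Suc 0)) B" "card B = N ^ k" "B \<subseteq> poly_box F (k * (N * e))" by blast
  have P: "prime_set (P 0)" "ideal_set (P (Suc 0))"
    using Suc.prems(1)[of 0] Suc.prems(1)[of "Suc 0"] by (auto simp: prime_set_def)
  have "P 0 \<subseteq> P (Suc 0)" "f 0 \<in> P (Suc 0)" "f 0 \<notin> P 0" "f 0 \<in> poly_box F e"
    using Suc.prems(2)[of 0] by auto
  from indep_mod_iterate[OF P this B(1,3), of N] B(2) show ?case
    by (auto simp: algebra_simps)
qed

lemma card_box_monomials:
  assumes "finite F"
  shows "finite {m :: nat \<Rightarrow>\<^sub>0 nat. kys m \<subseteq> F \<and> (\<forall>v. lkp m v \<le> D)}" (is "finite ?M")
    and "card {m :: nat \<Rightarrow>\<^sub>0 nat. kys m \<subseteq> F \<and> (\<forall>v. lkp m v \<le> D)} \<le> (D + 1) ^ card F"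
proof -
  let ?g = "\<lambda>m. restrict (lkp m) F"
  have inj: "inj_on ?g ?M"
  proof (rule inj_onI, rule poly_mapping_eqI)
    fix m m' v assume mm: "m \<in> ?M" "m' \<in> ?M" "?g m = ?g m'"
    show "lkp m v = lkp m' v"
    proof (cases "v \<in> F")
      case True
      then show ?thesis using fun_cong[OF mm(3), of v] by simp
    next
      case False
      then have "v \<notin> kys m" "v \<notin> kys m'" using mm by auto
      then show ?thesis by (simp add: in_keys_iff)
    qed
  qed
  have sub: "?g ` ?M \<subseteq> F \<rightarrow>\<^sub>E {..D}" by auto
  have fin: "finite (F \<rightarrow>\<^sub>E {..D})" using assms by (intro finite_PiE) auto
  show "finite ?M" using inj sub fin by (meson finite_subset finite_imageD)
  have "card ?M = card (?g ` ?M)" using inj by (simp add: card_image)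
  also have "\<dots> \<le> card (F \<rightarrow>\<^sub>E {..D})" using sub fin by (rule card_mono[rotated])
  also have "\<dots> = (D + 1) ^ card F" using assms by (simp add: card_PiE)
  finally show "card ?M \<le> (D + 1) ^ card F" .
qed

lemma indep_mod_card_le:
  fixes B Q :: "('k::field) mpoly set"
  assumes "finite F" "indep_mod Q B" "0 \<in> Q" "B \<subseteq> poly_box F D"
  shows "card B \<le> (D + 1) ^ card F"
proof -
  let ?M = "{m :: nat \<Rightarrow>\<^sub>0 nat. kys m \<subseteq> F \<and> (\<forall>v. lkp m v \<le> D)}"
  let ?T = "(\<lambda>m. sngl m (1::'k)) ` ?M"
  have ind: "pvs.independent B"
    using assms(2,3) unfolding indep_mod_def by (subst pvs.dependent_finite) auto
  have "B \<subseteq> pvs.span ?T"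
  proof
    fix p assume "p \<in> B"
    then have p: "m \<in> kys p \<Longrightarrow> m \<in> ?M" for m using assms(4) unfolding poly_box_def by blast
    have "(\<Sum>m\<in>kys p. sngl 0 (lkp p m) * sngl m 1) \<in> pvs.span ?T"
      using p by (intro pvs.span_sum pvs.span_scale pvs.span_base imageI) blast
    then show "p \<in> pvs.span ?T" by (simp add: mult_single sum_single_keys)
  qed
  then have "card B \<le> card ?T"
    using pvs.independent_span_bound[OF _ ind] card_box_monomials(1)[OF assms(1), of D] by blast
  also have "\<dots> \<le> card ?M" using card_box_monomials(1)[OF assms(1)] by (rule card_image_le)
  also have "\<dots> \<le> (D + 1) ^ card F" using card_box_monomials(2)[OF assms(1)] .
  finally show ?thesis .
qed

text \<open>A chain of length \<open>k\<close> yields \<open>N ^ k\<close> independent polynomials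
  in a box with side linear in \<open>N\<close>, hence at most a constant times
  \<open>N ^ card F\<close> of them. For large \<open>N\<close> this bounds
  \<open>k\<close>.\<close>

lemma prime_chain_bound:
  fixes P :: "nat \<Rightarrow> ('k::field) mpoly set"
  assumes F: "finite F" and P: "\<And>i. i \<le> k \<Longrightarrow> prime_set (P i)" "\<And>i. i < k \<Longrightarrow> P i \<subset> P (Suc i)"
    and sub: "sr_ideal (Pow F) \<subseteq> P 0"
  shows "k \<le> card F"
proof (rule ccontr)
  assume "\<not> ?thesis"
  then have kF: "card F < k" by simp
  have sub': "sr_ideal (Pow F) \<subseteq> P i" if "i \<le> k" for i
    using that
  proof (induction i)
    case (Suc i)
    then show ?case using P(2)[of i] by auto
  qed (use sub in auto)
  have "\<exists>g. g \<in> P (Suc i) \<and> g \<notin> P i \<and> (\<exists>e. g \<in> poly_box F e)" if i: "i < k" for i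
  proof -
    obtain g where g: "g \<in> P (Suc i)" "g \<notin> P i" using P(2)[OF i] by blast
    have I: "ideal_set (P i)" "ideal_set (P (Suc i))" using P(1)[of i] P(1)[of "Suc i"] i by (auto simp: prime_set_def)
    \<comment> \<open>The witnesses of strictness are replaced by their restrictions to
      \<open>F\<close>, which changes them only by elements of all primes of the chain and puts them
      into a box.\<close>
    have d: "g - restr F g \<in> P i" "g - restr F g \<in> P (Suc i)"
      using diff_restr_in_sr_ideal[of g F] sub'[of i] sub'[of "Suc i"] i by auto
    have "restr F g \<in> P (Suc i)" using ideal_set_diff[OF I(2) g(1) d(2)] by simp
    moreover have "restr F g \<notin> P i" using ideal_set_add[OF I(1) d(1), of "restr F g"] g(2) by auto
    moreover have "\<exists>e. restr F g \<in> poly_box F e" by (rule poly_box_exists) (simp add: keys_restr)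
    ultimately show ?thesis by blast
  qed
  then obtain g e where ge: "\<And>i. i < k \<Longrightarrow> g i \<in> P (Suc i) \<and> g i \<notin> P i \<and> g i \<in> poly_box F (e i)"
    by metis
  define E where "E = (\<Sum>i<k. e i)"
  have "e i \<le> E" if "i < k" for i unfolding E_def using that by (intro member_le_sum) auto
  then have gE: "P i \<subseteq> P (Suc i) \<and> g i \<in> P (Suc i) \<and> g i \<notin> P i \<and> g i \<in> poly_box F E" if "i < k" for i
    using ge[OF that] poly_box_mono[of "e i" E F] P(2)[OF that] that by auto
  let ?m = "card F"
  \<comment> \<open>Chosen to exceed the constant that remains after dividing the inequality by
    \<open>N ^ ?m\<close>.\<close>
  define N where "N = Suc ((k * E + 1) ^ ?m)"
  obtain B where B: "indep_mod (P 0) B" "card B = N ^ k" "B \<subseteq> poly_box F (k * (N * E))"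
    using indep_mod_chain[of k P g F E N] P(1) gE by blast
  have P0: "0 \<in> P 0" using P(1)[of 0] by (simp add: prime_set_def ideal_set_zero)
  have N1: "1 \<le> N" unfolding N_def by simp
  have "N * N ^ ?m \<le> N ^ k" using kF power_increasing[of "Suc ?m" k N] N1 by simp
  also have "\<dots> \<le> (k * (N * E) + 1) ^ ?m" using indep_mod_card_le[OF F B(1) P0 B(3)] B(2) by simp
  also have "\<dots> \<le> ((k * E + 1) * N) ^ ?m" using N1 by (intro power_mono) (simp_all add: algebra_simps)
  also have "\<dots> = (k * E + 1) ^ ?m * N ^ ?m" by (rule power_mult_distrib)
  finally have "N \<le> (k * E + 1) ^ ?m" using N1 by simp
  then show False unfolding N_def by simp
qed

text \<open>The variables missing from the prime \<open>P 0\<close> have their product outside it,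
  so they form a face \<open>F\<close>. All monomials not supported on \<open>F\<close> lie in
  \<open>P 0\<close>, which reduces the bound to the simplex \<open>F\<close>.\<close>

lemma sr_prime_chain_bound:
  fixes P :: "nat \<Rightarrow> ('k::field) mpoly set"
  assumes V: "finite V" "\<Delta> \<subseteq> Pow V" and dim: "\<And>A. A \<in> \<Delta> \<Longrightarrow> card A \<le> d"
    and P: "\<And>i. i \<le> k \<Longrightarrow> prime_set (P i)" "\<And>i. i < k \<Longrightarrow> P i \<subset> P (Suc i)"
    and sub: "sr_ideal \<Delta> \<subseteq> P 0"
  shows "k \<le> d"
proof -
  define F where "F = {v. var v \<notin> P 0}"
  have P0: "prime_set (P 0)" "ideal_set (P 0)" using P(1)[of 0] by (auto simp: prime_set_def)
  have "v \<in> V" if "v \<in> F" for v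
  proof (rule ccontr)
    assume "v \<notin> V"
    then have "var v \<in> sr_ideal \<Delta>" using V(2) unfolding sr_ideal_def var_def by auto
    then show False using sub that unfolding F_def by blast
  qed
  then have "F \<subseteq> V" by blast
  then have F: "finite F" using V(1) by (rule finite_subset)
  have "(\<Prod>v\<in>A. var v) \<notin> P 0" if "finite A" "A \<subseteq> F" for A
    using that
  proof (induction A)
    case (insert v A)
    then have "var v \<notin> P 0" "(\<Prod>v\<in>A. var v) \<notin> P 0" unfolding F_def by auto
    then have "var v * (\<Prod>v\<in>A. var v) \<notin> P 0" using P0(1) unfolding prime_set_def by blast
    then show ?case using insert by simp
  next
    case empty
    then show ?case using P0(1) unfolding prime_set_def by simp
  qed
  from this[OF F subset_refl] have "sngl (squarefree_monom F) 1 \<notin> (sr_ideal \<Delta> :: 'k mpoly set)" using sub unfolding prod_var by blast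
  then have "F \<in> \<Delta>" unfolding sr_ideal_def using keys_squarefree_monom[OF F] by simp
  have "sr_ideal (Pow F) \<subseteq> P 0"
  proof
    fix p :: "'k mpoly" assume p: "p \<in> sr_ideal (Pow F)"
    have "sngl m (lkp p m) \<in> P 0" if "m \<in> kys p" for m
    proof -
      obtain v where v: "v \<in> kys m" "v \<notin> F" using p \<open>m \<in> kys p\<close> unfolding sr_ideal_def by blast
      then have "var v \<in> P 0" unfolding F_def by blast
      then show ?thesis using monom_split_var[OF v(1)] ideal_set_mult_right[OF P0(2)] by metis
    qed
    then have "(\<Sum>m\<in>kys p. sngl m (lkp p m)) \<in> P 0" by (rule ideal_set_sum[OF P0(2)])
    then show "p \<in> P 0" by (simp add: sum_single_keys)
  qed
  then have "k \<le> card F" using prime_chain_bound[of F k P] F P by blast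
  then show ?thesis using dim[OF \<open>F \<in> \<Delta>\<close>] by simp
qed

section \<open>Transfer to the quotient ring\<close>

text \<open>Pulls questions about a ring with carrier back to a type-class ring, where ideals of
  \<open>R\<close> correspond to plain sets containing the kernel \<open>J\<close>.\<close>

locale surj_ring_hom = cring R for R (structure) +
  fixes \<theta> :: "'c::comm_ring_1 \<Rightarrow> 'a" and J :: "'c set"
  assumes surj: "range \<theta> = carrier R"
    and hom_add: "\<theta> (p + q) = \<theta> p \<oplus> \<theta> q"
    and hom_mult: "\<theta> (p * q) = \<theta> p \<otimes> \<theta> q"
    and hom_one: "\<theta> 1 = \<one>"
    and kernel: "\<theta> p = \<zero> \<longleftrightarrow> p \<in> J"
begin

lemma hom_closed [simp]: "\<theta> p \<in> carrier R"
  by (simp flip: surj)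

lemma carrier_ex: "x \<in> carrier R \<Longrightarrow> \<exists>p. x = \<theta> p"
  by (auto simp flip: surj)

lemma hom_zero: "\<theta> 0 = \<zero>"
proof -
  have "\<theta> 0 \<oplus> \<theta> 0 = \<theta> 0" using hom_add[of 0 0] by simp
  then show ?thesis using add.r_cancel_one[of "\<theta> 0" "\<theta> 0"] by simp
qed

lemma hom_uminus: "\<theta> (- p) = \<ominus> \<theta> p"
proof -
  have "\<theta> (- p) \<oplus> \<theta> p = \<zero>" using hom_add[of "- p" p] hom_zero by simp
  then show ?thesis by (simp add: minus_equality)
qed

lemma hom_eq_iff: "\<theta> p = \<theta> q \<longleftrightarrow> p - q \<in> J"
proof -
  have "\<theta> p = \<theta> (p - q) \<oplus> \<theta> q" using hom_add[of "p - q" q] by simp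
  then have "\<theta> p = \<theta> q \<longleftrightarrow> \<theta> (p - q) = \<zero>" using add.r_cancel_one[of "\<theta> q" "\<theta> (p - q)"] by simp
  then show ?thesis using kernel by simp
qed

lemma ideal_set_kernel: "ideal_set J"
  unfolding ideal_set_def by (auto simp: hom_add hom_mult hom_zero simp flip: kernel)

lemma hom_in_image_iff:
  assumes "ideal_set I" "J \<subseteq> I" shows "\<theta> p \<in> \<theta> ` I \<longleftrightarrow> p \<in> I"
proof
  assume "\<theta> p \<in> \<theta> ` I"
  then obtain q where "q \<in> I" "p - q \<in> J" using hom_eq_iff by blast
  then show "p \<in> I" using ideal_set_add[OF assms(1), of "p - q" q] assms(2) by auto
qed blast

lemma ideal_image:
  assumes "ideal_set I" shows "ideal (\<theta> ` I) R"
proof (rule idealI)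
  show "subgroup (\<theta> ` I) (add_monoid R)"
  proof (rule subgroup.intro)
    show "\<And>x y. x \<in> \<theta> ` I \<Longrightarrow> y \<in> \<theta> ` I \<Longrightarrow> x \<otimes>\<^bsub>add_monoid R\<^esub> y \<in> \<theta> ` I"
      using ideal_set_add[OF assms] by (auto simp flip: hom_add)
    show "\<one>\<^bsub>add_monoid R\<^esub> \<in> \<theta> ` I"
      using ideal_set_zero[OF assms] by (auto simp flip: hom_zero)
    show "\<And>x. x \<in> \<theta> ` I \<Longrightarrow> inv\<^bsub>add_monoid R\<^esub> x \<in> \<theta> ` I"
      using ideal_set_uminus[OF assms] by (auto simp flip: hom_uminus a_inv_def)
  qed auto
next
  fix a x assume "a \<in> \<theta> ` I" "x \<in> carrier R"
  then obtain p q where "a = \<theta> p" "p \<in> I" "x = \<theta> q" using carrier_ex by blast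
  then show "x \<otimes> a \<in> \<theta> ` I" "a \<otimes> x \<in> \<theta> ` I"
    using ideal_set_mult_left[OF assms] ideal_set_mult_right[OF assms] by (auto simp flip: hom_mult)
qed (rule ring_axioms)

lemma ideal_set_preimage:
  assumes "ideal I R" shows "ideal_set (\<theta> -` I)" "J \<subseteq> \<theta> -` I"
proof -
  interpret I: ideal I R by fact
  show "ideal_set (\<theta> -` I)" unfolding ideal_set_def
  proof (intro conjI ballI allI vimageI2)
    show "\<theta> 0 \<in> I" by (simp add: hom_zero)
    show "\<And>a b. a \<in> \<theta> -` I \<Longrightarrow> b \<in> \<theta> -` I \<Longrightarrow> \<theta> (a + b) \<in> I" by (simp add: hom_add)
    show "\<And>a c. a \<in> \<theta> -` I \<Longrightarrow> \<theta> (c * a) \<in> I" by (simp add: hom_mult I.I_l_closed)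
  qed
  show "J \<subseteq> \<theta> -` I"
  proof
    fix p assume "p \<in> J"
    then have "\<theta> p = \<zero>" using kernel by simp
    then show "p \<in> \<theta> -` I" by simp
  qed
qed

lemma image_preimage:
  assumes "ideal I R" shows "\<theta> ` (\<theta> -` I) = I"
proof -
  interpret I: ideal I R by fact
  have "I \<subseteq> range \<theta>" using I.a_subset surj by simp
  then show ?thesis by (simp add: image_vimage_eq Int_absorb2)
qed

text \<open>The generated ideal is recognised by minimality, so no explicit linear combinations of
  generators are handled.\<close>

lemma genideal_image:
  assumes "ideal_set I" "J \<subseteq> I" "X \<subseteq> I" and "\<And>I'. ideal_set I' \<Longrightarrow> J \<subseteq> I' \<Longrightarrow> X \<subseteq> I' \<Longrightarrow> I \<subseteq> I'"
  shows "Idl (\<theta> ` X) = \<theta> ` I"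
proof
  show "Idl (\<theta> ` X) \<subseteq> \<theta> ` I"
    using assms by (intro genideal_minimal ideal_image) auto
  have *: "ideal (Idl (\<theta> ` X)) R" by (intro genideal_ideal) auto
  have "\<theta> ` X \<subseteq> Idl (\<theta> ` X)" by (rule genideal_self) auto
  then have "X \<subseteq> \<theta> -` (Idl (\<theta> ` X))" by blast
  then have "I \<subseteq> \<theta> -` (Idl (\<theta> ` X))" using assms(4) ideal_set_preimage[OF *] by blast
  then show "\<theta> ` I \<subseteq> Idl (\<theta> ` X)" by blast
qed

lemma genideal_adjoin: "Idl (\<theta> ` set fs) = \<theta> ` adjoin J fs"
proof (rule genideal_image)
  show "ideal_set (adjoin J fs)" by (rule ideal_set_adjoin[OF ideal_set_kernel])
  show "J \<subseteq> adjoin J fs" by (rule subset_adjoin)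
  show "set fs \<subseteq> adjoin J fs" by (rule gen_in_adjoin[OF ideal_set_kernel])
qed (rule adjoin_minimal)

lemma adjoin_mem_iff: "\<theta> p \<in> \<theta> ` adjoin J fs \<longleftrightarrow> p \<in> adjoin J fs"
  by (intro hom_in_image_iff ideal_set_adjoin ideal_set_kernel subset_adjoin)

lemma image_eq_carrier_iff:
  assumes "ideal_set I" "J \<subseteq> I" shows "\<theta> ` I = carrier R \<longleftrightarrow> 1 \<in> I"
proof
  assume "\<theta> ` I = carrier R"
  then show "1 \<in> I" using hom_in_image_iff[OF assms, of 1] by auto
next
  assume "1 \<in> I"
  then have "p \<in> I" for p using ideal_set_mult_left[OF assms(1), of 1 p] by simp
  then have "I = UNIV" by blast
  then show "\<theta> ` I = carrier R" using surj by simp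
qed

lemma regular_sequence_iff: "regular_sequence R (map \<theta> fs) \<longleftrightarrow> regular_list J fs"
proof -
  have ball: "(\<forall>a\<in>carrier R. Q a) \<longleftrightarrow> (\<forall>p. Q (\<theta> p))" for Q by (simp flip: surj)
  have "set (map \<theta> fs) \<subseteq> carrier R" by auto
  moreover have "Idl (set (take i (map \<theta> fs))) = \<theta> ` adjoin J (take i fs)" for i
    using genideal_adjoin[of "take i fs"] by (simp add: take_map)
  moreover have "Idl (set (map \<theta> fs)) = \<theta> ` adjoin J fs"
    using genideal_adjoin[of fs] by simp
  moreover have "\<theta> ` adjoin J fs \<noteq> carrier R \<longleftrightarrow> 1 \<notin> adjoin J fs"
    using image_eq_carrier_iff[OF ideal_set_adjoin[OF ideal_set_kernel] subset_adjoin] by blast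
  ultimately show ?thesis
    unfolding regular_sequence_def regular_list_iff_nth ball by (simp add: adjoin_mem_iff flip: hom_mult)
qed

lemma depth_eq:
  assumes "ideal_set I" "J \<subseteq> I"
  shows "depth R (\<theta> ` I) = Sup {enat (length fs) | fs. regular_list J fs \<and> set fs \<subseteq> I}"
proof -
  have "{enat (length xs) | xs. regular_sequence R xs \<and> set xs \<subseteq> \<theta> ` I} =
        {enat (length fs) | fs. regular_list J fs \<and> set fs \<subseteq> I}" (is "?A = ?B")
  proof (intro equalityI subsetI)
    fix n assume "n \<in> ?A"
    then obtain xs where xs: "n = enat (length xs)" "regular_sequence R xs" "set xs \<subseteq> \<theta> ` I" by blast
    then have "xs \<in> lists (\<theta> ` I)" by auto
    then have "xs \<in> map \<theta> ` lists I" by (simp add: lists_image)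
    then obtain fs where "xs = map \<theta> fs" "fs \<in> lists I" by blast
    then show "n \<in> ?B" using xs regular_sequence_iff by (auto intro!: exI[of _ fs])
  next
    fix n assume "n \<in> ?B"
    then obtain fs where fs: "n = enat (length fs)" "regular_list J fs" "set fs \<subseteq> I" by blast
    then have "set (map \<theta> fs) \<subseteq> \<theta> ` I" "length (map \<theta> fs) = length fs" by auto
    then show "n \<in> ?A" using fs regular_sequence_iff by (intro CollectI exI[of _ "map \<theta> fs"]) simp
  qed
  then show ?thesis unfolding depth_def by simp
qed

lemma primeideal_image:
  assumes "prime_set Q" "J \<subseteq> Q" shows "primeideal (\<theta> ` Q) R"
proof (rule primeidealI)
  have I: "ideal_set Q" using assms unfolding prime_set_def by blast
  show "ideal (\<theta> ` Q) R" by (rule ideal_image[OF I])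
  show "carrier R \<noteq> \<theta> ` Q"
    using image_eq_carrier_iff[OF I assms(2)] assms(1) unfolding prime_set_def by metis
  fix a b assume ab: "a \<in> carrier R" "b \<in> carrier R" "a \<otimes> b \<in> \<theta> ` Q"
  obtain p q where pq: "a = \<theta> p" "b = \<theta> q" using carrier_ex[OF ab(1)] carrier_ex[OF ab(2)] by blast
  then have "p * q \<in> Q" using ab hom_in_image_iff[OF I assms(2)] by (simp flip: hom_mult)
  then show "a \<in> \<theta> ` Q \<or> b \<in> \<theta> ` Q" using pq assms(1) unfolding prime_set_def by blast
qed (rule is_cring)

lemma prime_set_preimage:
  assumes "primeideal Q R" shows "prime_set (\<theta> -` Q)"
proof -
  interpret Q: primeideal Q R by fact
  have "1 \<notin> \<theta> -` Q" using Q.one_imp_carrier Q.I_notcarr by (auto simp: hom_one)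
  moreover have "p * q \<in> \<theta> -` Q \<Longrightarrow> p \<in> \<theta> -` Q \<or> q \<in> \<theta> -` Q" for p q
    using Q.I_prime[of "\<theta> p" "\<theta> q"] by (simp add: hom_mult)
  ultimately show ?thesis
    using ideal_set_preimage(1)[OF Q.is_ideal] unfolding prime_set_def by blast
qed

lemma krull_dim_eq:
  "krull_dim R = Sup {enat n | n. \<exists>P. (\<forall>i\<le>n. prime_set (P i)) \<and> (\<forall>i<n. P i \<subset> P (Suc i)) \<and> J \<subseteq> P 0}"
proof -
  have "(\<exists>P. (\<forall>i\<le>n. primeideal (P i) R) \<and> (\<forall>i<n. P i \<subset> P (Suc i))) \<longleftrightarrow>
        (\<exists>P. (\<forall>i\<le>n. prime_set (P i)) \<and> (\<forall>i<n. P i \<subset> P (Suc i)) \<and> J \<subseteq> P 0)" (is "?A \<longleftrightarrow> ?B") for n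
  proof
    assume ?A
    then obtain P where P: "\<And>i. i \<le> n \<Longrightarrow> primeideal (P i) R" "\<And>i. i < n \<Longrightarrow> P i \<subset> P (Suc i)" by blast
    have eq: "\<theta> ` (\<theta> -` P i) = P i" if "i \<le> n" for i
      using image_preimage P(1)[OF that] unfolding primeideal_def by blast
    have "\<theta> -` P i \<subset> \<theta> -` P (Suc i)" if "i < n" for i
    proof (rule psubsetI)
      show "\<theta> -` P i \<subseteq> \<theta> -` P (Suc i)" using P(2)[OF that] by blast
      have "P i \<noteq> P (Suc i)" using P(2)[OF that] by blast
      then show "\<theta> -` P i \<noteq> \<theta> -` P (Suc i)" using eq[of i] eq[of "Suc i"] that by force
    qed
    moreover have "J \<subseteq> \<theta> -` P 0" using ideal_set_preimage(2) P(1)[of 0] unfolding primeideal_def by blast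
    ultimately show ?B using P(1) prime_set_preimage by (intro exI[of _ "\<lambda>i. \<theta> -` P i"]) blast
  next
    assume ?B
    then obtain P where P: "\<And>i. i \<le> n \<Longrightarrow> prime_set (P i)" "\<And>i. i < n \<Longrightarrow> P i \<subset> P (Suc i)" "J \<subseteq> P 0" by blast
    have J: "J \<subseteq> P i" if "i \<le> n" for i
      using that
    proof (induction i)
      case (Suc i)
      then show ?case using P(2)[of i] by auto
    qed (use P(3) in simp)
    have "\<theta> ` P i \<subset> \<theta> ` P (Suc i)" if i: "i < n" for i
    proof -
      obtain p where p: "p \<in> P (Suc i)" "p \<notin> P i" using P(2)[OF i] by blast
      then have "\<theta> p \<notin> \<theta> ` P i"
        using hom_in_image_iff[of "P i" p] P(1)[of i] J[of i] i p(2) unfolding prime_set_def by auto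
      then show ?thesis using p P(2)[OF i] by blast
    qed
    moreover have "primeideal (\<theta> ` P i) R" if "i \<le> n" for i
      using primeideal_image P(1)[OF that] J[OF that] by blast
    ultimately show ?A by (intro exI[of _ "\<lambda>i. \<theta> ` P i"]) blast
  qed
  then show ?thesis unfolding krull_dim_def by simp
qed

end

section \<open>The Stanley--Reisner ring as a quotient of the full polynomial ring\<close>

lemma carrier_polynomial_ring:
  "carrier (polynomial_ring K V) = {p. \<forall>m\<in>kys p. kys m \<subseteq> V}"
  unfolding polynomial_ring_def by simp

lemma polynomial_ring_simps [simp]:
  "x \<otimes>\<^bsub>polynomial_ring K V\<^esub> y = x * y"
  "x \<oplus>\<^bsub>polynomial_ring K V\<^esub> y = x + y"
  "\<one>\<^bsub>polynomial_ring K V\<^esub> = 1"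
  "\<zero>\<^bsub>polynomial_ring K V\<^esub> = 0"
  unfolding polynomial_ring_def by simp_all

lemma restr_in_carrier [simp]: "restr V p \<in> carrier (polynomial_ring K V)"
  unfolding carrier_polynomial_ring by (simp add: keys_restr)

lemma restr_carrier: "p \<in> carrier (polynomial_ring K V) \<Longrightarrow> restr V p = p"
  unfolding carrier_polynomial_ring by (intro restr_id) blast

text \<open>The carrier is the fixed set of the ring endomorphism \<open>restr V\<close>, which
  turns closure properties into equations.\<close>

lemma in_carrier_iff: "p \<in> carrier (polynomial_ring K V) \<longleftrightarrow> restr V p = p"
  using restr_carrier restr_in_carrier by metis

lemma cring_polynomial_ring: "cring (polynomial_ring K (V :: nat set))"
proof (rule cringI)
  show "abelian_group (polynomial_ring K V)"
  proof (rule abelian_groupI)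
    fix x assume "x \<in> carrier (polynomial_ring K V)"
    then have "- x \<in> carrier (polynomial_ring K V)"
      unfolding in_carrier_iff using restr_diff[of V 0 x] by simp
    then show "\<exists>y\<in>carrier (polynomial_ring K V). y \<oplus>\<^bsub>polynomial_ring K V\<^esub> x = \<zero>\<^bsub>polynomial_ring K V\<^esub>"
      by force
  qed (auto simp: in_carrier_iff restr_add add_ac)
  show "comm_monoid (polynomial_ring K V)"
    by (rule comm_monoidI) (auto simp: in_carrier_iff restr_mult mult_ac)
qed (auto simp: algebra_simps)

text \<open>A monomial whose support is a nonface is a multiple of the squarefree monomial of its
  support, which is one of the generators.\<close>

lemma stanley_reisner_ideal_eq:
  fixes K :: "'k::field itself"
  assumes V: "finite V" and \<Delta>: "down_closed \<Delta>"
  shows "stanley_reisner_ideal K V \<Delta> = sr_ideal \<Delta> \<inter> carrier (polynomial_ring K V)"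
proof -
  interpret PR: cring "polynomial_ring K V" by (rule cring_polynomial_ring)
  let ?G = "{\<Prod>v\<in>F. var v | F. F \<subseteq> V \<and> finite F \<and> F \<notin> \<Delta>}"
  let ?I = "sr_ideal \<Delta> \<inter> carrier (polynomial_ring K V)"
  have I: "ideal_set (sr_ideal \<Delta> :: 'k mpoly set)" by (rule ideal_set_sr_ideal[OF \<Delta>])
  have neg: "inv\<^bsub>add_monoid (polynomial_ring K V)\<^esub> x = - x" if "x \<in> carrier (polynomial_ring K V)" for x
  proof -
    have "- x \<in> carrier (polynomial_ring K V)"
      using that restr_diff[of V 0 x] unfolding in_carrier_iff by simp
    then have "\<ominus>\<^bsub>polynomial_ring K V\<^esub> x = - x" using that by (intro PR.minus_equality) auto
    then show ?thesis by (simp add: a_inv_def)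
  qed
  have ideal_I: "ideal ?I (polynomial_ring K V)"
  proof (rule idealI)
    show "subgroup ?I (add_monoid (polynomial_ring K V))"
    proof (rule subgroup.intro)
      fix x assume x: "x \<in> ?I"
      then have "- x \<in> ?I"
        using ideal_set_uminus[OF I, of x] restr_diff[of V 0 x] by (simp add: in_carrier_iff)
      then show "inv\<^bsub>add_monoid (polynomial_ring K V)\<^esub> x \<in> ?I" using x neg by simp
    qed (use ideal_set_add[OF I] ideal_set_zero[OF I] PR.a_closed PR.zero_closed in auto)
  qed (use ideal_set_mult_left[OF I] ideal_set_mult_right[OF I] PR.m_closed PR.ring_axioms in auto)
  have G: "?G \<subseteq> ?I"
    by (auto simp: prod_var sr_ideal_def carrier_polynomial_ring keys_squarefree_monom)
  have G': "?G \<subseteq> carrier (polynomial_ring K V)" using G by simp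
  show ?thesis
  proof
    show "stanley_reisner_ideal K V \<Delta> \<subseteq> ?I"
      unfolding stanley_reisner_ideal_def by (rule PR.genideal_minimal[OF ideal_I G])
  next
    interpret H: ideal "Idl\<^bsub>polynomial_ring K V\<^esub> ?G" "polynomial_ring K V"
      by (rule PR.genideal_ideal[OF G'])
    have gen: "sngl m c \<in> Idl\<^bsub>polynomial_ring K V\<^esub> ?G" if m: "kys m \<subseteq> V" "kys m \<notin> \<Delta>" for m and c :: 'k
    proof -
      have fin: "finite (kys m)" by simp
      have "(\<Prod>v\<in>kys m. var v) \<in> Idl\<^bsub>polynomial_ring K V\<^esub> ?G"
        by (rule subsetD[OF PR.genideal_self[OF G']]) (use m fin in blast)
      then have 1: "sngl (squarefree_monom (kys m)) (1::'k) \<in> Idl\<^bsub>polynomial_ring K V\<^esub> ?G"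
        by (simp add: prod_var)
      have "(m - squarefree_monom (kys m)) + squarefree_monom (kys m) = m"
        using lookup_squarefree_monom[OF fin]
        by (intro poly_mapping_eqI) (auto simp: lookup_add lookup_minus in_keys_iff)
      then have eq: "sngl (m - squarefree_monom (kys m)) c * sngl (squarefree_monom (kys m)) 1 = sngl m c"
        by (simp add: mult_single)
      have "kys (m - squarefree_monom (kys m)) \<subseteq> kys m"
        by (auto simp: in_keys_iff lookup_minus)
      then have "sngl (m - squarefree_monom (kys m)) c \<in> carrier (polynomial_ring K V)"
        using m unfolding carrier_polynomial_ring by auto
      from H.I_l_closed[OF 1 this] show ?thesis by (simp add: eq)
    qed
    show "?I \<subseteq> stanley_reisner_ideal K V \<Delta>"
    proof
      fix p assume p: "p \<in> ?I"
      have "(\<Sum>m\<in>M. sngl m (lkp p m)) \<in> Idl\<^bsub>polynomial_ring K V\<^esub> ?G" if "finite M" "M \<subseteq> kys p" for M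
        using that
      proof (induction M)
        case empty
        then show ?case using H.zero_closed by simp
      next
        case (insert m M)
        then have "sngl m (lkp p m) \<in> Idl\<^bsub>polynomial_ring K V\<^esub> ?G"
          using p by (intro gen) (auto simp: sr_ideal_def carrier_polynomial_ring)
        then show ?case using insert H.a_closed by simp
      qed
      from this[OF finite_keys subset_refl] show "p \<in> stanley_reisner_ideal K V \<Delta>"
        unfolding stanley_reisner_ideal_def by (simp add: sum_single_keys)
    qed
  qed
qed

text \<open>Composed with \<open>restr V\<close> so as to be defined on all polynomials. The kernel
  is still \<open>sr_ideal\<close> when the complex lives on \<open>V\<close>, since the variables
  set to zero already belong to it.\<close>

definition sr_proj ::
    "'k::field itself \<Rightarrow> nat set \<Rightarrow> nat set set \<Rightarrow> 'k mpoly \<Rightarrow> 'k mpoly set" where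
  "sr_proj K V \<Delta> p = stanley_reisner_ideal K V \<Delta> +>\<^bsub>polynomial_ring K V\<^esub> restr V p"

lemma surj_ring_hom_sr_proj:
  fixes K :: "'k::field itself"
  assumes V: "finite V" and \<Delta>: "down_closed \<Delta>" "\<Delta> \<subseteq> Pow V"
  shows "surj_ring_hom (stanley_reisner_ring K V \<Delta>) (sr_proj K V \<Delta>) (sr_ideal \<Delta>)"
proof -
  interpret PR: cring "polynomial_ring K V" by (rule cring_polynomial_ring)
  let ?I = "stanley_reisner_ideal K V \<Delta>"
  have "ideal ?I (polynomial_ring K V)"
    unfolding stanley_reisner_ideal_def
    by (rule PR.genideal_ideal) (auto simp: prod_var carrier_polynomial_ring keys_squarefree_monom)
  then interpret I: ideal ?I "polynomial_ring K V" .
  have hom: "(+>\<^bsub>polynomial_ring K V\<^esub>) ?I \<in> ring_hom (polynomial_ring K V) (stanley_reisner_ring K V \<Delta>)"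
    unfolding stanley_reisner_ring_def by (rule I.rcos_ring_hom)
  show ?thesis
  proof (rule surj_ring_hom.intro)
    show "cring (stanley_reisner_ring K V \<Delta>)"
      unfolding stanley_reisner_ring_def by (rule I.quotient_is_cring[OF PR.is_cring])
    show "surj_ring_hom_axioms (stanley_reisner_ring K V \<Delta>) (sr_proj K V \<Delta>) (sr_ideal \<Delta>)"
    proof
      show "range (sr_proj K V \<Delta>) = carrier (stanley_reisner_ring K V \<Delta>)"
      proof
        show "range (sr_proj K V \<Delta>) \<subseteq> carrier (stanley_reisner_ring K V \<Delta>)"
          using ring_hom_closed[OF hom] by (auto simp: sr_proj_def)
        show "carrier (stanley_reisner_ring K V \<Delta>) \<subseteq> range (sr_proj K V \<Delta>)"
        proof
          fix x assume "x \<in> carrier (stanley_reisner_ring K V \<Delta>)"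
          then obtain p where "p \<in> carrier (polynomial_ring K V)" "x = ?I +>\<^bsub>polynomial_ring K V\<^esub> p"
            unfolding stanley_reisner_ring_def FactRing_def A_RCOSETS_def' by auto
          then have "x = sr_proj K V \<Delta> p" by (simp add: sr_proj_def restr_carrier)
          then show "x \<in> range (sr_proj K V \<Delta>)" by blast
        qed
      qed
    next
      fix p q :: "'k mpoly"
      show "sr_proj K V \<Delta> (p + q) = sr_proj K V \<Delta> p \<oplus>\<^bsub>stanley_reisner_ring K V \<Delta>\<^esub> sr_proj K V \<Delta> q"
        using ring_hom_add[OF hom, of "restr V p" "restr V q"] by (simp add: sr_proj_def restr_add)
      show "sr_proj K V \<Delta> (p * q) = sr_proj K V \<Delta> p \<otimes>\<^bsub>stanley_reisner_ring K V \<Delta>\<^esub> sr_proj K V \<Delta> q"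
        using ring_hom_mult[OF hom, of "restr V p" "restr V q"] by (simp add: sr_proj_def restr_mult)
      have "sr_proj K V \<Delta> p = \<zero>\<^bsub>stanley_reisner_ring K V \<Delta>\<^esub> \<longleftrightarrow> restr V p \<in> ?I"
        unfolding sr_proj_def stanley_reisner_ring_def FactRing_def
        using I.a_rcos_const[of "restr V p"] PR.a_coset_join1[OF _ _ I.a_subgroup, of "restr V p"] by auto
      also have "\<dots> \<longleftrightarrow> p \<in> sr_ideal \<Delta>"
        unfolding stanley_reisner_ideal_eq[OF V \<Delta>(1)] using \<Delta>(2)
        by (auto simp: sr_ideal_def keys_restr)
      finally show "sr_proj K V \<Delta> p = \<zero>\<^bsub>stanley_reisner_ring K V \<Delta>\<^esub> \<longleftrightarrow> p \<in> sr_ideal \<Delta>" .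
    next
      show "sr_proj K V \<Delta> 1 = \<one>\<^bsub>stanley_reisner_ring K V \<Delta>\<^esub>"
        using ring_hom_one[OF hom] by (simp add: sr_proj_def)
    qed
  qed
qed

text \<open>The preimage of the irrelevant ideal, written with \<open>adjoin\<close> so that the
  description of generated ideals for sequences applies to it.\<close>

definition sr_irrelevant :: "nat set \<Rightarrow> nat set set \<Rightarrow> ('k::field) mpoly set" where
  "sr_irrelevant V \<Delta> = adjoin (sr_ideal \<Delta>) (map var (sorted_list_of_set V))"

lemma sr_irrelevant:
  assumes "finite V" "down_closed \<Delta>"
  shows "ideal_set (sr_irrelevant V \<Delta> :: ('k::field) mpoly set)"
    and "sr_ideal \<Delta> \<subseteq> (sr_irrelevant V \<Delta> :: ('k::field) mpoly set)"
    and "v \<in> V \<Longrightarrow> var v \<in> (sr_irrelevant V \<Delta> :: ('k::field) mpoly set)"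
    and "ideal_set I \<Longrightarrow> sr_ideal \<Delta> \<subseteq> I \<Longrightarrow> var ` V \<subseteq> I \<Longrightarrow>
      (sr_irrelevant V \<Delta> :: ('k::field) mpoly set) \<subseteq> I"
proof -
  note I = ideal_set_sr_ideal[OF assms(2), where 'k='k]
  show "ideal_set (sr_irrelevant V \<Delta> :: 'k mpoly set)"
    unfolding sr_irrelevant_def by (rule ideal_set_adjoin[OF I])
  show "sr_ideal \<Delta> \<subseteq> (sr_irrelevant V \<Delta> :: 'k mpoly set)"
    unfolding sr_irrelevant_def by (rule subset_adjoin)
  show "v \<in> V \<Longrightarrow> var v \<in> (sr_irrelevant V \<Delta> :: 'k mpoly set)"
    unfolding sr_irrelevant_def using gen_in_adjoin[OF I, of "map var (sorted_list_of_set V)"] assms(1) by auto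
  show "ideal_set I \<Longrightarrow> sr_ideal \<Delta> \<subseteq> I \<Longrightarrow> var ` V \<subseteq> I \<Longrightarrow>
      (sr_irrelevant V \<Delta> :: 'k mpoly set) \<subseteq> I"
    unfolding sr_irrelevant_def using assms(1) by (intro adjoin_minimal) auto
qed

lemma irrelevant_ideal_eq:
  fixes K :: "'k::field itself"
  assumes "finite V" "down_closed \<Delta>" "\<Delta> \<subseteq> Pow V"
  shows "irrelevant_ideal K V \<Delta> = sr_proj K V \<Delta> ` sr_irrelevant V \<Delta>"
proof -
  interpret surj_ring_hom "stanley_reisner_ring K V \<Delta>" "sr_proj K V \<Delta>" "sr_ideal \<Delta>"
    by (rule surj_ring_hom_sr_proj[OF assms])
  have "(\<lambda>v. stanley_reisner_ideal K V \<Delta> +>\<^bsub>polynomial_ring K V\<^esub> var v) ` V = sr_proj K V \<Delta> ` set (map var (sorted_list_of_set V))"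
    using assms(1) by (auto simp: sr_proj_def restr_var image_image)
  then show ?thesis unfolding irrelevant_ideal_def sr_irrelevant_def by (simp only: genideal_adjoin)
qed

text \<open>The Krull dimension is \<open>d\<close> by the two chain lemmas, and no regular sequence
  is longer than \<open>d\<close>; hence the supremum defining the depth reaches \<open>d\<close>
  only if it is attained.\<close>

lemma cohen_macaulay_iff:
  fixes K :: "'k::field itself"
  assumes V: "finite V" and \<Delta>: "down_closed \<Delta>" "\<Delta> \<subseteq> Pow V"
    and dim: "\<And>A. A \<in> \<Delta> \<Longrightarrow> card A \<le> d" and top: "F \<in> \<Delta>" "card F = d"
  shows "cohen_macaulay K V \<Delta> \<longleftrightarrow>
    (\<exists>fs :: 'k mpoly list.
        length fs = d \<and> regular_list (sr_ideal \<Delta>) fs \<and> set fs \<subseteq> sr_irrelevant V \<Delta>)"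
proof -
  interpret surj_ring_hom "stanley_reisner_ring K V \<Delta>" "sr_proj K V \<Delta>" "sr_ideal \<Delta>"
    by (rule surj_ring_hom_sr_proj[OF V \<Delta>])
  note irr = sr_irrelevant[OF V \<Delta>(1), where 'k='k]
  note I = ideal_set_kernel
  let ?m = "sr_irrelevant V \<Delta> :: 'k mpoly set"
  have chain_le: "n \<le> d" if "\<forall>i\<le>n. prime_set (P i)" "\<forall>i<n. P i \<subset> P (Suc i)" "sr_ideal \<Delta> \<subseteq> P 0"
    for n and P :: "nat \<Rightarrow> 'k mpoly set"
    using sr_prime_chain_bound[OF V \<Delta>(2) dim, where P = P and k = n] that by blast
  have krull: "krull_dim (stanley_reisner_ring K V \<Delta>) = enat d"
    unfolding krull_dim_eq
  proof (rule antisym)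
    show "Sup {enat n | n. \<exists>P :: nat \<Rightarrow> 'k mpoly set. (\<forall>i\<le>n. prime_set (P i)) \<and> (\<forall>i<n. P i \<subset> P (Suc i)) \<and> sr_ideal \<Delta> \<subseteq> P 0} \<le> enat d"
      using chain_le by (intro Sup_least) auto
    have "finite F" using top \<Delta>(2) V finite_subset by blast
    from sr_prime_chain[OF this, where 'k='k] obtain P :: "nat \<Rightarrow> 'k mpoly set" where
      P: "\<forall>i\<le>d. prime_set (P i)" "\<forall>i<d. P i \<subset> P (Suc i)" "P 0 = sr_ideal (Pow F)" using top(2) by blast
    have "Pow F \<subseteq> \<Delta>" using top(1) \<Delta>(1) unfolding down_closed_def by blast
    then have "sr_ideal \<Delta> \<subseteq> P 0" unfolding P(3) by (rule sr_ideal_antimono)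
    then show "enat d \<le> Sup {enat n | n. \<exists>P :: nat \<Rightarrow> 'k mpoly set. (\<forall>i\<le>n. prime_set (P i)) \<and> (\<forall>i<n. P i \<subset> P (Suc i)) \<and> sr_ideal \<Delta> \<subseteq> P 0}"
      using P by (intro Sup_upper) blast
  qed
  have len_le: "length fs \<le> d" if reg: "regular_list (sr_ideal \<Delta>) fs" for fs :: "'k mpoly list"
    using regular_list_prime_chain[OF I reg] chain_le by blast
  let ?A = "{enat (length fs) | fs :: 'k mpoly list. regular_list (sr_ideal \<Delta>) fs \<and> set fs \<subseteq> ?m}"
  have "cohen_macaulay K V \<Delta> \<longleftrightarrow> Sup ?A = enat d"
    unfolding cohen_macaulay_def krull irrelevant_ideal_eq[OF V \<Delta>] depth_eq[OF irr(1,2)] ..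
  also have "\<dots> \<longleftrightarrow> (\<exists>fs :: 'k mpoly list.
        length fs = d \<and> regular_list (sr_ideal \<Delta>) fs \<and> set fs \<subseteq> ?m)" (is "_ \<longleftrightarrow> ?E")
  proof
    assume sup: "Sup ?A = enat d"
    show ?E
    proof (rule ccontr)
      assume "\<not> ?E"
      then have lt: "length fs < d" if "regular_list (sr_ideal \<Delta>) fs" "set fs \<subseteq> ?m" for fs :: "'k mpoly list"
        using len_le[OF that(1)] that by (metis le_neq_implies_less)
      \<comment> \<open>Truncated subtraction leaves \<open>d = 0\<close> as the only escape, and
        there the empty sequence is regular because the ring is nonzero.\<close>
      have "Sup ?A \<le> enat (d - 1)" using lt by (intro Sup_least) fastforce
      then have "d = 0" using sup by (cases d) auto
      moreover have "1 \<notin> (sr_ideal \<Delta> :: 'k mpoly set)"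
        using top(1) \<Delta>(1) unfolding sr_ideal_def down_closed_def by auto
      ultimately show False using lt[of "[]"] by simp
    qed
  next
    assume ?E
    then have "enat d \<in> ?A" by blast
    moreover have "\<forall>x\<in>?A. x \<le> enat d" using len_le by auto
    ultimately show "Sup ?A = enat d" by (intro antisym Sup_least Sup_upper) auto
  qed
  finally show ?thesis .
qed

section \<open>Vertex decompositions and shellings\<close>

lemma exists_facet:
  assumes "finite \<Delta>" "F \<in> \<Delta>" shows "\<exists>G\<in>facets \<Delta>. F \<subseteq> G"
  using finite_has_maximal2[OF assms] unfolding facets_def by blast

lemma facets_subset: "facets \<Delta> \<subseteq> \<Delta>"
  unfolding facets_def by blast

lemma facets_Pow [simp]: "facets (Pow F) = {F}"
  unfolding facets_def by blast

lemma Union_Pow_facets: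
  assumes "finite \<Delta>" "down_closed \<Delta>" shows "(\<Union>F\<in>facets \<Delta>. Pow F) = \<Delta>"
proof (intro equalityI subsetI)
  fix A assume "A \<in> (\<Union>F\<in>facets \<Delta>. Pow F)"
  then obtain F where "F \<in> \<Delta>" "A \<subseteq> F" using facets_subset by blast
  then show "A \<in> \<Delta>" using assms(2) unfolding down_closed_def by blast
qed (use exists_facet[OF assms(1)] in blast)

lemma facets_generated:
  assumes "\<And>A B. A \<in> \<F> \<Longrightarrow> B \<in> \<F> \<Longrightarrow> A \<subseteq> B \<Longrightarrow> A = B"
  shows "facets {A. \<exists>F\<in>\<F>. A \<subseteq> F} = \<F>"
proof (intro equalityI subsetI)
  fix A assume A: "A \<in> facets {A. \<exists>F\<in>\<F>. A \<subseteq> F}"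
  then obtain F where "F \<in> \<F>" "A \<subseteq> F" unfolding facets_def by blast
  then have "A = F" using A unfolding facets_def by blast
  then show "A \<in> \<F>" using \<open>F \<in> \<F>\<close> by simp
next
  fix A assume A: "A \<in> \<F>"
  have "A = G" if "F \<in> \<F>" "G \<subseteq> F" "A \<subseteq> G" for F G
  proof -
    have "A = F" using assms[OF A that(1)] that by blast
    then show ?thesis using that by blast
  qed
  then show "A \<in> facets {A. \<exists>F\<in>\<F>. A \<subseteq> F}" using A unfolding facets_def by blast
qed

text \<open>The shelling of the deletion is followed by the shelling of the link coned with
  \<open>v\<close>. The shedding condition guarantees that facets of the deletion stay facets of the
  whole complex.\<close>

lemma shelling_shed:
  assumes \<Delta>: "finite \<Delta>" "down_closed \<Delta>" "\<And>F. F \<in> \<Delta> \<Longrightarrow> finite F" and v: "{v} \<in> \<Delta>"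
    and shed: "facets (vertex_link \<Delta> v) \<inter> facets (vertex_deletion \<Delta> v) = {}"
    and Ls: "shelling (vertex_link \<Delta> v) Ls" and Ds: "shelling (vertex_deletion \<Delta> v) Ds"
  shows "shelling \<Delta> (Ds @ map (insert v) Ls)"
proof -
  let ?L = "vertex_link \<Delta> v" and ?D = "vertex_deletion \<Delta> v"
  have dc: "A \<in> \<Delta> \<Longrightarrow> B \<subseteq> A \<Longrightarrow> B \<in> \<Delta>" for A B using \<Delta>(2) unfolding down_closed_def by blast
  have LD: "?L \<subseteq> ?D" using dc unfolding vertex_link_def vertex_deletion_def by blast
  have vL: "v \<notin> F" if "F \<in> ?L" for F using that unfolding vertex_link_def by blast
  have vD: "v \<notin> F" if "F \<in> ?D" for F using that unfolding vertex_deletion_def by blast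
  have finD: "finite ?D" using \<Delta>(1) unfolding vertex_deletion_def by simp
  have dcD: "down_closed ?D" using dc unfolding down_closed_def vertex_deletion_def by blast
  have sL: "set Ls = facets ?L" "distinct Ls" and sD: "set Ds = facets ?D" "distinct Ds"
    using Ls Ds unfolding shelling_def by auto
  have memL: "F \<in> ?L" if "F \<in> set Ls" for F using that sL facets_subset by blast
  have "facets \<Delta> = facets ?D \<union> insert v ` facets ?L"
  proof (intro equalityI subsetI)
    fix F assume F: "F \<in> facets \<Delta>"
    show "F \<in> facets ?D \<union> insert v ` facets ?L"
    proof (cases "v \<in> F")
      case True
      have "F - {v} \<in> facets ?L" unfolding facets_def
      proof (intro CollectI conjI ballI impI)
        show "F - {v} \<in> ?L" using F True unfolding vertex_link_def facets_def by (simp add: insert_absorb)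
        fix G assume G: "G \<in> ?L" "F - {v} \<subseteq> G"
        then have "insert v G \<in> \<Delta>" "F \<subseteq> insert v G" unfolding vertex_link_def by auto
        then have "F = insert v G" using F unfolding facets_def by blast
        then show "F - {v} = G" using vL[OF G(1)] by auto
      qed
      moreover have "F = insert v (F - {v})" using True by blast
      ultimately show ?thesis by blast
    next
      case False
      then show ?thesis using F unfolding facets_def vertex_deletion_def by blast
    qed
  next
    fix F assume "F \<in> facets ?D \<union> insert v ` facets ?L"
    then show "F \<in> facets \<Delta>"
    proof
      assume F: "F \<in> facets ?D"
      have "F \<in> \<Delta>" "v \<notin> F" using F facets_subset[of ?D] unfolding vertex_deletion_def by auto
      \<comment> \<open>If a facet of the deletion extended by \<open>v\<close>, it would lie in the
        link and be maximal there as well, against the shedding condition.\<close>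
      moreover have "F = G" if G: "G \<in> \<Delta>" "F \<subseteq> G" for G
      proof (cases "v \<in> G")
        case True
        have "insert v F \<in> \<Delta>" using dc[OF G(1)] True G(2) by blast
        then have "F \<in> ?L" using \<open>v \<notin> F\<close> unfolding vertex_link_def by blast
        then have "F \<in> facets ?L" using F LD unfolding facets_def by blast
        then show ?thesis using F shed by blast
      next
        case False
        then show ?thesis using F G unfolding facets_def vertex_deletion_def by blast
      qed
      ultimately show ?thesis unfolding facets_def by blast
    next
      assume "F \<in> insert v ` facets ?L"
      then obtain E where E: "F = insert v E" "E \<in> facets ?L" by blast
      then have EL: "E \<in> ?L" using facets_subset by blast
      then have "F \<in> \<Delta>" using E unfolding vertex_link_def by blast
      moreover have "F = G" if G: "G \<in> \<Delta>" "F \<subseteq> G" for G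
      proof -
        have "v \<in> G" using G E by blast
        then have "G - {v} \<in> ?L" using G unfolding vertex_link_def by (simp add: insert_absorb)
        moreover have "E \<subseteq> G - {v}" using G(2) E(1) vL[OF EL] by blast
        ultimately have "E = G - {v}" using E(2) unfolding facets_def by blast
        then show ?thesis using E \<open>v \<in> G\<close> by blast
      qed
      ultimately show ?thesis unfolding facets_def by blast
    qed
  qed
  moreover have "distinct (Ds @ map (insert v) Ls)"
  proof -
    have "inj_on (insert v) (set Ls)"
    proof (rule inj_onI)
      fix A B assume "A \<in> set Ls" "B \<in> set Ls" "insert v A = insert v B"
      then show "A = B" using vL[OF memL] by (metis Diff_insert_absorb)
    qed
    moreover have "set Ds \<inter> insert v ` set Ls = {}" using sD vD facets_subset[of ?D] by blast
    ultimately show ?thesis using sL sD by (simp add: distinct_map)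
  qed
  moreover have "card G + 1 = card ((Ds @ map (insert v) Ls) ! j)"
    if j: "0 < j" "j < length (Ds @ map (insert v) Ls)"
      and G: "G \<in> facets ((\<Union>i<j. Pow ((Ds @ map (insert v) Ls) ! i)) \<inter> Pow ((Ds @ map (insert v) Ls) ! j))"
    for j G
  proof (cases "j < length Ds")
    case True
    have "(\<Union>i<j. Pow ((Ds @ map (insert v) Ls) ! i)) = (\<Union>i<j. Pow (Ds ! i))"
      using True by (intro SUP_cong) (auto simp: nth_append)
    then show ?thesis using Ds G j True unfolding shelling_def by (simp add: nth_append)
  next
    case False
    define k where "k = j - length Ds"
    have k: "j = length Ds + k" "k < length Ls" using False j unfolding k_def by auto
    let ?Lk = "Ls ! k"
    have Lk: "?Lk \<in> facets ?L" "?Lk \<in> ?L" "v \<notin> ?Lk" "finite ?Lk"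
    proof -
      show "?Lk \<in> facets ?L" using sL k nth_mem by blast
      then show L: "?Lk \<in> ?L" using facets_subset by blast
      show "v \<notin> ?Lk" using vL[OF L] .
      show "finite ?Lk" using L LD \<Delta>(3) unfolding vertex_deletion_def by blast
    qed
    have nthk: "(Ds @ map (insert v) Ls) ! j = insert v ?Lk" using k by (simp add: nth_append)
    \<comment> \<open>Once all of \<open>Ds\<close> has been listed, the complex built so far is the
      entire deletion together with the cones over the earlier facets of the link.\<close>
    have un: "(\<Union>i<j. Pow ((Ds @ map (insert v) Ls) ! i)) = ?D \<union> (\<Union>i<k. Pow (insert v (Ls ! i)))"
    proof -
      have "{..<j} = {..<length Ds} \<union> (\<lambda>i. length Ds + i) ` {..<k}"
      proof (intro equalityI subsetI)
        fix x assume "x \<in> {..<j}"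
        then show "x \<in> {..<length Ds} \<union> (\<lambda>i. length Ds + i) ` {..<k}"
          using k by (cases "x < length Ds") (auto intro!: image_eqI[of _ _ "x - length Ds"])
      qed (use k in auto)
      then have "(\<Union>i<j. Pow ((Ds @ map (insert v) Ls) ! i)) =
         (\<Union>i<length Ds. Pow ((Ds @ map (insert v) Ls) ! i)) \<union> (\<Union>i<k. Pow ((Ds @ map (insert v) Ls) ! (length Ds + i)))"
        by auto
      also have "(\<Union>i<length Ds. Pow ((Ds @ map (insert v) Ls) ! i)) = (\<Union>F\<in>set Ds. Pow F)"
      proof -
        have "(\<Union>i<length Ds. Pow ((Ds @ map (insert v) Ls) ! i)) = (\<Union>i<length Ds. Pow (Ds ! i))"
          by (intro SUP_cong) (auto simp: nth_append)
        moreover have "set Ds = (!) Ds ` {..<length Ds}" by (auto simp: in_set_conv_nth)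
        ultimately show ?thesis by simp
      qed
      also have "\<dots> = ?D" unfolding sD by (rule Union_Pow_facets[OF finD dcD])
      also have "(\<Union>i<k. Pow ((Ds @ map (insert v) Ls) ! (length Ds + i))) = (\<Union>i<k. Pow (insert v (Ls ! i)))"
        using k by (intro SUP_cong) (auto simp: nth_append)
      finally show ?thesis .
    qed
    let ?X = "(?D \<union> (\<Union>i<k. Pow (insert v (Ls ! i)))) \<inter> Pow (insert v ?Lk)"
    have GX: "G \<in> facets ?X" using G unfolding un nthk .
    show ?thesis
    proof (cases "v \<in> G")
      case False
      \<comment> \<open>The link is contained in the deletion, so \<open>?Lk\<close> is itself a
        face of the intersection and has exactly one vertex less than the new facet.\<close>
      have "G \<subseteq> ?Lk" using GX False facets_subset[of ?X] by blast
      moreover have "?Lk \<in> ?X" using Lk LD by blast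
      ultimately have "G = ?Lk" using GX unfolding facets_def by blast
      then show ?thesis using nthk Lk by simp
    next
      case True
      have "G \<in> ?X" using GX facets_subset by blast
      then obtain i where i: "i < k" "G \<subseteq> insert v (Ls ! i)" using True vD by blast
      let ?Y = "(\<Union>i<k. Pow (Ls ! i)) \<inter> Pow ?Lk"
      have "G - {v} \<in> facets ?Y" unfolding facets_def
      proof (intro CollectI conjI ballI impI)
        show "G - {v} \<in> ?Y" using i \<open>G \<in> ?X\<close> by blast
        fix H assume H: "H \<in> ?Y" "G - {v} \<subseteq> H"
        then have "insert v H \<in> ?X" by blast
        moreover have "G \<subseteq> insert v H" using H by blast
        ultimately have "G = insert v H" using GX unfolding facets_def by blast
        then show "G - {v} = H" using H Lk(3) by blast
      qed
      then have "card (G - {v}) + 1 = card ?Lk" using Ls i k unfolding shelling_def by auto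
      moreover have "finite G" using \<open>G \<in> ?X\<close> Lk(4) finite_subset by blast
      ultimately show ?thesis using True nthk Lk by (simp add: card_Diff_singleton) (metis Suc_pred card_gt_0_iff empty_iff)
    qed
  qed
  ultimately show ?thesis unfolding shelling_def using sL sD by auto
qed

lemma vertex_decomposable_imp_shellable:
  assumes "vertex_decomposable \<Delta>" "finite \<Delta>" "down_closed \<Delta>" "\<And>F. F \<in> \<Delta> \<Longrightarrow> finite F"
  shows "shellable \<Delta>"
  using assms
proof (induction rule: vertex_decomposable.induct)
  case void
  have "shelling {} []" unfolding shelling_def facets_def by simp
  then show ?case unfolding shellable_def by blast
next
  case (simplex F)
  have "shelling (Pow F) [F]" unfolding shelling_def by simp
  then show ?case unfolding shellable_def by blast
next
  case (shed v \<Delta>)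
  have "vertex_link \<Delta> v \<subseteq> (\<lambda>F. F - {v}) ` \<Delta>"
  proof
    fix F assume "F \<in> vertex_link \<Delta> v"
    then have "insert v F \<in> \<Delta>" "F = insert v F - {v}" unfolding vertex_link_def by auto
    then show "F \<in> (\<lambda>F. F - {v}) ` \<Delta>" by blast
  qed
  then have "finite (vertex_link \<Delta> v)" using shed.prems(1) finite_surj by blast
  moreover have "down_closed (vertex_link \<Delta> v)" unfolding down_closed_def
  proof (intro ballI allI impI)
    fix A B assume "A \<in> vertex_link \<Delta> v" "B \<subseteq> A"
    then have "v \<notin> B" "insert v A \<in> \<Delta>" "insert v B \<subseteq> insert v A" unfolding vertex_link_def by auto
    then show "B \<in> vertex_link \<Delta> v"
      using shed.prems(2) unfolding vertex_link_def down_closed_def by blast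
  qed
  moreover have "finite F" if "F \<in> vertex_link \<Delta> v" for F
    using that shed.prems(3)[of "insert v F"] unfolding vertex_link_def by simp
  ultimately have "shellable (vertex_link \<Delta> v)" using shed.IH(1) by blast
  moreover have "shellable (vertex_deletion \<Delta> v)"
    using shed.IH(2) shed.prems unfolding vertex_deletion_def down_closed_def by fastforce
  ultimately show ?case
    using shelling_shed[OF shed.prems shed.hyps(1,2)] unfolding shellable_def by blast
qed

section \<open>Vertex decompositions of point sets, paths and cycles\<close>

lemma vertex_decomposable_points:
  assumes "finite A" "A \<noteq> {}"
  shows "vertex_decomposable {F. \<exists>a\<in>A. F \<subseteq> {a}}"
  using assms
proof (induction rule: finite_ne_induct)
  case (singleton a)
  have "{F. \<exists>a\<in>{a}. F \<subseteq> {a}} = Pow {a}" by auto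
  then show ?case by (metis finite.emptyI finite_insert simplex)
next
  case (insert a A)
  let ?\<Delta> = "{F. \<exists>b\<in>insert a A. F \<subseteq> {b}}"
  have link: "vertex_link ?\<Delta> a = Pow {}" unfolding vertex_link_def using insert.hyps by auto
  have del: "vertex_deletion ?\<Delta> a = {F. \<exists>b\<in>A. F \<subseteq> {b}}" (is "_ = ?D")
    unfolding vertex_deletion_def using insert.hyps by (auto simp: subset_singleton_iff)
  show ?case
  proof (rule shed[of a])
    have "{} \<notin> facets ?D" unfolding facets_def using insert.hyps by blast
    then show "facets (vertex_link ?\<Delta> a) \<inter> facets (vertex_deletion ?\<Delta> a) = {}"
      unfolding link del facets_Pow by blast
    show "vertex_decomposable (vertex_link ?\<Delta> a)" unfolding link by (rule simplex) simp
    show "vertex_decomposable (vertex_deletion ?\<Delta> a)" unfolding del by (rule insert.IH)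
  qed simp
qed


text \<open>The last vertex is shed: its link is one point, which is not a facet of the shorter path
  because that path still has an edge there.\<close>

lemma vertex_decomposable_path:
  "vertex_decomposable {F. \<exists>i. a \<le> i \<and> i \<le> a + k \<and> F \<subseteq> {i, Suc i :: nat}}"
proof (induction k)
  case 0
  have "{F. \<exists>i. a \<le> i \<and> i \<le> a + 0 \<and> F \<subseteq> {i, Suc i}} = Pow {a, Suc a}" by auto
  then show ?case by (metis finite.emptyI finite_insert simplex)
next
  case (Suc k)
  let ?\<Delta> = "\<lambda>k. {F. \<exists>i. a \<le> i \<and> i \<le> a + k \<and> F \<subseteq> {i, Suc i}}"
  let ?v = "Suc (a + Suc k)" and ?u = "a + Suc k"
  have link: "vertex_link (?\<Delta> (Suc k)) ?v = Pow {?u}"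
  proof (intro equalityI subsetI)
    fix F assume "F \<in> vertex_link (?\<Delta> (Suc k)) ?v"
    then obtain i where i: "?v \<notin> F" "i \<le> ?u" "insert ?v F \<subseteq> {i, Suc i}" unfolding vertex_link_def by auto
    then have "i = ?u" by auto
    then show "F \<in> Pow {?u}" using i by auto
  next
    fix F assume "F \<in> Pow {?u}"
    then have "?v \<notin> F" "insert ?v F \<subseteq> {?u, Suc ?u}" by auto
    then show "F \<in> vertex_link (?\<Delta> (Suc k)) ?v" unfolding vertex_link_def by (force intro: exI[of _ ?u])
  qed
  have del: "vertex_deletion (?\<Delta> (Suc k)) ?v = ?\<Delta> k"
  proof (intro equalityI subsetI)
    fix F assume "F \<in> vertex_deletion (?\<Delta> (Suc k)) ?v"
    then obtain i where i: "?v \<notin> F" "a \<le> i" "i \<le> ?u" "F \<subseteq> {i, Suc i}" unfolding vertex_deletion_def by auto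
    show "F \<in> ?\<Delta> k"
    proof (cases "i = ?u")
      case True
      then have "F \<subseteq> {a + k, Suc (a + k)}" using i by auto
      then show ?thesis by (auto intro!: exI[of _ "a + k"])
    next
      case False
      then show ?thesis using i by (auto intro!: exI[of _ i])
    qed
  next
    fix F assume "F \<in> ?\<Delta> k"
    then obtain i where i: "a \<le> i" "i \<le> a + k" "F \<subseteq> {i, Suc i}" by auto
    moreover have "?v \<notin> F" using i by auto
    ultimately show "F \<in> vertex_deletion (?\<Delta> (Suc k)) ?v" unfolding vertex_deletion_def by (auto intro!: exI[of _ i])
  qed
  show ?case
  proof (rule shed[of ?v])
    have "{?u} \<notin> facets (?\<Delta> k)"
    proof
      assume f: "{?u} \<in> facets (?\<Delta> k)"
      have "{a + k, Suc (a + k)} \<in> ?\<Delta> k" by (auto intro!: exI[of _ "a + k"])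
      moreover have "{?u} \<subseteq> {a + k, Suc (a + k)}" by simp
      ultimately have "{?u} = {a + k, Suc (a + k)}" using f unfolding facets_def by blast
      then show False by auto
    qed
    then show "facets (vertex_link (?\<Delta> (Suc k)) ?v) \<inter> facets (vertex_deletion (?\<Delta> (Suc k)) ?v) = {}"
      unfolding link del by simp
    show "vertex_decomposable (vertex_link (?\<Delta> (Suc k)) ?v)" unfolding link by (rule simplex) simp
    show "vertex_decomposable (vertex_deletion (?\<Delta> (Suc k)) ?v)" unfolding del by (rule Suc.IH)
  qed (auto intro!: exI[of _ ?u])
qed

text \<open>Vertex \<open>0\<close> is shed: the deletion is a path and the link consists of its two
  end points, each of which lies on an edge of the path.\<close>

lemma vertex_decomposable_cycle:
  assumes "4 \<le> (n::nat)"
  shows "vertex_decomposable {F. \<exists>i<n. F \<subseteq> {i, if Suc i < n then Suc i else 0}}" (is "vertex_decomposable ?\<Delta>")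
proof -
  \<comment> \<open>The path has vertices \<open>1, ..., n - 1\<close>; its last edge starts at
    \<open>n - 2\<close>, written as \<open>1 + (n - 3)\<close> to match the form of the path
    lemma.\<close>
  let ?P = "{F. \<exists>i. 1 \<le> i \<and> i \<le> 1 + (n - 3) \<and> F \<subseteq> {i, Suc i}}" and ?Q = "{F. \<exists>a\<in>{1, n - 1}. F \<subseteq> {a}}"
  have link: "vertex_link ?\<Delta> 0 = ?Q"
  proof (intro equalityI subsetI)
    fix F assume "F \<in> vertex_link ?\<Delta> 0"
    then obtain i where i: "0 \<notin> F" "i < n" "insert 0 F \<subseteq> {i, if Suc i < n then Suc i else 0}"
      unfolding vertex_link_def by auto
    then have "i = 0 \<or> i = n - 1" by (auto split: if_splits)
    then show "F \<in> ?Q" using i assms by (auto split: if_splits)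
  next
    fix F assume "F \<in> ?Q"
    then consider "F \<subseteq> {1}" | "F \<subseteq> {n - 1}" by auto
    then show "F \<in> vertex_link ?\<Delta> 0"
    proof cases
      case 1
      then have "0 \<notin> F" "insert 0 F \<subseteq> {0, if Suc 0 < n then Suc 0 else 0}" using assms by auto
      then show ?thesis unfolding vertex_link_def using assms by (auto intro!: exI[of _ 0])
    next
      case 2
      then have "0 \<notin> F" "insert 0 F \<subseteq> {n - 1, if Suc (n - 1) < n then Suc (n - 1) else 0}" using assms by auto
      then show ?thesis unfolding vertex_link_def using assms by (intro CollectI conjI exI[of _ "n - 1"]) auto
    qed
  qed
  have del: "vertex_deletion ?\<Delta> 0 = ?P"
  proof (intro equalityI subsetI)
    fix F assume "F \<in> vertex_deletion ?\<Delta> 0"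
    then obtain i where i: "0 \<notin> F" "i < n" "F \<subseteq> {i, if Suc i < n then Suc i else 0}"
      unfolding vertex_deletion_def by auto
    consider "i = 0" | "i = n - 1" | "1 \<le> i" "i \<le> 1 + (n - 3)" using i assms by linarith
    then show "F \<in> ?P"
    proof cases
      case 1
      then have "F \<subseteq> {1, Suc 1}" using i by (auto split: if_splits)
      then show ?thesis by (intro CollectI exI[of _ 1]) simp
    next
      case 2
      then have "F \<subseteq> {n - 2, Suc (n - 2)}" using i assms by (auto split: if_splits)
      moreover have "1 \<le> n - 2" "n - 2 \<le> 1 + (n - 3)" using assms by linarith+
      ultimately show ?thesis by blast
    next
      case 3
      then have "F \<subseteq> {i, Suc i}" using i assms by (auto split: if_splits)
      then show ?thesis using 3 by blast
    qed
  next
    fix F assume "F \<in> ?P"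
    then obtain i where i: "1 \<le> i" "i \<le> 1 + (n - 3)" "F \<subseteq> {i, Suc i}" by blast
    then have "0 \<notin> F" "i < n" "F \<subseteq> {i, if Suc i < n then Suc i else 0}" using assms by auto
    then show "F \<in> vertex_deletion ?\<Delta> 0" unfolding vertex_deletion_def by blast
  qed
  show ?thesis
  proof (rule shed[of 0])
    show "facets (vertex_link ?\<Delta> 0) \<inter> facets (vertex_deletion ?\<Delta> 0) = {}"
    proof (rule ccontr)
      assume "facets (vertex_link ?\<Delta> 0) \<inter> facets (vertex_deletion ?\<Delta> 0) \<noteq> {}"
      then obtain F where F: "F \<in> facets ?Q" "F \<in> facets ?P" unfolding link del by blast
      have "F \<in> ?Q" using F(1) facets_subset by blast
      then have "F \<subseteq> {1, 2} \<or> F \<subseteq> {n - 2, n - 1}" by auto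
      moreover have "{1, 2} \<in> ?P" by (intro CollectI exI[of _ 1]) auto
      moreover have "{n - 2, n - 1} \<in> ?P" using assms by (intro CollectI exI[of _ "n - 2"]) auto
      ultimately have "F = {1, 2} \<or> F = {n - 2, n - 1}" using F(2) unfolding facets_def by blast
      moreover obtain a where "F \<subseteq> {a}" using \<open>F \<in> ?Q\<close> by blast
      ultimately have "(1 = a \<and> 2 = a) \<or> (n - 2 = a \<and> n - 1 = a)" by blast
      then show False using assms by linarith
    qed
    show "vertex_decomposable (vertex_link ?\<Delta> 0)" unfolding link by (rule vertex_decomposable_points) auto
    show "vertex_decomposable (vertex_deletion ?\<Delta> 0)" unfolding del by (rule vertex_decomposable_path)
  qed (use assms in \<open>auto intro!: exI[of _ 0]\<close>)
qed

section \<open>Arcs of the cycle\<close>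

definition nxt :: "nat \<Rightarrow> nat \<Rightarrow> nat" where
  "nxt n x = (if Suc x < n then Suc x else 0)"

text \<open>The conditional is \<open>x - i\<close> modulo \<open>n\<close>, written without \<open>mod\<close> to stay within linear arithmetic.\<close>

definition arc_at :: "nat \<Rightarrow> nat \<Rightarrow> nat \<Rightarrow> nat set" where
  "arc_at n i m = {x. x < n \<and> (if i \<le> x then x - i else x + n - i) < m}"

definition shift :: "nat \<Rightarrow> nat \<Rightarrow> nat \<Rightarrow> nat" where
  "shift n i j = (if i + j < n then i + j else i + j - n)"

lemma shift_less: "i < n \<Longrightarrow> j \<le> n \<Longrightarrow> shift n i j < n"
  unfolding shift_def by auto

lemma arc_at_eq_image:
  assumes "i < n" "m \<le> n" shows "arc_at n i m = shift n i ` {..<m}"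
proof (intro equalityI subsetI)
  fix x assume "x \<in> arc_at n i m"
  then show "x \<in> shift n i ` {..<m}" using assms unfolding arc_at_def shift_def
    by (intro image_eqI[of _ _ "if i \<le> x then x - i else x + n - i"]) auto
qed (use assms in \<open>auto simp: arc_at_def shift_def\<close>)

text \<open>Rotation to the base point \<open>x\<close>: membership becomes a comparison of the
  offsets \<open>t\<close> and \<open>j\<close>, without case distinctions on wrapping at
  \<open>x\<close>.\<close>

lemma shift_in_arc_at_shift:
  assumes "x < n" "t < n" "j < n"
  shows "shift n x j \<in> arc_at n (shift n x t) m \<longleftrightarrow> (if t \<le> j then j - t else j + n - t) < m"
  using assms unfolding arc_at_def shift_def by auto

lemma shift_zero [simp]: "i < n \<Longrightarrow> shift n i 0 = i"
  unfolding shift_def by simp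

lemma card_arc_at:
  assumes "i < n" "m \<le> n" shows "card (arc_at n i m) = m"
proof -
  have "inj_on (shift n i) {..<m}" using assms unfolding inj_on_def shift_def by auto
  then show ?thesis unfolding arc_at_eq_image[OF assms] by (simp add: card_image)
qed

lemma arc_at_subset: "arc_at n i m \<subseteq> {0..<n}"
  unfolding arc_at_def by auto

lemma finite_arc_at [simp]: "finite (arc_at n i m)"
  by (rule finite_subset[OF arc_at_subset]) simp

lemma compl_arc_at:
  assumes "i < n" "m \<le> n"
  shows "{0..<n} - arc_at n i m = arc_at n (shift n i m) (n - m)"
  using assms unfolding arc_at_def shift_def by (auto split: if_splits)

text \<open>A proper nonempty arc determines its starting point, the only element whose predecessor
  is missing.\<close>

lemma arc_at_eq_iff:
  assumes "i < n" "j < n" "0 < m" "m < n"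
  shows "arc_at n i m = arc_at n j m \<longleftrightarrow> i = j"
proof
  assume eq: "arc_at n i m = arc_at n j m"
  show "i = j"
  proof (rule ccontr)
    assume ne: "i \<noteq> j"
    let ?p = "if 0 < i then i - 1 else n - 1"
    have "?p \<notin> arc_at n i m" using assms unfolding arc_at_def by auto
    moreover have "i \<in> arc_at n i m" using assms unfolding arc_at_def by auto
    then have "i \<in> arc_at n j m" using eq by simp
    then have "?p \<in> arc_at n j m" using ne assms unfolding arc_at_def by (auto split: if_splits)
    ultimately show False using eq by simp
  qed
qed simp

section \<open>Connected vertex sets of the cycle and the facets of the complex\<close>

lemma verts_cycle_graph [simp]: "verts (cycle_graph n) = {0..<n}"
  unfolding cycle_graph_def by simp

lemma mod_eq_nxt: "i < n \<Longrightarrow> (i + 1) mod n = nxt n i"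
  unfolding nxt_def by (cases "Suc i < n") (auto simp: mod_Suc)

lemma arcs_ends_induced_cycle_graph:
  assumes "W \<subseteq> {0..<n}"
  shows "arcs_ends (cycle_graph n \<restriction> W) = {(x, y). x \<in> W \<and> y \<in> W \<and> (y = nxt n x \<or> x = nxt n y)}"
  using assms mod_eq_nxt[of _ n]
  by (auto simp: arcs_ends_def arc_to_ends_def cycle_graph_def with_proj_def image_def subset_iff)

lemma connected_induced_cycle_graph:
  assumes "W \<subseteq> {0..<n}"
  shows "connected (cycle_graph n \<restriction> W) \<longleftrightarrow> W \<noteq> {} \<and>
    (\<forall>u\<in>W. \<forall>v\<in>W. (u, v) \<in> rtrancl_on W {(x, y). x \<in> W \<and> y \<in> W \<and> (y = nxt n x \<or> x = nxt n y)})"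
proof -
  have "sym {(x, y). x \<in> W \<and> y \<in> W \<and> (y = nxt n x \<or> x = nxt n y)}" by (auto simp: sym_def)
  then have "(arcs_ends (cycle_graph n \<restriction> W))\<^sup>s = {(x, y). x \<in> W \<and> y \<in> W \<and> (y = nxt n x \<or> x = nxt n y)}"
    unfolding arcs_ends_induced_cycle_graph[OF assms] symcl_def by auto
  then show ?thesis unfolding connected_conv by simp
qed

lemma connected_arc_at:
  assumes "i < n" "0 < m" "m \<le> n"
  shows "connected (cycle_graph n \<restriction> arc_at n i m)"
proof -
  let ?W = "arc_at n i m"
  let ?R = "{(x, y). x \<in> ?W \<and> y \<in> ?W \<and> (y = nxt n x \<or> x = nxt n y)}"
  have inW: "shift n i j \<in> ?W" if "j < m" for j using that assms unfolding arc_at_eq_image[OF assms(1,3)] by simp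
  have reach: "(i, shift n i j) \<in> rtrancl_on ?W ?R" if "j < m" for j
    using that
  proof (induction j)
    case 0
    have "shift n i 0 = i" using assms unfolding shift_def by simp
    then show ?case using inW[of 0] assms by simp
  next
    case (Suc j)
    have "shift n i (Suc j) = nxt n (shift n i j)"
      using Suc.prems assms unfolding shift_def nxt_def by auto
    then have "(shift n i j, shift n i (Suc j)) \<in> ?R" using inW[of j] inW[of "Suc j"] Suc.prems by simp
    then show ?case using Suc inW[of "Suc j"] by (auto intro: rtrancl_on_into_rtrancl_on)
  qed
  have "sym ?R" by (auto simp: sym_def)
  then have symR: "sym (rtrancl_on ?W ?R)" by (rule rtrancl_on_sym)
  have "(i, u) \<in> rtrancl_on ?W ?R" if "u \<in> ?W" for u
    using that reach unfolding arc_at_eq_image[OF assms(1,3)] by blast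
  then have "(u, v) \<in> rtrancl_on ?W ?R" if "u \<in> ?W" "v \<in> ?W" for u v
    using rtrancl_on_trans[OF symD[OF symR]] that by blast
  moreover have "?W \<noteq> {}" using inW assms by blast
  ultimately show ?thesis using connected_induced_cycle_graph[OF arc_at_subset] by blast
qed

text \<open>A maximal run of consecutive elements has missing vertices on both sides, so a walk
  inside \<open>W\<close> can never leave it.\<close>

lemma connected_imp_arc_at:
  assumes W: "W \<subseteq> {0..<n}" "card W < n" and conn: "connected (cycle_graph n \<restriction> W)"
  shows "\<exists>i<n. W = arc_at n i (card W)"
proof -
  let ?R = "{(x, y). x \<in> W \<and> y \<in> W \<and> (y = nxt n x \<or> x = nxt n y)}"
  have ne: "W \<noteq> {}" and reach: "\<And>u v. u \<in> W \<Longrightarrow> v \<in> W \<Longrightarrow> (u, v) \<in> rtrancl_on W ?R"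
    using conn connected_induced_cycle_graph[OF W(1)] by auto
  obtain w where w: "w \<in> W" using ne by blast
  have wn: "w < n" using w W by auto
  \<comment> \<open>The offset \<open>n - 1\<close> is the predecessor. If \<open>W\<close>
    contained all predecessors of its elements, stepping backwards from \<open>w\<close> would
    exhaust the cycle.\<close>
  have "\<exists>i<n. i \<in> W \<and> shift n i (n - 1) \<notin> W"
  proof (rule ccontr)
    assume "\<not> ?thesis"
    then have closed: "shift n i (n - 1) \<in> W" if "i \<in> W" for i using that W by auto
    have all: "shift n w (n - j) \<in> W" if "j \<le> n" for j
      using that
    proof (induction j)
      case 0
      then show ?case using w wn unfolding shift_def by simp
    next
      case (Suc j)
      have "shift n w (n - Suc j) = shift n (shift n w (n - j)) (n - 1)"
        using wn Suc.prems unfolding shift_def by auto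
      then show ?case using Suc closed by simp
    qed
    have "x \<in> W" if "x < n" for x
    proof -
      let ?j = "if w \<le> x then n + w - x else w - x"
      have "shift n w (n - ?j) = x" "?j \<le> n" using that wn unfolding shift_def by auto
      then show ?thesis using all by metis
    qed
    then have "W = {0..<n}" using W by auto
    then show False using W by simp
  qed
  then obtain i where i: "i < n" "i \<in> W" "shift n i (n - 1) \<notin> W" by blast
  \<comment> \<open>The length of the run starting at \<open>i\<close>. It is less than
    \<open>n\<close> because the predecessor of \<open>i\<close> is already missing.\<close>
  define l where "l = (LEAST j. shift n i j \<notin> W)"
  have l: "shift n i l \<notin> W" unfolding l_def using i(3) by (rule LeastI)
  have below: "shift n i j \<in> W" if "j < l" for j using that not_less_Least unfolding l_def by blast
  have "l \<le> n - 1" unfolding l_def using i(3) by (rule Least_le)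
  then have ln: "l < n" using i by linarith
  have l0: "0 < l" using l i unfolding shift_def by (cases l) auto
  have sub: "arc_at n i l \<subseteq> W" using below ln unfolding arc_at_eq_image[OF i(1) less_imp_le[OF ln]] by blast
  have "v \<in> arc_at n i l" if "v \<in> W" for v
  proof -
    have "(i, v) \<in> rtrancl_on W ?R" using reach i that by blast
    then show ?thesis
    proof (induction rule: rtrancl_on_induct)
      case base
      then show ?case using i l0 unfolding arc_at_def by auto
    next
      case (step y z)
      have "z < n" using step W by auto
      have zl: "z \<noteq> shift n i l" using step l by blast
      have zp: "z \<noteq> shift n i (n - 1)" using step i by blast
      have "z = nxt n y \<or> y = nxt n z" using step by blast
      then show ?case
        using zl zp step.IH i(1) ln l0 \<open>z < n\<close> unfolding arc_at_def nxt_def shift_def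
        by (auto split: if_splits)
    qed
  qed
  then have "W = arc_at n i l" using sub by blast
  moreover have "card (arc_at n i l) = l" using card_arc_at i ln by simp
  ultimately show ?thesis using i by metis
qed

lemma Con_cycle_graph:
  assumes "0 < r" "r \<le> n" shows "Con r (cycle_graph n) = (\<lambda>i. arc_at n i r) ` {..<n}"
proof (intro equalityI subsetI)
  fix W assume "W \<in> Con r (cycle_graph n)"
  then have W: "W \<subseteq> {0..<n}" "card W = r" "connected (cycle_graph n \<restriction> W)" unfolding Con_def by auto
  show "W \<in> (\<lambda>i. arc_at n i r) ` {..<n}"
  proof (cases "r = n")
    case True
    then have "W = {0..<n}" using W card_subset_eq[of "{0..<n}" W] by simp
    moreover have "arc_at n 0 r = {0..<n}" using True unfolding arc_at_def by auto
    ultimately show ?thesis using assms by (intro image_eqI[of _ _ 0]) auto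
  next
    case False
    then show ?thesis using connected_imp_arc_at[OF W(1) _ W(3)] W(2) assms by auto
  qed
next
  fix W assume "W \<in> (\<lambda>i. arc_at n i r) ` {..<n}"
  then show "W \<in> Con r (cycle_graph n)"
    using assms arc_at_subset card_arc_at connected_arc_at unfolding Con_def by auto
qed

lemma Con_cycle_graph_empty:
  assumes "n < r" shows "Con r (cycle_graph n) = {}"
proof -
  have "\<not> (W \<subseteq> {0..<n} \<and> card W = r)" for W
  proof
    assume "W \<subseteq> {0..<n} \<and> card W = r"
    then have "r \<le> card {0..<n}" using card_mono[of "{0..<n}" W] by simp
    then show False using assms by simp
  qed
  then show ?thesis unfolding Con_def verts_cycle_graph by blast
qed

lemma Sigma_cycle_graph:
  assumes "0 < r" "r \<le> n"
  shows "Sigma_complex r (cycle_graph n) = {F. \<exists>A\<in>(\<lambda>i. arc_at n i (n - r)) ` {..<n}. F \<subseteq> A}"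
proof -
  have "(\<lambda>W. {0..<n} - W) ` Con r (cycle_graph n) = (\<lambda>i. arc_at n i (n - r)) ` {..<n}"
  proof (intro equalityI subsetI)
    fix A assume "A \<in> (\<lambda>W. {0..<n} - W) ` Con r (cycle_graph n)"
    then obtain i where "i < n" "A = {0..<n} - arc_at n i r" unfolding Con_cycle_graph[OF assms] by auto
    then show "A \<in> (\<lambda>i. arc_at n i (n - r)) ` {..<n}"
      using compl_arc_at[of i n r] assms shift_less[of i n r] by auto
  next
    fix A assume "A \<in> (\<lambda>i. arc_at n i (n - r)) ` {..<n}"
    then obtain i where i: "i < n" "A = arc_at n i (n - r)" by auto
    let ?j = "shift n i (n - r)"
    have j: "?j < n" using i shift_less by simp
    have "shift n ?j r = i" using i assms unfolding shift_def by auto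
    then have "A = {0..<n} - arc_at n ?j r" using compl_arc_at[OF j assms(2)] i by simp
    then show "A \<in> (\<lambda>W. {0..<n} - W) ` Con r (cycle_graph n)"
      unfolding Con_cycle_graph[OF assms] using j by blast
  qed
  then have "(\<exists>W\<in>Con r (cycle_graph n). F \<subseteq> {0..<n} - W) \<longleftrightarrow> (\<exists>A\<in>(\<lambda>i. arc_at n i (n - r)) ` {..<n}. F \<subseteq> A)" for F
    by (metis (no_types, lifting) image_iff)
  then show ?thesis unfolding Sigma_complex_def by simp
qed

lemma Sigma_cycle_graph_void: "n < r \<Longrightarrow> Sigma_complex r (cycle_graph n) = {}"
  unfolding Sigma_complex_def by (simp add: Con_cycle_graph_empty)

lemma facets_Sigma_cycle_graph:
  assumes "0 < r" "r \<le> n"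
  shows "facets (Sigma_complex r (cycle_graph n)) = (\<lambda>i. arc_at n i (n - r)) ` {..<n}"
  unfolding Sigma_cycle_graph[OF assms]
proof (rule facets_generated)
  fix A B assume "A \<in> (\<lambda>i. arc_at n i (n - r)) ` {..<n}" "B \<in> (\<lambda>i. arc_at n i (n - r)) ` {..<n}" "A \<subseteq> B"
  then show "A = B" using card_arc_at card_subset_eq[of B A] by auto
qed

lemma Sigma_cycle_graph_facts:
  "finite (Sigma_complex r (cycle_graph n))" "down_closed (Sigma_complex r (cycle_graph n))"
  "F \<in> Sigma_complex r (cycle_graph n) \<Longrightarrow> finite F"
  "Sigma_complex r (cycle_graph n) \<subseteq> Pow {0..<n}"
proof -
  show sub: "Sigma_complex r (cycle_graph n) \<subseteq> Pow {0..<n}" unfolding Sigma_complex_def by auto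
  show "finite (Sigma_complex r (cycle_graph n))" by (rule finite_subset[OF sub]) simp
  show "F \<in> Sigma_complex r (cycle_graph n) \<Longrightarrow> finite F" using sub finite_subset[of F "{0..<n}"] by auto
  show "down_closed (Sigma_complex r (cycle_graph n))" unfolding down_closed_def Sigma_complex_def by blast
qed

lemma vertex_decomposable_Sigma_cycle_graph:
  assumes "3 \<le> n" "2 \<le> r" "n \<le> r + 2"
  shows "vertex_decomposable (Sigma_complex r (cycle_graph n))"
proof -
  consider "n < r" | "n = r" | "n = r + 1" | "n = r + 2" using assms by linarith
  then show ?thesis
  proof cases
    case 1
    then show ?thesis by (simp add: Sigma_cycle_graph_void void)
  next
    case 2
    have "arc_at n i 0 = {}" for i unfolding arc_at_def by auto
    then have "Sigma_complex r (cycle_graph n) = Pow {}"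
      using 2 assms Sigma_cycle_graph[of r n] by (auto intro: exI[of _ 0])
    then show ?thesis using simplex[of "{}"] by simp
  next
    case 3
    have "arc_at n i 1 = {i}" if "i < n" for i using that unfolding arc_at_def by auto
    then have "Sigma_complex r (cycle_graph n) = {F. \<exists>i\<in>{..<n}. F \<subseteq> {i}}"
      using Sigma_cycle_graph[of r n] 3 assms by auto
    then show ?thesis using vertex_decomposable_points[of "{..<n}"] assms by force
  next
    case 4
    have "arc_at n i 2 = {i, if Suc i < n then Suc i else 0}" if "i < n" for i
      using that 4 assms unfolding arc_at_def by auto
    then have "Sigma_complex r (cycle_graph n) = {F. \<exists>i<n. F \<subseteq> {i, if Suc i < n then Suc i else 0}}"
      using Sigma_cycle_graph[of r n] 4 assms by auto
    then show ?thesis using vertex_decomposable_cycle[of n] 4 assms by simp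
  qed
qed

section \<open>Failure of shellability\<close>

lemma arc_at_diff_ge_2:
  assumes "x < n" "z < n" "m + 2 \<le> n" "2 \<le> m" "z \<noteq> x" "z \<noteq> nxt n x" "x \<noteq> nxt n z"
  shows "\<exists>e e'. e \<noteq> e' \<and> {e, e'} \<subseteq> arc_at n x m - arc_at n z m"
proof -
  define t where "t = (if x \<le> z then z - x else z + n - x)"
  have t: "2 \<le> t" "t + 2 \<le> n" "t < n" using assms unfolding t_def nxt_def by (auto split: if_splits)
  have z: "z = shift n x t" using assms unfolding t_def shift_def by auto
  \<comment> \<open>Relative to \<open>x\<close> the second arc begins at offset \<open>t\<close>.
    The last two offsets below both \<open>t\<close> and \<open>m\<close> lie in the first arc only;
    \<open>m + 2 \<le> n\<close> and \<open>t + 2 \<le> n\<close> keep the second arc from coming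
    round to them.\<close>
  define u where "u = min t m"
  have u: "2 \<le> u" "u \<le> t" "u \<le> m" "t + 1 < u + n - m" "u = t \<or> u = m" using t assms unfolding u_def by auto
  have "shift n x (u - 1) \<in> arc_at n x m - arc_at n z m" "shift n x (u - 2) \<in> arc_at n x m - arc_at n z m"
    unfolding z using u t assms(1-4) shift_in_arc_at_shift[of x n t "u - 1" m]
      shift_in_arc_at_shift[of x n t "u - 2" m] shift_in_arc_at_shift[of x n 0 "u - 1" m]
      shift_in_arc_at_shift[of x n 0 "u - 2" m] by auto
  moreover have "shift n x (u - 1) \<noteq> shift n x (u - 2)" using u t assms(1) unfolding shift_def by auto
  ultimately show ?thesis by blast
qed

lemma not_shellable_Sigma_cycle_graph:
  assumes "2 \<le> r" "r + 3 \<le> n"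
  shows "\<not> shellable (Sigma_complex r (cycle_graph n))"
proof
  define m where "m = n - r"
  have m: "3 \<le> m" "m + 2 \<le> n" "m < n" "m \<le> n" using assms unfolding m_def by auto
  define a where "a i = arc_at n i m" for i
  assume "shellable (Sigma_complex r (cycle_graph n))"
  then obtain Fs where Fs: "distinct Fs" "set Fs = a ` {..<n}"
    and shell: "\<And>j G. 0 < j \<Longrightarrow> j < length Fs \<Longrightarrow>
        G \<in> facets ((\<Union>i<j. Pow (Fs ! i)) \<inter> Pow (Fs ! j)) \<Longrightarrow> card G + 1 = card (Fs ! j)"
    using facets_Sigma_cycle_graph[of r n] assms
    unfolding shellable_def shelling_def a_def m_def by auto
  have "\<forall>i<n. \<exists>k<length Fs. Fs ! k = a i"
    using Fs(2) by (metis imageI in_set_conv_nth lessThan_iff)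
  then obtain pos where pos: "\<And>i. i < n \<Longrightarrow> pos i < length Fs \<and> Fs ! pos i = a i" by metis
  have a_inj: "a i = a j \<longleftrightarrow> i = j" if "i < n" "j < n" for i j
    using arc_at_eq_iff[OF that, of m] m unfolding a_def by auto
  have pos_inj: "i = j" if "i < n" "j < n" "pos i = pos j" for i j
    using pos[OF that(1)] pos[OF that(2)] that a_inj by metis
  \<comment> \<open>Shellability puts the intersection into a face \<open>G\<close> of
    \<open>m - 1\<close> vertices that also lies in an earlier arc \<open>a z\<close>. Then at most
    one vertex of \<open>a x\<close> is outside \<open>a z\<close>, which forces the two starting
    points to be adjacent.\<close>
  have key: "\<exists>z<n. pos z < pos x \<and> a x \<inter> a y \<subseteq> a z \<and> (z = nxt n x \<or> x = nxt n z)"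
    if xy: "x < n" "y < n" "pos y < pos x" for x y
  proof -
    let ?X = "(\<Union>i<pos x. Pow (Fs ! i)) \<inter> Pow (Fs ! pos x)"
    have fin: "finite (a i)" for i unfolding a_def by simp
    have "a x \<inter> a y \<in> ?X" using xy pos[OF xy(1)] pos[OF xy(2)] by auto
    moreover have "finite ?X" using pos[OF xy(1)] fin by auto
    ultimately obtain G where G: "G \<in> facets ?X" "a x \<inter> a y \<subseteq> G" using exists_facet[of ?X "a x \<inter> a y"] by auto
    have "card G + 1 = card (Fs ! pos x)" using shell[OF _ _ G(1)] pos[OF xy(1)] xy by auto
    then have cG: "card G + 1 = m" using pos[OF xy(1)] card_arc_at[OF xy(1) m(4)] unfolding a_def by simp
    have "G \<in> ?X" by (rule subsetD[OF facets_subset G(1)])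
    then obtain k where k: "k < pos x" "G \<subseteq> Fs ! k" "G \<subseteq> a x" using pos[OF xy(1)] by auto
    have "k < length Fs" using k pos[OF xy(1)] by linarith
    then have "Fs ! k \<in> a ` {..<n}" using Fs(2) nth_mem by blast
    then obtain z where z: "z < n" "Fs ! k = a z" by auto
    have "pos z = k" using pos[OF z(1)] z Fs(1) \<open>k < length Fs\<close> nth_eq_iff_index_eq by metis
    have "z \<noteq> x" using \<open>pos z = k\<close> k by auto
    moreover have False if nz: "z \<noteq> nxt n x" "x \<noteq> nxt n z"
    proof -
      obtain e e' where e: "e \<noteq> e'" "{e, e'} \<subseteq> a x - a z"
        using arc_at_diff_ge_2[OF xy(1) z(1) m(2) _ \<open>z \<noteq> x\<close> nz] m unfolding a_def by auto
      then have "G \<union> {e, e'} \<subseteq> a x" "G \<inter> {e, e'} = {}" using k z by auto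
      then have "card (G \<union> {e, e'}) \<le> m" "card (G \<union> {e, e'}) = card G + 2"
        using card_mono[OF fin, of "G \<union> {e, e'}" x] card_arc_at[OF xy(1) m(4)] e
          finite_subset[OF k(3) fin] by (auto simp: a_def card_Un_disjoint)
      then show False using cG by simp
    qed
    ultimately have "z = nxt n x \<or> x = nxt n z" by blast
    moreover have "a x \<inter> a y \<subseteq> a z" "pos z < pos x" using z(2) k(1,2) \<open>pos z = k\<close> G(2) by auto
    ultimately show ?thesis using z(1) by blast
  qed
  have ex: "\<exists>q<n. \<forall>i<n. pos i \<le> pos q"
  proof -
    have "0 \<in> {..<n}" using m by simp
    then have "Max (pos ` {..<n}) \<in> pos ` {..<n}" by (intro Max_in) blast+
    then obtain q where "q < n" "pos q = Max (pos ` {..<n})" by auto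
    then show ?thesis by (metis Max_ge finite_imageI finite_lessThan imageI lessThan_iff)
  qed
  then obtain q where q: "q < n" "\<And>i. i < n \<Longrightarrow> pos i \<le> pos q" by blast
  \<comment> \<open>The arc \<open>a q\<close> comes last; \<open>p\<close> and \<open>s\<close> are
    the starting points before and after \<open>q\<close>. Whichever of \<open>a p\<close>,
    \<open>a s\<close> comes later cannot use \<open>a q\<close> as the earlier adjacent
    arc.\<close>
  define p where "p = (if 0 < q then q - 1 else n - 1)"
  define s where "s = nxt n q"
  have pn: "p < n" "nxt n p = q" "s < n" "p \<noteq> s" using q m unfolding p_def s_def nxt_def by auto
  have s2: "s = shift n p 2" using q(1) m unfolding p_def s_def nxt_def shift_def by auto
  show False
  proof (cases "pos s < pos p")
    case True
    then obtain z where z: "z < n" "pos z < pos p" "a p \<inter> a s \<subseteq> a z" "z = nxt n p \<or> p = nxt n z"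
      using key[OF pn(1,3)] by blast
    have "z \<noteq> q" using z q(2)[OF pn(1)] by auto
    then have "p = nxt n z" using z pn by auto
    \<comment> \<open>The last vertex of \<open>a p\<close>. It has offset \<open>m - 3\<close> in
      \<open>a s\<close>, which needs \<open>m \<ge> 3\<close>, but it is just past the end of the
      arc starting before \<open>p\<close>.\<close>
    moreover have "shift n p (m - 1) \<in> a p \<inter> a s"
      using shift_in_arc_at_shift[OF pn(1), of 0 "m - 1" m] shift_in_arc_at_shift[OF pn(1), of 2 "m - 1" m] pn(1) m
      unfolding a_def s2 by simp
    then have "shift n p (m - 1) \<in> a z" using z by blast
    moreover have "shift n (nxt n z) (m - 1) = shift n z m" using z(1) m unfolding nxt_def shift_def by auto
    ultimately show False using shift_in_arc_at_shift[OF z(1), of 0 m m] z(1) m unfolding a_def by simp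
  next
    case False
    then have "pos p < pos s" using pos_inj[OF pn(1,3)] pn(4) by force
    then obtain z where z: "z < n" "pos z < pos s" "a s \<inter> a p \<subseteq> a z" "z = nxt n s \<or> s = nxt n z"
      using key[OF pn(3,1)] by blast
    have "z \<noteq> q" using z q(2)[OF pn(3)] by auto
    moreover have "z = q" if "s = nxt n z" using that z(1) q(1) unfolding s_def nxt_def by (auto split: if_splits)
    ultimately have "z = nxt n s" using z by auto
    \<comment> \<open>The mirror image: the first vertex of \<open>a s\<close> has offset
      \<open>2 < m\<close> in \<open>a p\<close> but is missing from the arc starting after
      \<open>s\<close>.\<close>
    moreover have "s \<in> a s \<inter> a p"
      using shift_in_arc_at_shift[OF pn(1), of 2 2 m] shift_in_arc_at_shift[OF pn(1), of 0 2 m] pn(1) m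
      unfolding a_def s2 by simp
    then have "s \<in> a z" using z by blast
    moreover have "nxt n s = shift n s 1" using pn(3) m unfolding nxt_def shift_def by auto
    ultimately show False using shift_in_arc_at_shift[OF pn(3), of 1 0 m] pn(3) m unfolding a_def by simp
  qed
qed

section \<open>Chordality\<close>

text \<open>Circuits with two vertices fewer than \<open>V\<close> are read as edges of the graph
  \<open>P\<close> of their complements, and candidates for \<open>Z\<close> as complements of
  triples. A triple containing the single edge \<open>{x, y}\<close> gives a simplicial
  \<open>Z\<close>: its closed neighbourhood is \<open>V - {x, y}\<close>, which has only one subset
  of circuit size.\<close>

lemma chordal_delete_pair:
  fixes V :: "'a set"
  assumes V: "finite V" "2 \<le> card V" and P: "\<And>p. p \<in> P \<Longrightarrow> p \<subseteq> V \<and> card p = 2"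
    and xy: "{x, y} \<in> P" "x \<noteq> y" and z: "z \<in> V" "z \<noteq> x" "z \<noteq> y" "{x, z} \<notin> P" "{y, z} \<notin> P"
    and rest: "chordal_clutter (card V - 2) V ((\<lambda>p. V - p) ` (P - {{x, y}}))"
  shows "chordal_clutter (card V - 2) V ((\<lambda>p. V - p) ` P)"
proof (rule chordal_clutter.delete)
  let ?C = "(\<lambda>p. V - p) ` P" and ?Z = "V - {x, y, z}"
  have xyV: "x \<in> V" "y \<in> V" using P[OF xy(1)] by auto
  have pair: "p = {a, b}" if "p \<in> P" "{a, b} \<subseteq> p" "a \<noteq> b" for p a b
  proof -
    have "finite p" using P[OF that(1)] V finite_subset[of p V] by blast
    then show ?thesis using P[OF that(1)] card_subset_eq[of p "{a, b}"] that by simp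
  qed
  have N: "closed_neighborhood ?C ?Z = V - {x, y}"
  proof (intro equalityI subsetI)
    fix t assume "t \<in> closed_neighborhood ?C ?Z"
    then consider "t \<in> ?Z" | p where "t \<notin> ?Z" "p \<in> P" "t \<in> V - p" "V - p \<subseteq> ?Z \<union> {t}"
      unfolding closed_neighborhood_def by blast
    then show "t \<in> V - {x, y}"
    proof cases
      case 2
      have "t \<noteq> x"
      proof
        assume t: "t = x"
        then have "{y, z} \<subseteq> p" using 2 xyV z xy by blast
        then show False using pair[OF 2(2), of y z] z 2 by simp
      qed
      moreover have "t \<noteq> y"
      proof
        assume t: "t = y"
        then have "{x, z} \<subseteq> p" using 2 xyV z xy by blast
        then show False using pair[OF 2(2), of x z] z 2 by simp
      qed
      ultimately show ?thesis using 2 by blast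
    qed blast
  next
    fix t assume t: "t \<in> V - {x, y}"
    show "t \<in> closed_neighborhood ?C ?Z"
    proof (cases "t = z")
      case True
      have "V - {x, y} \<in> ?C" "z \<in> V - {x, y}" "V - {x, y} \<subseteq> ?Z \<union> {z}" using xy z by auto
      then show ?thesis unfolding closed_neighborhood_def True by blast
    qed (use t in \<open>simp add: closed_neighborhood_def\<close>)
  qed
  have "card (V - {x, y}) = card V - 2" using V xyV xy by (simp add: card_Diff_subset)
  then have "F = V - {x, y}" if "F \<subseteq> V - {x, y}" "card F = card V - 2" for F
    using that V card_subset_eq[of "V - {x, y}" F] by simp
  then have "clutter_clique (card V - 2) V ?C (V - {x, y})"
    unfolding clutter_clique_def using xy by blast
  moreover have "card ?Z = card V - 2 - 1" using V xyV xy z by (simp add: card_Diff_subset)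
  ultimately show "simplicial_maximal_subcircuit (card V - 2) V ?C ?Z"
    unfolding simplicial_maximal_subcircuit_def N using V by simp
  have "clutter_deletion ?C ?Z = (\<lambda>p. V - p) ` (P - {{x, y}})"
  proof -
    have "?Z \<subseteq> V - p \<longleftrightarrow> p = {x, y}" if p: "p \<in> P" for p
    proof
      assume "?Z \<subseteq> V - p"
      then have sub: "p \<subseteq> {x, y, z}" using P[OF p] by blast
      obtain a b where ab: "p = {a, b}" "a \<noteq> b" using P[OF p] card_2_iff by metis
      show "p = {x, y}"
      proof (cases "z \<in> p")
        case True
        then obtain c where "p = {c, z}" "c \<noteq> z" using ab by blast
        then have "p = {x, z} \<or> p = {y, z}" using sub by blast
        then show ?thesis using p z by blast
      qed (use ab sub in blast)
    qed blast
    moreover have "V - p \<noteq> V - {x, y}" if "p \<in> P" "p \<noteq> {x, y}" for p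
      using that P[OF that(1)] P[OF xy(1)] by blast
    ultimately show ?thesis unfolding clutter_deletion_def by auto
  qed
  then show "chordal_clutter (card V - 2) V (clutter_deletion ?C ?Z)" using rest by simp
qed

text \<open>An isolated vertex \<open>z\<close> completes every edge to a triple with no other edge,
  so the edges can be deleted in any order.\<close>

lemma chordal_complement_star:
  assumes V: "finite V" "2 \<le> card V" and z: "z \<in> V"
    and P: "finite P" "\<And>p. p \<in> P \<Longrightarrow> p \<subseteq> V - {z} \<and> card p = 2"
  shows "chordal_clutter (card V - 2) V ((\<lambda>p. V - p) ` P)"
  using P
proof (induction P)
  case empty
  then show ?case by (simp add: chordal_clutter.no_circuits)
next
  case (insert p P)
  obtain x y where xy: "p = {x, y}" "x \<noteq> y" using insert.prems[of p] card_2_iff[of p] by auto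
  have "z \<noteq> x" "z \<noteq> y" using insert.prems[of p] xy by auto
  moreover have "{x, z} \<notin> insert p P" "{y, z} \<notin> insert p P" using insert.prems by blast+
  moreover have "insert p P - {{x, y}} = P" using insert.hyps xy by auto
  ultimately show ?case
    using chordal_delete_pair[OF V, of "insert p P" x y z] insert z xy by auto
qed

text \<open>The graph of complements consists of the chords of the cycle. The chords
  \<open>{0, k}\<close> are deleted for increasing \<open>k\<close> with third vertex
  \<open>k - 1\<close>: \<open>{k - 1, k}\<close> is a cycle edge, and \<open>{0, k - 1}\<close> is
  a cycle edge or already deleted. After that \<open>0\<close> is isolated.\<close>

lemma chordal_complement_cycle:
  assumes n: "4 \<le> n"
  shows "chordal_clutter (n - 2) {0..<n}
    ((\<lambda>p. {0..<n} - p) ` {p. p \<subseteq> {0..<n} \<and> card p = 2 \<and> (\<forall>i<n. p \<noteq> {i, nxt n i})})"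
proof -
  let ?V = "{0..<n}"
  \<comment> \<open>The chords left after the removal of all \<open>{0, j}\<close> with
    \<open>j \<le> k\<close>. The induction runs backwards, from \<open>P (n - 2)\<close> without
    chords at \<open>0\<close> to \<open>P 1\<close> with all chords.\<close>
  define P where "P k = {p. p \<subseteq> ?V \<and> card p = 2 \<and> (\<forall>i<n. p \<noteq> {i, nxt n i}) \<and> (\<forall>j. p = {0, j} \<longrightarrow> k < j)}" for k
  have card2: "card {0, k} = 2" if "0 < k" for k :: nat using that by simp
  have "chordal_clutter (n - 2) ?V ((\<lambda>p. ?V - p) ` P (n - 2 - j))" if "j \<le> n - 3" for j
    using that
  proof (induction j)
    case 0
    have "finite (P (n - 2))" unfolding P_def by (rule finite_subset[of _ "Pow ?V"]) auto
    moreover have "p \<subseteq> ?V - {0} \<and> card p = 2" if p: "p \<in> P (n - 2)" for p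
    proof -
      have "0 \<notin> p"
      proof
        assume "0 \<in> p"
        then obtain j where j: "p = {0, j}" "j \<noteq> 0" using p card_2_iff[of p] unfolding P_def by auto
        then have "n - 2 < j" "j < n" using p unfolding P_def by auto
        then have "j = n - 1" by linarith
        then have "p = {n - 1, nxt n (n - 1)}" using j n unfolding nxt_def by auto
        moreover have "n - 1 < n" using n by simp
        ultimately show False using p unfolding P_def by blast
      qed
      then show ?thesis using p unfolding P_def by auto
    qed
    ultimately show ?case using chordal_complement_star[of ?V 0 "P (n - 2)"] n by simp
  next
    case (Suc j)
    define k where "k = n - 2 - j"
    have k: "2 \<le> k" "k \<le> n - 2" "n - 2 - Suc j = k - 1" using Suc.prems n unfolding k_def by auto
    have e: "{0, k} \<in> P (k - 1)" unfolding P_def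
    proof (intro CollectI conjI allI impI)
      show "{0, k} \<subseteq> ?V" "card {0, k} = 2" using k n by auto
      show "{0, k} \<noteq> {i, nxt n i}" if "i < n" for i
        using k n that unfolding nxt_def by (auto simp: doubleton_eq_iff split: if_splits)
      show "k - 1 < j" if "{0, k} = {0, j}" for j using that k by (auto simp: doubleton_eq_iff)
    qed
    have "P (k - 1) - {{0, k}} = P k"
    proof (intro equalityI subsetI)
      fix p assume p: "p \<in> P (k - 1) - {{0, k}}"
      have "k < j" if "p = {0, j}" for j
      proof -
        have "k - 1 < j" "j \<noteq> k" using p that unfolding P_def by auto
        then show ?thesis by linarith
      qed
      then show "p \<in> P k" using p unfolding P_def by auto
    next
      fix p assume p: "p \<in> P k"
      have "k < j" if "p = {0, j}" for j using p that unfolding P_def by blast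
      then have "p \<noteq> {0, k}" "\<forall>j. p = {0, j} \<longrightarrow> k - 1 < j" using less_imp_diff_less by blast+
      then show "p \<in> P (k - 1) - {{0, k}}" using p unfolding P_def by blast
    qed
    then have "chordal_clutter (n - 2) ?V ((\<lambda>p. ?V - p) ` (P (k - 1) - {{0, k}}))"
      using Suc k_def by simp
    moreover have "{0, k - 1} \<notin> P (k - 1)" unfolding P_def by auto
    moreover have "{k, k - 1} \<notin> P (k - 1)"
    proof -
      have "{k, k - 1} = {k - 1, nxt n (k - 1)}" "k - 1 < n" using k n unfolding nxt_def by auto
      then show ?thesis unfolding P_def by blast
    qed
    moreover have "\<And>p. p \<in> P (k - 1) \<Longrightarrow> p \<subseteq> ?V \<and> card p = 2" unfolding P_def by blast
    ultimately show ?case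
      using chordal_delete_pair[of ?V "P (k - 1)" 0 k "k - 1"] e k n by simp
  qed
  moreover have "n - 2 - (n - 3) = 1" using n by linarith
  ultimately have "chordal_clutter (n - 2) ?V ((\<lambda>p. ?V - p) ` P 1)" by (metis order_refl)
  moreover have "P 1 = {p. p \<subseteq> ?V \<and> card p = 2 \<and> (\<forall>i<n. p \<noteq> {i, nxt n i})}"
  proof -
    have "1 < j" if "p = {0, j}" "card p = 2" "\<forall>i<n. p \<noteq> {i, nxt n i}" for p j
    proof -
      have "j \<noteq> 0" using that(1,2) by auto
      moreover have "j \<noteq> 1"
      proof
        assume "j = 1"
        then have "p = {0, nxt n 0}" using that(1) n unfolding nxt_def by auto
        then show False using that(3) n by auto
      qed
      ultimately show ?thesis by linarith
    qed
    then show ?thesis unfolding P_def by blast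
  qed
  ultimately show ?thesis by simp
qed

text \<open>For \<open>n \<le> r + 1\<close> every \<open>r\<close>-subset of the vertices is an arc
  and the complementary clutter is empty. For \<open>n = r + 2\<close> the arcs are the complements
  of the cycle edges, which leaves the chords.\<close>

lemma cochordal_Con_cycle_graph:
  assumes "3 \<le> n" "2 \<le> r" "n \<le> r + 2"
  shows "cochordal_clutter r (verts (cycle_graph n)) (Con r (cycle_graph n))"
proof -
  let ?V = "{0..<n}" and ?C = "clutter_complement r {0..<n} (Con r (cycle_graph n))"
  have "chordal_clutter r ?V ?C"
  proof (cases "n = r + 2")
    case False
    have "?C = {}"
    proof (rule ccontr)
      assume "?C \<noteq> {}"
      then obtain F where F: "F \<subseteq> ?V" "card F = r" "F \<notin> Con r (cycle_graph n)"
        unfolding clutter_complement_def by auto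
      have "r \<le> n" using card_mono[OF _ F(1)] F(2) by simp
      then consider "n = r" | "n = r + 1" using assms False by linarith
      then show False
      proof cases
        case 1
        then have "F = ?V" using F card_subset_eq[of ?V F] by simp
        moreover have "arc_at n 0 r = ?V" using 1 unfolding arc_at_def by auto
        ultimately show False using F(3) Con_cycle_graph[of r n] 1 assms by auto
      next
        case 2
        have "finite F" by (rule finite_subset[OF F(1)]) simp
        then have "card (?V - F) = 1" using F 2 by (simp add: card_Diff_subset)
        then obtain v where v: "?V - F = {v}" using card_1_singletonE by blast
        then have vn: "v < n" by auto
        have "F = ?V - {v}" using v F(1) by blast
        also have "{v} = arc_at n v 1" using vn unfolding arc_at_def by auto
        also have "?V - arc_at n v 1 = arc_at n (shift n v 1) r" using compl_arc_at[OF vn, of 1] 2 by simp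
        finally show False using F(3) Con_cycle_graph[of r n] shift_less[OF vn, of 1] 2 assms by auto
      qed
    qed
    then show ?thesis by (simp add: chordal_clutter.no_circuits)
  next
    case True
    have "?C = (\<lambda>p. ?V - p) ` {p. p \<subseteq> ?V \<and> card p = 2 \<and> (\<forall>i<n. p \<noteq> {i, nxt n i})}" (is "_ = _ ` ?P")
    proof -
      have two: "arc_at n i 2 = {i, nxt n i}" if "i < n" for i
        using that assms unfolding arc_at_def nxt_def by auto
      have Con: "Con r (cycle_graph n) = (\<lambda>i. ?V - {i, nxt n i}) ` {..<n}"
      proof (intro equalityI subsetI)
        fix W assume "W \<in> Con r (cycle_graph n)"
        then obtain i where i: "i < n" "W = arc_at n i r" using Con_cycle_graph[of r n] True assms by auto
        let ?j = "shift n i r"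
        have j: "?j < n" using shift_less i True by simp
        have "shift n ?j 2 = i" using i True unfolding shift_def by auto
        then have "W = ?V - {?j, nxt n ?j}" using compl_arc_at[OF j, of 2] two[OF j] i True by simp
        then show "W \<in> (\<lambda>i. ?V - {i, nxt n i}) ` {..<n}" using j by blast
      next
        fix W assume "W \<in> (\<lambda>i. ?V - {i, nxt n i}) ` {..<n}"
        then obtain i where i: "i < n" "W = ?V - {i, nxt n i}" by auto
        then have "W = arc_at n (shift n i 2) r" using compl_arc_at[OF i(1), of 2] two[OF i(1)] True by simp
        then show "W \<in> Con r (cycle_graph n)"
          using Con_cycle_graph[of r n] True assms shift_less[OF i(1), of 2] by auto
      qed
      show ?thesis
      proof (intro equalityI subsetI)
        fix F assume "F \<in> ?C"
        then have F: "F \<subseteq> ?V" "card F = r" "F \<notin> Con r (cycle_graph n)" unfolding clutter_complement_def by auto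
        have "finite F" by (rule finite_subset[OF F(1)]) simp
        then have "card (?V - F) = 2" using F True by (simp add: card_Diff_subset)
        moreover have "?V - F \<noteq> {i, nxt n i}" if "i < n" for i
        proof
          assume "?V - F = {i, nxt n i}"
          then have "F = ?V - {i, nxt n i}" using F(1) by blast
          then show False using F(3) that unfolding Con by blast
        qed
        moreover have "F = ?V - (?V - F)" using F(1) by blast
        ultimately show "F \<in> (\<lambda>p. ?V - p) ` ?P" by blast
      next
        fix F assume "F \<in> (\<lambda>p. ?V - p) ` ?P"
        then obtain p where p: "p \<subseteq> ?V" "card p = 2" "\<forall>i<n. p \<noteq> {i, nxt n i}" "F = ?V - p" by blast
        have "finite p" by (rule finite_subset[OF p(1)]) simp
        then have "card F = r" using p True by (simp add: card_Diff_subset)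
        moreover have "F \<notin> Con r (cycle_graph n)"
        proof
          assume "F \<in> Con r (cycle_graph n)"
          then obtain i where i: "i < n" "?V - p = ?V - {i, nxt n i}" unfolding Con p(4) by auto
          have "nxt n i < n" using i assms unfolding nxt_def by auto
          then have "p = {i, nxt n i}" using i p(1) by auto
          then show False using p i by blast
        qed
        ultimately show "F \<in> ?C" unfolding clutter_complement_def using p by blast
      qed
    qed
    then show ?thesis using chordal_complement_cycle[of n] True assms by simp
  qed
  then show ?thesis unfolding cochordal_clutter_def by simp
qed

section \<open>Obstructions to chordality\<close>

text \<open>The restriction to \<open>A \<union> B\<close> never changes: a set \<open>Z\<close>
  inside the union has all of \<open>A\<close> or all of \<open>B\<close> in its closed
  neighbourhood, which is then not a clique, and deleting any other \<open>Z\<close> leaves the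
  circuits inside the union alone.\<close>

lemma not_chordal_two_missing:
  assumes d: "2 \<le> d" and AB: "A \<inter> B = {}" "card A = d" "card B = d"
    and C: "{E \<in> C. E \<subseteq> A \<union> B} = {F. F \<subseteq> A \<union> B \<and> card F = d \<and> F \<noteq> A \<and> F \<noteq> B}"
  shows "\<not> chordal_clutter d V C"
proof
  have fin: "finite A" "finite B" using AB d by (auto intro: card_ge_0_finite)
  have mem: "E \<in> C \<longleftrightarrow> E \<noteq> A \<and> E \<noteq> B" if "{E \<in> C. E \<subseteq> A \<union> B} = {F. F \<subseteq> A \<union> B \<and> card F = d \<and> F \<noteq> A \<and> F \<noteq> B}"
    "E \<subseteq> A \<union> B" "card E = d" for C E
    using that by blast
  assume "chordal_clutter d V C"
  then show False using C
  proof (induction rule: chordal_clutter.induct)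
    case no_circuits
    obtain a b where ab: "a \<in> A" "b \<in> B" using AB d by fastforce
    \<comment> \<open>Exchanging one element of \<open>A\<close> for one of \<open>B\<close> gives a
      circuit; it differs from \<open>B\<close> since \<open>d \<ge> 2\<close>.\<close>
    let ?F = "insert b (A - {a})"
    have "b \<notin> A" using ab AB by blast
    then have "card ?F = d" "?F \<subseteq> A \<union> B" using ab AB fin d by (auto simp: card_insert_disjoint)
    moreover have "?F \<noteq> A" using ab AB by blast
    moreover have "?F \<noteq> B"
    proof
      assume "?F = B"
      then have "A \<subseteq> {a}" using AB by blast
      then have "card A \<le> 1" using card_mono[of "{a}" A] by simp
      then show False using AB d by simp
    qed
    ultimately show ?case using mem[OF no_circuits, of ?F] by blast
  next
    case (delete C Z)
    have Z: "finite Z" "card Z = d - 1" "clutter_clique d V C (closed_neighborhood C Z)"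
      using delete.hyps(1) unfolding simplicial_maximal_subcircuit_def by auto
    show ?case
    proof (cases "Z \<subseteq> A \<union> B")
      case True
      have Zne: "Z \<noteq> {}" using Z d by auto
      have nbr: "x \<in> closed_neighborhood C Z"
        if x: "x \<in> A \<union> B" "x \<notin> Z" "insert x Z \<noteq> A" "insert x Z \<noteq> B" for x
      proof -
        have "card (insert x Z) = d" using Z x d by simp
        then have "insert x Z \<in> C" using mem[OF delete.prems, of "insert x Z"] x True by auto
        then show ?thesis unfolding closed_neighborhood_def using x by blast
      qed
      have sub: "Z \<subseteq> closed_neighborhood C Z" unfolding closed_neighborhood_def by blast
      have no: "\<not> A \<subseteq> closed_neighborhood C Z" "\<not> B \<subseteq> closed_neighborhood C Z"
        using Z(3) AB mem[OF delete.prems, of A] mem[OF delete.prems, of B] unfolding clutter_clique_def by blast+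
      show False
      proof (cases "Z \<subseteq> A")
        case True
        \<comment> \<open>Adding an element of \<open>B\<close> to a nonempty subset of
          \<open>A\<close> produces a mixed set, hence a circuit.\<close>
        have "B \<subseteq> closed_neighborhood C Z"
        proof
          fix b assume b: "b \<in> B"
          then have "b \<notin> Z" "insert b Z \<noteq> A" "insert b Z \<noteq> B" using True AB Zne by auto
          then show "b \<in> closed_neighborhood C Z" using nbr b by blast
        qed
        then show False using no by blast
      next
        case notA: False
        have "A \<subseteq> closed_neighborhood C Z"
        proof
          fix a assume a: "a \<in> A"
          show "a \<in> closed_neighborhood C Z"
          proof (cases "a \<in> Z")
            case False
            have "insert a Z \<noteq> A" using notA by blast
            moreover have "insert a Z \<noteq> B" using a AB by blast
            ultimately show ?thesis using nbr[of a] a False by blast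
          qed (use sub in blast)
        qed
        then show False using no by blast
      qed
    next
      case False
      then have "{E \<in> clutter_deletion C Z. E \<subseteq> A \<union> B} = {E \<in> C. E \<subseteq> A \<union> B}"
        unfolding clutter_deletion_def by blast
      then show False using delete.IH delete.prems by simp
    qed
  qed
qed

text \<open>The vertices \<open>r\<close> and \<open>2 * r + 1\<close> are outside the union, and an
  \<open>r\<close>-arc starting strictly inside either block runs over the end of that
  block.\<close>

lemma arc_at_within_two_arcs:
  assumes "2 \<le> r" "2 * r + 2 \<le> n" "i < n" "arc_at n i r \<subseteq> {0..<r} \<union> {r + 1..<2 * r + 1}"
  shows "i = 0 \<or> i = r + 1"
proof (rule ccontr)
  assume ne: "\<not> ?thesis"
  have "i \<in> arc_at n i r" using assms unfolding arc_at_def by auto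
  then consider "0 < i" "i < r" | "r + 1 < i" "i < 2 * r + 1" using ne assms(4) by force
  then show False
  proof cases
    case 1
    then have "r \<in> arc_at n i r" using assms unfolding arc_at_def by auto
    then show False using assms(4) by auto
  next
    case 2
    then have "2 * r + 1 \<in> arc_at n i r" using assms unfolding arc_at_def by auto
    then show False using assms(4) by auto
  qed
qed

lemma not_cochordal_Con_cycle_graph_large:
  assumes r: "2 \<le> r" and n: "2 * r + 2 \<le> n"
  shows "\<not> cochordal_clutter r (verts (cycle_graph n)) (Con r (cycle_graph n))"
proof -
  let ?A = "{0..<r}" and ?B = "{r + 1..<2 * r + 1}"
  have Con: "Con r (cycle_graph n) = (\<lambda>i. arc_at n i r) ` {..<n}" using Con_cycle_graph[of r n] r n by simp
  have arcs: "arc_at n 0 r = ?A" "arc_at n (r + 1) r = ?B" using n unfolding arc_at_def by auto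
  have "F \<in> Con r (cycle_graph n) \<longleftrightarrow> F = ?A \<or> F = ?B" if F: "F \<subseteq> ?A \<union> ?B" for F
  proof
    assume "F \<in> Con r (cycle_graph n)"
    then obtain i where i: "i < n" "F = arc_at n i r" unfolding Con by auto
    then have "i = 0 \<or> i = r + 1" using arc_at_within_two_arcs[OF r n i(1)] F by simp
    then show "F = ?A \<or> F = ?B" using arcs i by metis
  next
    assume "F = ?A \<or> F = ?B"
    then have "F = arc_at n 0 r \<or> F = arc_at n (r + 1) r" using arcs by simp
    moreover have "0 < n" "r + 1 < n" using n by auto
    ultimately show "F \<in> Con r (cycle_graph n)" unfolding Con by blast
  qed
  moreover have "?A \<union> ?B \<subseteq> {0..<n}" using n by auto
  ultimately have "{E \<in> clutter_complement r {0..<n} (Con r (cycle_graph n)). E \<subseteq> ?A \<union> ?B} =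
      {F. F \<subseteq> ?A \<union> ?B \<and> card F = r \<and> F \<noteq> ?A \<and> F \<noteq> ?B}"
    unfolding clutter_complement_def by blast
  then show ?thesis
    unfolding cochordal_clutter_def using not_chordal_two_missing[of r ?A ?B] r by simp
qed

section \<open>The homological obstruction and the dual of the circle\<close>

declare add_bit_eq_xor [simp del] mult_bit_eq_and [simp del]

lemma bit_double [simp]: "(x :: bit) + x = 0"
  by (cases x) (auto simp: add_bit_eq_xor)

text \<open>The vanishing of a double boundary in characteristic two: each unordered pair is counted
  twice.\<close>

lemma sum_symmetric_bit:
  fixes g :: "'a \<Rightarrow> 'a \<Rightarrow> bit"
  assumes "finite S" "\<And>s t. g s t = g t s"
  shows "(\<Sum>s\<in>S. \<Sum>t\<in>S - {s}. g s t) = 0"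
  using assms(1)
proof (induction S)
  case (insert a S)
  have "(\<Sum>t\<in>insert a S - {s}. g s t) = g s a + (\<Sum>t\<in>S - {s}. g s t)" if "s \<in> S" for s
  proof -
    have "insert a S - {s} = insert a (S - {s})" using insert.hyps that by auto
    then show ?thesis using insert.hyps by simp
  qed
  then have "(\<Sum>s\<in>S. \<Sum>t\<in>insert a S - {s}. g s t) = (\<Sum>s\<in>S. g s a) + (\<Sum>s\<in>S. \<Sum>t\<in>S - {s}. g s t)"
    by (simp add: sum.distrib)
  moreover have "(\<Sum>t\<in>insert a S - {a}. g a t) = (\<Sum>s\<in>S. g s a)"
    using insert.hyps assms(2)[of a] by simp
  ultimately show ?case using insert by simp
qed simp

text \<open>The homological obstruction to chordality, over the field with two elements: a cycle \<open>z\<close>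
  of the clique complex in dimension \<open>q - 1 \<ge> d - 1\<close> on which a cocycle \<open>\<phi>\<close> does not vanish
  survives the deletion of a simplicial maximal subcircuit \<open>Z\<close>, because the faces of \<open>z\<close>
  containing \<open>Z\<close> span a cone and can be pushed away from \<open>Z\<close>.\<close>

lemma not_chordal_homology:
  fixes z \<phi> :: "'a set \<Rightarrow> bit"
  assumes V: "finite V" and d: "0 < d" "d \<le> q"
    and cycle: "\<And>G. G \<subseteq> V \<Longrightarrow> card G + 1 = q \<Longrightarrow> (\<Sum>x\<in>V - G. z (insert x G)) = 0"
    and supp: "\<And>F. z F \<noteq> 0 \<Longrightarrow> F \<subseteq> V \<and> card F = q \<and> clutter_clique d V C F"
    and cocycle: "\<And>H. clutter_clique d V C H \<Longrightarrow> card H = q + 1 \<Longrightarrow> (\<Sum>x\<in>H. \<phi> (H - {x})) = 0"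
    and pairing: "(\<Sum>F | F \<subseteq> V \<and> card F = q. z F * \<phi> F) = 1"
  shows "\<not> chordal_clutter d V C"
proof
  assume "chordal_clutter d V C"
  then show False using cycle supp cocycle pairing
  proof (induction arbitrary: z rule: chordal_clutter.induct)
    case no_circuits
    have "\<exists>F. z F \<noteq> 0"
    proof (rule ccontr)
      assume "\<not> ?thesis"
      then show False using no_circuits(4) by simp
    qed
    then obtain F where F: "card F = q" "clutter_clique d V {} F" using no_circuits(2) by blast
    obtain E where "E \<subseteq> F" "card E = d" using obtain_subset_with_card_n[of d F] F d by auto
    then show False using F unfolding clutter_clique_def by blast
  next
    case (delete C Z)
    let ?N = "closed_neighborhood C Z" and ?D = "clutter_deletion C Z"
    have Z: "Z \<subseteq> V" "finite Z" "card Z = d - 1" "clutter_clique d V C ?N"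
      using delete.hyps(1) unfolding simplicial_maximal_subcircuit_def by auto
    have ZN: "Z \<subseteq> ?N" unfolding closed_neighborhood_def by blast
    have NV: "?N \<subseteq> V" using Z(4) unfolding clutter_clique_def by blast
    have sub_clique: "clutter_clique d V C F'" if "clutter_clique d V C F" "F' \<subseteq> F" for F F'
      using that unfolding clutter_clique_def by blast
    have in_N: "F \<subseteq> ?N" if F: "clutter_clique d V C F" "Z \<subseteq> F" for F
    proof
      fix t assume t: "t \<in> F"
      show "t \<in> ?N"
      proof (cases "t \<in> Z")
        case False
        have "card (insert t Z) = d" using False Z d by simp
        then have "insert t Z \<in> C" using F t unfolding clutter_clique_def by blast
        then show ?thesis unfolding closed_neighborhood_def using False by blast
      qed (use ZN in blast)
    qed
    have clique_del: "clutter_clique d V ?D F" if "clutter_clique d V C F" "\<not> Z \<subseteq> F" for F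
      using that unfolding clutter_clique_def clutter_deletion_def by blast
    have coc: "(\<Sum>x\<in>H. \<phi> (H - {x})) = 0" if "clutter_clique d V ?D H" "card H = q + 1" for H
      using that delete.prems(3)[of H] unfolding clutter_clique_def clutter_deletion_def by blast
    show False
    proof (cases "?N = Z")
      case True
      have "F \<subseteq> V \<and> card F = q \<and> clutter_clique d V ?D F" if F: "z F \<noteq> 0" for F
      proof -
        have cl: "F \<subseteq> V" "card F = q" "clutter_clique d V C F" using delete.prems(2)[OF F] by auto
        \<comment> \<open>If nothing extends \<open>Z\<close>, a clique containing \<open>Z\<close>
          equals it, and \<open>d - 1 < q\<close> vertices are too few.\<close>
        have "\<not> Z \<subseteq> F"
        proof
          assume "Z \<subseteq> F"
          then have "F \<subseteq> Z" using in_N[OF cl(3)] True by simp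
          then have "card F \<le> d - 1" using card_mono[OF Z(2)] Z(3) by simp
          then show False using cl d by simp
        qed
        then show ?thesis using clique_del cl by blast
      qed
      then show False using delete.IH[OF delete.prems(1) _ coc delete.prems(4)] by blast
    next
      case False
      then obtain y where y: "y \<in> ?N" "y \<notin> Z" using ZN by blast
      have yV: "y \<in> V" using y NV by blast
      \<comment> \<open>The part of \<open>z\<close> on faces through \<open>Z\<close> avoiding
        \<open>y\<close> is coned with apex \<open>y\<close> to \<open>w\<close>, and
        \<open>z'\<close> is \<open>z\<close> plus the boundary of \<open>w\<close>. The cone
        consists of cliques because cliques through \<open>Z\<close> lie in the clique
        \<open>?N\<close>.\<close>
      define u where "u F = (if Z \<subseteq> F \<and> y \<notin> F then z F else 0)" for F
      define w where "w H = (if y \<in> H then u (H - {y}) else 0)" for H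
      define z' where "z' F = (if F \<subseteq> V \<and> card F = q then z F + (\<Sum>x\<in>V - F. w (insert x F)) else 0)" for F
      have fin: "F \<subseteq> V \<Longrightarrow> finite F" for F using V finite_subset[of F V] by blast
      have w_clique: "clutter_clique d V C H" if "w H \<noteq> 0" for H
      proof -
        have yH: "y \<in> H" "u (H - {y}) \<noteq> 0" using that unfolding w_def by (auto split: if_splits)
        then have zH: "z (H - {y}) \<noteq> 0" "Z \<subseteq> H - {y}" unfolding u_def by (auto split: if_splits)
        then have "H - {y} \<subseteq> ?N" using in_N delete.prems(2) by blast
        then have "H \<subseteq> ?N" using y by blast
        then show ?thesis using sub_clique[OF Z(4)] by blast
      qed
      have bd_notin: "(\<Sum>x\<in>V - F. w (insert x F)) = u F" if F: "F \<subseteq> V" "y \<notin> F" for F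
      proof -
        have "(\<Sum>x\<in>V - F. w (insert x F)) = (\<Sum>x\<in>V - F. if x = y then u F else 0)"
          by (intro sum.cong) (use F in \<open>auto simp: w_def\<close>)
        also have "\<dots> = u F" using V F yV by simp
        finally show ?thesis .
      qed
      have bd_in: "(\<Sum>x\<in>V - F. w (insert x F)) = (\<Sum>x\<in>V - F. u (insert x (F - {y})))" if F: "F \<subseteq> V" "y \<in> F" for F
      proof (rule sum.cong)
        fix x assume "x \<in> V - F"
        then have "insert x F - {y} = insert x (F - {y})" using F by auto
        then show "w (insert x F) = u (insert x (F - {y}))" using F unfolding w_def by simp
      qed simp
      \<comment> \<open>For \<open>y\<close> outside \<open>F\<close> the boundary of the cone
        contributes exactly \<open>z F\<close>. For \<open>y\<close> in \<open>F\<close> the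
        cancellation is the cycle condition of \<open>z\<close> at \<open>F - {y}\<close>.\<close>
      have z'_Z: "z' F = 0" if ZF: "Z \<subseteq> F" for F
      proof (cases "F \<subseteq> V \<and> card F = q")
        case False
        then show ?thesis unfolding z'_def by argo
      next
        case True
        then have F: "F \<subseteq> V" "card F = q" by auto
        show ?thesis
        proof (cases "y \<in> F")
          case False
          then show ?thesis using bd_notin[OF F(1) False] ZF True unfolding z'_def u_def by simp
        next
          case y_in: True
          let ?G = "F - {y}"
          have G: "?G \<subseteq> V" "card ?G + 1 = q" using F y_in fin[OF F(1)] d by (auto simp: card_Diff_singleton)
          have VG: "V - ?G = insert y (V - F)" using y_in yV by blast
          have "insert y ?G = F" using y_in by blast
          then have "z F + (\<Sum>x\<in>V - F. z (insert x ?G)) = 0"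
            using delete.prems(1)[OF G] V y_in unfolding VG by simp
          moreover have "(\<Sum>x\<in>V - F. z (insert x ?G)) = (\<Sum>x\<in>V - F. u (insert x ?G))"
            by (intro sum.cong) (use ZF y y_in in \<open>auto simp: u_def\<close>)
          ultimately show ?thesis using bd_in[OF F(1) y_in] F unfolding z'_def by simp
        qed
      qed
      have supp': "F \<subseteq> V \<and> card F = q \<and> clutter_clique d V ?D F" if nz: "z' F \<noteq> 0" for F
      proof -
        have F: "F \<subseteq> V" "card F = q" using nz unfolding z'_def by (auto split: if_splits)
        have nZ: "\<not> Z \<subseteq> F" using z'_Z nz by blast
        have "clutter_clique d V C F"
        proof (cases "z F = 0")
          case True
          then have "(\<Sum>x\<in>V - F. w (insert x F)) \<noteq> 0" using nz F unfolding z'_def by simp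
          then obtain x where "w (insert x F) \<noteq> 0" by (meson sum.neutral)
          then show ?thesis using sub_clique[OF w_clique, of "insert x F" F] by blast
        qed (use delete.prems(2) in blast)
        then show ?thesis using F clique_del nZ by blast
      qed
      have cycle': "(\<Sum>x\<in>V - G. z' (insert x G)) = 0" if G: "G \<subseteq> V" "card G + 1 = q" for G
      proof -
        have "z' (insert x G) = z (insert x G) + (\<Sum>x'\<in>V - G - {x}. w (insert x' (insert x G)))" if x: "x \<in> V - G" for x
        proof -
          have "insert x G \<subseteq> V" "card (insert x G) = q" using x G fin[OF G(1)] by auto
          moreover have "V - insert x G = V - G - {x}" by blast
          ultimately show ?thesis unfolding z'_def by simp
        qed
        then have "(\<Sum>x\<in>V - G. z' (insert x G)) =
           (\<Sum>x\<in>V - G. z (insert x G)) + (\<Sum>x\<in>V - G. \<Sum>x'\<in>V - G - {x}. w (insert x' (insert x G)))"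
          by (simp add: sum.distrib)
        moreover have "(\<Sum>x\<in>V - G. \<Sum>x'\<in>V - G - {x}. w (insert x' (insert x G))) = 0"
          by (rule sum_symmetric_bit) (use V in \<open>auto simp: insert_commute\<close>)
        ultimately show ?thesis using delete.prems(1)[OF G] by simp
      qed
      have "(\<Sum>F | F \<subseteq> V \<and> card F = q. z' F * \<phi> F) =
          (\<Sum>F | F \<subseteq> V \<and> card F = q. z F * \<phi> F) +
          (\<Sum>F | F \<subseteq> V \<and> card F = q. \<Sum>x\<in>V - F. w (insert x F) * \<phi> F)"
        unfolding z'_def by (simp add: sum.distrib distrib_right sum_distrib_right)
      \<comment> \<open>Pairing a boundary with \<open>\<phi>\<close> is pairing \<open>w\<close>
        with the coboundary of \<open>\<phi>\<close>, which vanishes on cliques. The sum is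
        regrouped along \<open>(F, x)\<close> and \<open>(insert x F, x)\<close>.\<close>
      also have "(\<Sum>F | F \<subseteq> V \<and> card F = q. \<Sum>x\<in>V - F. w (insert x F) * \<phi> F) = 0"
      proof -
        let ?Fs = "{F. F \<subseteq> V \<and> card F = q}" and ?Hs = "{H. H \<subseteq> V \<and> card H = q + 1}"
        have finF: "finite ?Fs" by (rule finite_subset[of _ "Pow V"]) (use V in auto)
        have finH: "finite ?Hs" by (rule finite_subset[of _ "Pow V"]) (use V in auto)
        have "(\<Sum>F\<in>?Fs. \<Sum>x\<in>V - F. w (insert x F) * \<phi> F) =
            (\<Sum>(F, x)\<in>(SIGMA F:?Fs. V - F). w (insert x F) * \<phi> F)"
          by (rule sum.Sigma) (use finF V in auto)
        also have "\<dots> = (\<Sum>(H, x)\<in>(SIGMA H:?Hs. H). w H * \<phi> (H - {x}))"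
        proof (rule sum.reindex_bij_witness[where i = "\<lambda>(H, x). (H - {x}, x)" and j = "\<lambda>(F, x). (insert x F, x)"])
          fix a assume a: "a \<in> (SIGMA F:?Fs. V - F)"
          then obtain F x where Fx: "a = (F, x)" "F \<subseteq> V" "card F = q" "x \<in> V" "x \<notin> F" by auto
          then show "(case case a of (F, x) \<Rightarrow> (insert x F, x) of (H, x) \<Rightarrow> (H - {x}, x)) = a" by simp
          show "(case a of (F, x) \<Rightarrow> (insert x F, x)) \<in> (SIGMA H:?Hs. H)" using Fx fin[OF Fx(2)] by simp
          show "(case case a of (F, x) \<Rightarrow> (insert x F, x) of (H, x) \<Rightarrow> w H * \<phi> (H - {x})) =
            (case a of (F, x) \<Rightarrow> w (insert x F) * \<phi> F)" using Fx by simp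
        next
          fix b assume b: "b \<in> (SIGMA H:?Hs. H)"
          then obtain H x where Hx: "b = (H, x)" "H \<subseteq> V" "card H = q + 1" "x \<in> H" by auto
          then show "(case case b of (H, x) \<Rightarrow> (H - {x}, x) of (F, x) \<Rightarrow> (insert x F, x)) = b" by auto
          show "(case b of (H, x) \<Rightarrow> (H - {x}, x)) \<in> (SIGMA F:?Fs. V - F)" using Hx fin[OF Hx(2)] by auto
        qed
        also have "\<dots> = (\<Sum>H\<in>?Hs. \<Sum>x\<in>H. w H * \<phi> (H - {x}))"
          by (rule sum.Sigma[symmetric]) (use finH fin in auto)
        also have "\<dots> = (\<Sum>H\<in>?Hs. w H * (\<Sum>x\<in>H. \<phi> (H - {x})))" by (simp add: sum_distrib_left)
        also have "\<dots> = 0"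
        proof (rule sum.neutral, rule ballI)
          fix H assume "H \<in> ?Hs"
          then show "w H * (\<Sum>x\<in>H. \<phi> (H - {x})) = 0"
            using delete.prems(3)[of H] w_clique[of H] by (cases "w H = 0") auto
        qed
        finally show ?thesis .
      qed
      finally have "(\<Sum>F | F \<subseteq> V \<and> card F = q. z' F * \<phi> F) = 1" using delete.prems(4) by simp
      then show False using delete.IH[OF cycle' supp' coc] by blast
    qed
  qed
qed

lemma card_3_sorted:
  fixes T :: "nat set"
  assumes "card T = 3"
  obtains a b c where "T = {a, b, c}" "a < b" "b < c"
proof -
  define a where "a = Min T"
  define c where "c = Max T"
  have fin: "finite T" "T \<noteq> {}" using assms card_ge_0_finite[of T] by auto
  have a: "a \<in> T" "\<And>x. x \<in> T \<Longrightarrow> a \<le> x" using fin unfolding a_def by auto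
  have c: "c \<in> T" "\<And>x. x \<in> T \<Longrightarrow> x \<le> c" using fin unfolding c_def by auto
  have "card (T - {a}) = 2" using assms fin a by simp
  then have "a \<noteq> c"
  proof -
    have "T \<subseteq> {a}" if "a = c"
    proof
      fix x assume "x \<in> T"
      then show "x \<in> {a}" using a(2)[of x] c(2)[of x] that by simp
    qed
    then show ?thesis using card_mono[of "{a}" T] assms by auto
  qed
  then have "card (T - {a, c}) = 1" using assms fin a c by (simp add: card_Diff_subset)
  then obtain b where b: "T - {a, c} = {b}" using card_1_singletonE by blast
  then have "b \<in> T" "b \<noteq> a" "b \<noteq> c" by auto
  then have "a < b" "b < c" using a(2)[of b] c(2)[of b] by auto
  moreover have "T = {a, b, c}" using b a c by auto
  ultimately show thesis using that by blast
qed

text \<open>The facet has at most \<open>r + 1\<close> vertices, so a pair in it is at least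
  \<open>r + 1\<close> apart precisely when the facet passes through the cut between them. The
  alternatives are: no pair is separated, \<open>a\<close> is separated from the other two, or
  \<open>c\<close> is. Either no pair or two pairs are far apart, one of them then being
  \<open>{a, c}\<close>.\<close>

lemma triple_in_arc_at:
  assumes "n \<le> 2 * r + 1" "j < n" "r \<le> n" "a < b" "b < c" "{a, b, c} \<subseteq> arc_at n j (n - r)"
  shows "c < a + r + 1 \<or> (a + r + 1 \<le> b \<and> c < b + r + 1) \<or> (b < a + r + 1 \<and> b + r + 1 \<le> c)"
proof -
  have abcj: "(if j \<le> a then a - j else a + n - j) < n - r"
      "(if j \<le> b then b - j else b + n - j) < n - r"
      "(if j \<le> c then c - j else c + n - j) < n - r" and "c < n"
    using assms unfolding arc_at_def by auto
  consider "j \<le> a" | "c < j" | "a < j" "j \<le> b" | "b < j" "j \<le> c" using assms by linarith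
  then show ?thesis
  proof cases
    case 1
    then have "c < a + r + 1" using abcj assms by auto
    then show ?thesis by simp
  next
    case 2
    then have "c < a + r + 1" using abcj assms by auto
    then show ?thesis by simp
  next
    case 3
    then have "c < b + r + 1" "a + r + 1 \<le> b" using abcj assms by auto
    then show ?thesis by simp
  next
    case 4
    then have "b < a + r + 1" "b + r + 1 \<le> c" using abcj assms \<open>c < n\<close> by auto
    then show ?thesis by simp
  qed
qed

text \<open>The Alexander dual of the circle: on pairs, \<open>\<psi>\<close> detects the edges of the complex
  crossing the cut between \<open>n - 1\<close> and \<open>0\<close>; \<open>z\<close> is the coboundary of \<open>\<psi>\<close> in the full simplex,
  and \<open>\<phi>\<close> is the cone with apex \<open>0\<close> over the edge cycle, both read on complements.\<close>

lemma not_cochordal_Con_cycle_graph_small: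
  assumes r: "2 \<le> r" and n: "r + 3 \<le> n" "n \<le> 2 * r + 1"
  shows "\<not> cochordal_clutter r (verts (cycle_graph n)) (Con r (cycle_graph n))"
proof -
  let ?V = "{0..<n}"
  let ?C = "clutter_complement r ?V (Con r (cycle_graph n))"
  define \<psi> :: "nat set \<Rightarrow> bit" where "\<psi> P = (if Min P + r + 1 \<le> Max P then 1 else 0)" for P
  define z where "z F = (if F \<subseteq> ?V \<and> card F = n - 3 then \<Sum>x\<in>?V - F. \<psi> (?V - insert x F) else 0)" for F
  define \<phi> :: "nat set \<Rightarrow> bit" where "\<phi> F = (if \<exists>i. 1 \<le> i \<and> i + 1 < n \<and> F = ?V - {0, i, i + 1} then 1 else 0)" for F
  have \<psi>: "\<psi> {a, b} = (if a + r + 1 \<le> b then 1 else 0)" if "a < b" for a b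
    using that unfolding \<psi>_def by (simp add: min_def max_def)
  have z: "z (?V - {a, b, c}) = \<psi> {b, c} + \<psi> {a, c} + \<psi> {a, b}"
    if abc: "a < b" "b < c" "c < n" for a b c
  proof -
    have T: "?V - (?V - {a, b, c}) = {a, b, c}" using abc by auto
    have "card (?V - {a, b, c}) = n - 3" using abc by (simp add: card_Diff_subset)
    then have "z (?V - {a, b, c}) = (\<Sum>x\<in>{a, b, c}. \<psi> (?V - insert x (?V - {a, b, c})))"
      unfolding z_def T by simp
    also have "\<dots> = (\<Sum>x\<in>{a, b, c}. \<psi> ({a, b, c} - {x}))"
    proof (rule sum.cong)
      fix x assume "x \<in> {a, b, c}"
      then have "?V - insert x (?V - {a, b, c}) = {a, b, c} - {x}" using abc by auto
      then show "\<psi> (?V - insert x (?V - {a, b, c})) = \<psi> ({a, b, c} - {x})" by simp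
    qed simp
    also have "\<dots> = \<psi> ({a, b, c} - {a}) + (\<psi> ({a, b, c} - {b}) + \<psi> ({a, b, c} - {c}))"
      using abc by simp
    also have "{a, b, c} - {a} = {b, c}" using abc by auto
    also have "{a, b, c} - {b} = {a, c}" using abc by auto
    also have "{a, b, c} - {c} = {a, b}" using abc by auto
    finally show ?thesis by (simp add: add.assoc)
  qed
  have Con: "Con r (cycle_graph n) = (\<lambda>i. arc_at n i r) ` {..<n}" using Con_cycle_graph[of r n] r n by simp
  have clique: "clutter_clique r ?V ?C F \<longleftrightarrow> F \<subseteq> ?V \<and> (\<forall>i<n. \<not> arc_at n i r \<subseteq> F)" for F
  proof
    assume F: "clutter_clique r ?V ?C F"
    have "\<not> arc_at n i r \<subseteq> F" if "i < n" for i
    proof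
      assume "arc_at n i r \<subseteq> F"
      moreover have "card (arc_at n i r) = r" using card_arc_at that n by simp
      ultimately have "arc_at n i r \<in> ?C" using F unfolding clutter_clique_def by blast
      then show False using that unfolding clutter_complement_def Con by blast
    qed
    then show "F \<subseteq> ?V \<and> (\<forall>i<n. \<not> arc_at n i r \<subseteq> F)" using F unfolding clutter_clique_def by blast
  next
    assume F: "F \<subseteq> ?V \<and> (\<forall>i<n. \<not> arc_at n i r \<subseteq> F)"
    then show "clutter_clique r ?V ?C F" unfolding clutter_clique_def clutter_complement_def Con by blast
  qed
  have "\<not> chordal_clutter r ?V ?C"
  proof (rule not_chordal_homology[where z = z and \<phi> = \<phi> and q = "n - 3"])
    \<comment> \<open>Complements of triples have at least \<open>r\<close> vertices exactly because
      \<open>r + 3 \<le> n\<close>.\<close>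
    show "finite ?V" "0 < r" "r \<le> n - 3" using r n by auto
  next
    fix G assume G: "G \<subseteq> ?V" "card G + 1 = n - 3"
    have finG: "finite G" by (rule finite_subset[OF G(1)]) simp
    have "z (insert x G) = (\<Sum>x'\<in>?V - G - {x}. \<psi> (?V - insert x' (insert x G)))" if x: "x \<in> ?V - G" for x
    proof -
      have "insert x G \<subseteq> ?V" "card (insert x G) = n - 3" using x G finG by auto
      moreover have "?V - insert x G = ?V - G - {x}" by blast
      ultimately show ?thesis unfolding z_def by simp
    qed
    then have "(\<Sum>x\<in>?V - G. z (insert x G)) = (\<Sum>x\<in>?V - G. \<Sum>x'\<in>?V - G - {x}. \<psi> (?V - insert x' (insert x G)))"
      by simp
    also have "\<dots> = 0" by (rule sum_symmetric_bit) (auto simp: insert_commute)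
    finally show "(\<Sum>x\<in>?V - G. z (insert x G)) = 0" .
  next
    fix F assume nz: "z F \<noteq> 0"
    then have F: "F \<subseteq> ?V" "card F = n - 3" unfolding z_def by (auto split: if_splits)
    have "finite F" by (rule finite_subset[OF F(1)]) simp
    then have "card (?V - F) = 3" using F n by (simp add: card_Diff_subset)
    then obtain a b c where T: "?V - F = {a, b, c}" and abc: "a < b" "b < c" by (rule card_3_sorted)
    have c: "c < n" using T by auto
    have FT: "F = ?V - {a, b, c}" using F(1) T by blast
    have ne: "\<psi> {b, c} + \<psi> {a, c} + \<psi> {a, b} \<noteq> 0" using nz z[OF abc c] unfolding FT by simp
    \<comment> \<open>An arc inside \<open>F\<close> would place the complementary triple in a
      facet, where the number of far pairs is even.\<close>
    have "\<not> arc_at n i r \<subseteq> F" if i: "i < n" for i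
    proof
      assume sub: "arc_at n i r \<subseteq> F"
      let ?j = "shift n i r"
      have j: "?j < n" using shift_less[OF i] n by simp
      have "{a, b, c} \<subseteq> ?V - arc_at n i r" using sub T by blast
      then have "{a, b, c} \<subseteq> arc_at n ?j (n - r)" using compl_arc_at[OF i] n by simp
      then have "\<psi> {b, c} + \<psi> {a, c} + \<psi> {a, b} = 0"
        using triple_in_arc_at[OF n(2) j _ abc] abc n(1) by (auto simp: \<psi>)
      then show False using ne by simp
    qed
    then show "F \<subseteq> ?V \<and> card F = n - 3 \<and> clutter_clique r ?V ?C F" using F clique by blast
  next
    fix H assume H: "clutter_clique r ?V ?C H" "card H = n - 3 + 1"
    have HV: "H \<subseteq> ?V" and no_arc: "\<And>i. i < n \<Longrightarrow> \<not> arc_at n i r \<subseteq> H" using H clique by auto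
    have finH: "finite H" by (rule finite_subset[OF HV]) simp
    have "card (?V - H) = 2" using H HV finH n by (simp add: card_Diff_subset)
    then obtain a' b' where ab': "?V - H = {a', b'}" "a' \<noteq> b'" using card_2_iff by metis
    have "\<exists>a b. ?V - H = {a, b} \<and> a < b"
    proof (cases "a' < b'")
      case False
      then have "?V - H = {b', a'} \<and> b' < a'" using ab' by auto
      then show ?thesis by blast
    qed (use ab' in blast)
    then obtain a b where ab: "?V - H = {a, b}" "a < b" by blast
    have bn: "b < n" using ab by auto
    \<comment> \<open>A clique contains no arc, so its complementary pair lies in no facet, whereas
      two adjacent vertices always do.\<close>
    have nonadj: "b \<noteq> a + 1" "\<not> (a = 0 \<and> b = n - 1)"
    proof -
      have contra: False if i: "i < n" "{a, b} \<subseteq> arc_at n i 2" for i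
      proof -
        let ?j = "shift n i (n - r)"
        have j: "?j < n" using shift_less[OF i(1)] by simp
        have "arc_at n i 2 \<subseteq> arc_at n i (n - r)" using n unfolding arc_at_def by auto
        moreover have "arc_at n ?j r = ?V - arc_at n i (n - r)" using compl_arc_at[OF i(1), of "n - r"] n by simp
        ultimately have "arc_at n ?j r \<subseteq> ?V - {a, b}" using i(2) by blast
        then have "arc_at n ?j r \<subseteq> H" using ab(1) HV by blast
        then show False using no_arc j by blast
      qed
      have "{a, b} \<subseteq> arc_at n a 2" if "b = a + 1" using that bn unfolding arc_at_def by auto
      then show "b \<noteq> a + 1" using contra[of a] ab(2) bn by auto
      have "{a, b} \<subseteq> arc_at n (n - 1) 2" if "a = 0 \<and> b = n - 1" using that bn n unfolding arc_at_def by auto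
      then show "\<not> (a = 0 \<and> b = n - 1)" using contra[of "n - 1"] n by auto
    qed
    have mem: "\<phi> (H - {x}) = (if \<exists>i. 1 \<le> i \<and> i + 1 < n \<and> {x, a, b} = {0, i, i + 1} then 1 else 0)" if x: "x \<in> H" for x
    proof -
      have "?V - (H - {x}) = {x, a, b}" using ab(1) x HV by blast
      moreover have "H - {x} \<subseteq> ?V" using HV by blast
      ultimately have eq: "H - {x} = ?V - {0, i, i + 1} \<longleftrightarrow> {x, a, b} = {0, i, i + 1}" if "i + 1 < n" for i
      proof -
        have "{0, i, i + 1} \<subseteq> ?V" using that by auto
        then show ?thesis using \<open>?V - (H - {x}) = {x, a, b}\<close> \<open>H - {x} \<subseteq> ?V\<close> by (metis Diff_Diff_Int Int_absorb1 inf.absorb_iff2)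
      qed
      have "(\<exists>i. 1 \<le> i \<and> i + 1 < n \<and> H - {x} = ?V - {0, i, i + 1}) \<longleftrightarrow> (\<exists>i. 1 \<le> i \<and> i + 1 < n \<and> {x, a, b} = {0, i, i + 1})"
        by (rule iff_exI) (use eq in metis)
      then show ?thesis unfolding \<phi>_def by simp
    qed
    \<comment> \<open>The sum counts the cone triangles \<open>{0, i, i + 1}\<close> through the
      nonadjacent pair \<open>{a, b}\<close>: none if \<open>a \<noteq> 0\<close>, and the two with
      third vertex \<open>b - 1\<close> or \<open>b + 1\<close> if \<open>a = 0\<close>.\<close>
    show "(\<Sum>x\<in>H. \<phi> (H - {x})) = 0"
    proof (cases "a = 0")
      case False
      have "\<not> (1 \<le> i \<and> i + 1 < n \<and> {x, a, b} = {0, i, i + 1})" if "x \<in> H" for x i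
      proof
        assume *: "1 \<le> i \<and> i + 1 < n \<and> {x, a, b} = {0, i, i + 1}"
        then have "a \<in> {0, i, i + 1}" "b \<in> {0, i, i + 1}" by blast+
        then have "a \<in> {i, i + 1}" "b \<in> {i, i + 1}" using False ab(2) by auto
        then show False using ab(2) nonadj(1) by auto
      qed
      then show ?thesis using mem by (intro sum.neutral) auto
    next
      case True
      have b: "2 \<le> b" "b + 1 < n" using True ab(2) nonadj bn by auto
      have in_H: "b - 1 \<in> H" "b + 1 \<in> H"
      proof -
        have "t \<in> H" if "t < n" "t \<notin> {a, b}" for t using that unfolding ab(1)[symmetric] by simp
        then show "b - 1 \<in> H" "b + 1 \<in> H" using b True by auto
      qed
      have iff: "(\<exists>i. 1 \<le> i \<and> i + 1 < n \<and> {x, a, b} = {0, i, i + 1}) \<longleftrightarrow> x = b - 1 \<or> x = b + 1" if x: "x \<in> H" for x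
      proof
        assume "\<exists>i. 1 \<le> i \<and> i + 1 < n \<and> {x, a, b} = {0, i, i + 1}"
        then obtain i where i: "1 \<le> i" "{x, 0, b} = {0, i, i + 1}" using True by auto
        have "x \<notin> {a, b}" using x unfolding ab(1)[symmetric] by simp
        then have "x \<noteq> b" "x \<noteq> 0" using True by auto
        moreover have "x \<in> {0, i, i + 1}" "b \<in> {0, i, i + 1}" using i by blast+
        ultimately have "x \<in> {i, i + 1}" "b \<in> {i, i + 1}" using b by auto
        then show "x = b - 1 \<or> x = b + 1" using \<open>x \<noteq> b\<close> by auto
      next
        assume "x = b - 1 \<or> x = b + 1"
        then show "\<exists>i. 1 \<le> i \<and> i + 1 < n \<and> {x, a, b} = {0, i, i + 1}"
        proof
          assume "x = b - 1"
          then show ?thesis using b True by (intro exI[of _ "b - 1"]) auto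
        next
          assume "x = b + 1"
          then show ?thesis using b True by (intro exI[of _ b]) auto
        qed
      qed
      have "(\<Sum>x\<in>H. \<phi> (H - {x})) = (\<Sum>x\<in>H. if x \<in> {b - 1, b + 1} then 1 else 0)"
        by (intro sum.cong) (use mem iff in auto)
      also have "\<dots> = (\<Sum>x\<in>{b - 1, b + 1}. 1)"
        using in_H finH by (intro sum.mono_neutral_cong_right) auto
      also have "\<dots> = 0" using b by simp
      finally show ?thesis .
    qed
  next
    let ?Fs = "{F. F \<subseteq> ?V \<and> card F = n - 3}" and ?g = "\<lambda>i. ?V - {0, i, i + 1}"
    let ?I = "{1..<n - 1}"
    have inj: "inj_on ?g ?I"
    proof (rule inj_onI)
      fix i j assume ij: "i \<in> ?I" "j \<in> ?I" "?g i = ?g j"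
      have dbl: "?V - ?g k = {0, k, k + 1}" if "k \<in> ?I" for k using that by auto
      have "{0, i, i + 1} = ?V - ?g j" unfolding ij(3)[symmetric] by (rule dbl[OF ij(1), symmetric])
      also have "\<dots> = {0, j, j + 1}" by (rule dbl[OF ij(2)])
      finally have "{0, i, i + 1} = {0, j, j + 1}" .
      then have "i \<in> {0, j, j + 1}" "j \<in> {0, i, i + 1}" by blast+
      then have "i \<in> {j, j + 1}" "j \<in> {i, i + 1}" using ij by auto
      then show "i = j" by auto
    qed
    have gF: "?g ` ?I \<subseteq> ?Fs"
    proof
      fix F assume "F \<in> ?g ` ?I"
      then obtain i where i: "i \<in> ?I" "F = ?g i" by blast
      have "{0, i, i + 1} \<subseteq> ?V" "card {0, i, i + 1} = 3" using i by auto
      then have "card F = n - 3" using i(2) by (simp add: card_Diff_subset)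
      then show "F \<in> ?Fs" using i by blast
    qed
    have \<phi>: "\<phi> F = (if F \<in> ?g ` ?I then 1 else 0)" for F
    proof -
      have "(\<exists>i. 1 \<le> i \<and> i + 1 < n \<and> F = ?g i) \<longleftrightarrow> F \<in> ?g ` ?I"
      proof -
        have mem_I: "i \<in> ?I \<longleftrightarrow> 1 \<le> i \<and> i + 1 < n" for i by auto
        show ?thesis unfolding image_iff Bex_def mem_I conj_assoc ..
      qed
      then show ?thesis unfolding \<phi>_def by simp
    qed
    have "(\<Sum>F\<in>?Fs. z F * \<phi> F) = (\<Sum>F\<in>?g ` ?I. z F)"
    proof (rule sum.mono_neutral_cong_right)
      show "finite ?Fs" by (rule finite_subset[of _ "Pow ?V"]) auto
    qed (use gF in \<open>simp_all add: \<phi> del: image_iff\<close>)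
    also have "\<dots> = (\<Sum>i\<in>?I. z (?g i))" using inj by (simp add: sum.reindex)
    \<comment> \<open>Adjacent \<open>i\<close> and \<open>i + 1\<close> are not far apart, so the
      sum telescopes to the end terms, and only \<open>{0, n - 1}\<close> is far apart.\<close>
    also have "\<dots> = (\<Sum>i\<in>?I. \<psi> {0, i + 1} + \<psi> {0, i})"
    proof (rule sum.cong)
      fix i assume i: "i \<in> ?I"
      have "\<psi> {i, i + 1} = 0" using r by (simp add: \<psi>)
      moreover have "0 < i" "i + 1 < n" using i by auto
      ultimately show "z (?g i) = \<psi> {0, i + 1} + \<psi> {0, i}" using z[of 0 i "i + 1"] by simp
    qed simp
    also have "\<dots> = \<psi> {0, n - 1} + \<psi> {0, 1}"
    proof -
      have "(\<Sum>i\<in>{1..<Suc k}. \<psi> {0, i + 1} + \<psi> {0, i}) = \<psi> {0, Suc k} + \<psi> {0, 1}" for k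
      proof (induction k)
        case (Suc k)
        have "(\<Sum>i\<in>{1..<Suc (Suc k)}. \<psi> {0, i + 1} + \<psi> {0, i}) =
          (\<psi> {0, Suc k} + \<psi> {0, 1}) + (\<psi> {0, Suc (Suc k)} + \<psi> {0, Suc k})" using Suc by simp
        also have "\<dots> = (\<psi> {0, Suc k} + \<psi> {0, Suc k}) + (\<psi> {0, Suc (Suc k)} + \<psi> {0, 1})"
          by (simp only: add_ac)
        finally show ?case by simp
      qed simp
      from this[of "n - 2"] show ?thesis using n by (simp add: Suc_diff_Suc numeral_2_eq_2)
    qed
    also have "\<dots> = 1" using n r by (simp add: \<psi>)
    finally show "(\<Sum>F\<in>?Fs. z F * \<phi> F) = 1" .
  qed
  then show ?thesis unfolding cochordal_clutter_def by simp
qed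

section \<open>Cohen--Macaulayness\<close>

lemma lookup_var_mult:
  "lkp (var v * p :: ('v \<Rightarrow>\<^sub>0 nat) \<Rightarrow>\<^sub>0 'k::field) m = (if v \<in> kys m then lkp p (m - sngl v 1) else 0)"
proof -
  have "lkp (var v * p) m = (\<Sum>l. (\<Sum>q. lkp p q when m = l + q) when sngl v 1 = l)"
    unfolding lookup_mult var_def lookup_single when_mult by simp
  also have "\<dots> = (\<Sum>q. lkp p q when m = sngl v 1 + q)" by simp
  also have "\<dots> = (if v \<in> kys m then lkp p (m - sngl v 1) else 0)"
  proof (cases "v \<in> kys m")
    case True
    then have "sngl v 1 + (m - sngl v 1) = m"
      by (intro poly_mapping_eqI) (auto simp: lookup_add lookup_minus lookup_single when_def in_keys_iff)
    then have "m = sngl v 1 + q \<longleftrightarrow> m - sngl v 1 = q" for q by (metis add_diff_cancel_left')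
    then show ?thesis using True by simp
  next
    case False
    then have "m \<noteq> sngl v 1 + q" for q by (auto simp: keys_plus_nat)
    then show ?thesis using False by simp
  qed
  finally show ?thesis .
qed

lemma ideal_set_radical:
  assumes I: "ideal_set I" shows "ideal_set {f. \<exists>k. f ^ k \<in> I}"
  unfolding ideal_set_def mem_Collect_eq
proof (intro conjI ballI allI)
  show "\<exists>k. 0 ^ k \<in> I" using ideal_set_zero[OF I] by (intro exI[of _ 1]) simp
next
  fix a b assume "a \<in> {f. \<exists>k. f ^ k \<in> I}" "b \<in> {f. \<exists>k. f ^ k \<in> I}"
  then obtain k l where k: "a ^ k \<in> I" and l: "b ^ l \<in> I" by blast
  have "(a + b) ^ (k + l) = (\<Sum>i\<le>k + l. of_nat ((k + l) choose i) * a ^ i * b ^ (k + l - i))"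
    by (rule binomial_ring)
  also have "\<dots> \<in> I"
  proof (rule ideal_set_sum[OF I])
    fix i
    show "of_nat ((k + l) choose i) * a ^ i * b ^ (k + l - i) \<in> I"
    proof (cases "k \<le> i")
      case True
      then have "a ^ i = a ^ (i - k) * a ^ k" by (simp flip: power_add)
      then have "a ^ i \<in> I" using ideal_set_mult_left[OF I k] by simp
      then show ?thesis by (intro ideal_set_mult_right[OF I] ideal_set_mult_left[OF I])
    next
      case False
      then have "b ^ (k + l - i) = b ^ (k - i) * b ^ l" by (simp flip: power_add)
      then have "b ^ (k + l - i) \<in> I" using ideal_set_mult_left[OF I l] by simp
      then show ?thesis by (intro ideal_set_mult_left[OF I])
    qed
  qed
  finally show "\<exists>k. (a + b) ^ k \<in> I" by blast
next
  fix a c assume "a \<in> {f. \<exists>k. f ^ k \<in> I}"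
  then obtain k where "a ^ k \<in> I" by blast
  then have "(c * a) ^ k \<in> I" using ideal_set_mult_left[OF I] by (simp add: power_mult_distrib)
  then show "\<exists>k. (c * a) ^ k \<in> I" by blast
qed

lemma one_notin_sr_irrelevant:
  assumes "finite V" "down_closed \<Delta>" "{} \<in> \<Delta>"
  shows "1 \<notin> (sr_irrelevant V \<Delta> :: ('k::field) mpoly set)"
proof -
  have "sr_irrelevant V \<Delta> \<subseteq> (sr_ideal (Pow {}) :: 'k mpoly set)"
  proof (rule sr_irrelevant(4)[OF assms(1,2)])
    show "ideal_set (sr_ideal (Pow {}) :: 'k mpoly set)"
      by (rule ideal_set_sr_ideal[OF down_closed_Pow])
    show "sr_ideal \<Delta> \<subseteq> (sr_ideal (Pow {}) :: 'k mpoly set)"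
      using assms(3) by (intro sr_ideal_antimono) simp
    show "var ` V \<subseteq> (sr_ideal (Pow {}) :: 'k mpoly set)"
      by (intro image_subsetI) (simp only: restr_eq_zero_iff[symmetric] restr_var empty_iff if_False)
  qed
  moreover have "1 \<notin> (sr_ideal (Pow {}) :: 'k mpoly set)" by (simp add: sr_ideal_def)
  ultimately show ?thesis by blast
qed

lemma cohen_macaulay_void:
  fixes K :: "'k::field itself"
  assumes "finite (V :: nat set)" shows "cohen_macaulay K V {}"
proof -
  have dc: "down_closed ({} :: nat set set)" unfolding down_closed_def by simp
  interpret surj_ring_hom "stanley_reisner_ring K V {}" "sr_proj K V {}" "sr_ideal {}"
    by (rule surj_ring_hom_sr_proj[OF assms dc]) simp
  have one: "1 \<in> (sr_ideal {} :: 'k mpoly set)" unfolding sr_ideal_def by simp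
  have "\<not> regular_list (sr_ideal {}) fs" for fs :: "'k mpoly list"
    using one subset_adjoin[of "sr_ideal {}" fs] unfolding regular_list_iff_nth by blast
  then have "depth (stanley_reisner_ring K V {}) (irrelevant_ideal K V {}) = Sup {}"
    unfolding irrelevant_ideal_eq[OF assms dc empty_subsetI] depth_eq[OF sr_irrelevant(1,2)[OF assms dc]] by simp
  moreover have "\<not> (\<exists>P :: nat \<Rightarrow> 'k mpoly set.
      (\<forall>i\<le>k. prime_set (P i)) \<and> (\<forall>i<k. P i \<subset> P (Suc i)) \<and> sr_ideal {} \<subseteq> P 0)" for k
    using one unfolding prime_set_def by (metis le0 subsetD)
  then have "krull_dim (stanley_reisner_ring K V {}) = Sup {}"
    unfolding krull_dim_eq by (intro arg_cong[of _ _ Sup]) blast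
  ultimately show ?thesis unfolding cohen_macaulay_def by simp
qed

section \<open>Regular sequences for small complexes\<close>

lemma var_dvd_if_restr_zero:
  fixes p :: "('k::field) mpoly"
  assumes "restr (- {v}) p = 0" shows "\<exists>q. p = var v * q"
proof -
  have "sngl m (lkp p m) = var v * sngl (m - sngl v 1) (lkp p m)" if "m \<in> kys p" for m
  proof (rule monom_split_var)
    have "\<not> kys m \<subseteq> - {v}" using assms that unfolding restr_eq_zero_iff sr_ideal_def by auto
    then show "v \<in> kys m" by blast
  qed
  then have "(\<Sum>m\<in>kys p. sngl m (lkp p m)) = (\<Sum>m\<in>kys p. var v * sngl (m - sngl v 1) (lkp p m))" by simp
  then show ?thesis unfolding sum_single_keys by (metis sum_distrib_left)
qed

text \<open>The sum and the product of two variables are coprime. Setting one variable to zero kills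
  the right-hand side and turns the sum into the other variable, so that variable divides
  \<open>a\<close>; repeating this for the other one gives \<open>c\<close>.\<close>

lemma edge_divisibility:
  fixes a b :: "('k::field) mpoly"
  assumes "v \<noteq> w" and eq: "(var v + var w) * a = var v * var w * b"
  shows "\<exists>c. a = var v * var w * c \<and> b = (var v + var w) * c"
proof -
  have nz: "var u \<noteq> (0 :: 'k mpoly)" for u by (rule var_neq_zero)
  have "restr (- {v}) ((var v + var w) * a) = restr (- {v}) (var v * var w * b)" using eq by simp
  then have "restr (- {v}) a = 0" using assms(1) nz by (simp add: restr_mult restr_add restr_var)
  then obtain q where q: "a = var v * q" using var_dvd_if_restr_zero by blast
  have "var v * ((var v + var w) * q) = var v * (var w * b)" using eq unfolding q by (simp add: algebra_simps)
  then have eq2: "(var v + var w) * q = var w * b" using nz by simp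
  then have "restr (- {w}) ((var v + var w) * q) = restr (- {w}) (var w * b)" by simp
  then have "restr (- {w}) q = 0" using assms(1) nz by (simp add: restr_mult restr_add restr_var)
  then obtain c where c: "q = var w * c" using var_dvd_if_restr_zero by blast
  have "var w * ((var v + var w) * c) = var w * b" using eq2 unfolding c by (simp add: algebra_simps)
  then have "b = (var v + var w) * c" using nz by simp
  then show ?thesis using q c by (intro exI[of _ c]) (simp add: mult_ac)
qed

text \<open>Polynomials on the edges that agree at the vertices come from one polynomial, as in the
  exact sequence of a graph.\<close>

lemma glue_cycle:
  fixes c :: "nat \<Rightarrow> ('k::field) mpoly"
  assumes n: "3 \<le> n" and supp: "\<And>i. i < n \<Longrightarrow> restr {i, nxt n i} (c i) = c i"
    and agree: "\<And>i. i < n \<Longrightarrow> restr {nxt n i} (c i) = restr {nxt n i} (c (nxt n i))"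
  shows "\<exists>C. \<forall>k<n. restr {k, nxt n k} C = c k"
proof -
  define \<kappa> where "\<kappa> = restr {} (c 0)"
  have const: "restr {} (c k) = \<kappa>" if "k < n" for k
    using that
  proof (induction k)
    case (Suc k)
    have "nxt n k = Suc k" using Suc.prems unfolding nxt_def by simp
    then have "restr {} (restr {Suc k} (c k)) = restr {} (restr {Suc k} (c (Suc k)))"
      using agree[of k] Suc.prems by simp
    then show ?case using Suc by (simp add: restr_restr)
  qed (simp add: \<kappa>_def)
  \<comment> \<open>The terms of \<open>c i\<close> that involve the variable \<open>i\<close>. Over
    all \<open>i\<close> every edge or vertex monomial is counted once, and the common constant term
    \<open>\<kappa>\<close> is added separately.\<close>
  let ?t = "\<lambda>i. c i - restr {nxt n i} (c i)"
  have "restr {k, nxt n k} ((\<Sum>i<n. ?t i) + \<kappa>) = c k" if k: "k < n" for k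
  proof -
    have k': "nxt n k < n" "nxt n k \<noteq> k" "nxt n (nxt n k) \<notin> {k, nxt n k}"
      using k n unfolding nxt_def by (auto split: if_splits)
    have restr_t: "restr {k, nxt n k} (?t i) = restr ({k, nxt n k} \<inter> {i, nxt n i}) (c i) - restr ({k, nxt n k} \<inter> {nxt n i}) (c i)"
      if "i < n" for i
    proof -
      have "restr {k, nxt n k} (c i) = restr ({k, nxt n k} \<inter> {i, nxt n i}) (c i)"
        using supp[OF that] restr_restr[of "{k, nxt n k}" "{i, nxt n i}" "c i"] by simp
      then show ?thesis by (simp add: restr_diff restr_restr)
    qed
    have other: "restr {k, nxt n k} (?t i) = 0" if "i < n" "i \<notin> {k, nxt n k}" for i
    proof -
      have "{k, nxt n k} \<inter> {i, nxt n i} = {k, nxt n k} \<inter> {nxt n i}" using that by blast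
      then show ?thesis using restr_t[OF that(1)] by simp
    qed
    have tk: "restr {k, nxt n k} (?t k) = c k - restr {nxt n k} (c k)"
      using restr_t[OF k] supp[OF k] by simp
    have tk': "restr {k, nxt n k} (?t (nxt n k)) = restr {nxt n k} (c (nxt n k)) - \<kappa>"
    proof -
      have "{k, nxt n k} \<inter> {nxt n k, nxt n (nxt n k)} = {nxt n k}" "{k, nxt n k} \<inter> {nxt n (nxt n k)} = {}"
        using k' by auto
      then show ?thesis using restr_t[OF k'(1)] const[OF k'(1)] by simp
    qed
    have "restr {k, nxt n k} (\<Sum>i<n. ?t i) = (\<Sum>i<n. restr {k, nxt n k} (?t i))" by (rule restr_sum)
    also have "\<dots> = (\<Sum>i\<in>{k, nxt n k}. restr {k, nxt n k} (?t i))"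
      using k k' other by (intro sum.mono_neutral_right) auto
    also have "\<dots> = (c k - restr {nxt n k} (c k)) + (restr {nxt n k} (c (nxt n k)) - \<kappa>)"
      using k' tk tk' by simp
    also have "\<dots> = c k - \<kappa>" using agree[OF k] by simp
    finally show ?thesis by (simp add: restr_add \<kappa>_def restr_restr)
  qed
  then show ?thesis by blast
qed

lemma Sigma_cycle_graph_iff:
  assumes "0 < r" "r \<le> n"
  shows "A \<in> Sigma_complex r (cycle_graph n) \<longleftrightarrow> A \<subseteq> {0..<n} \<and> (\<exists>i<n. A \<inter> arc_at n i r = {})"
  unfolding Sigma_complex_def Con_cycle_graph[OF assms] verts_cycle_graph by auto

lemma cohen_macaulay_cycle_iff:
  fixes K :: "'k::field itself"
  assumes "0 < r" "r \<le> n" "0 < n"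
  shows "cohen_macaulay K {0..<n} (Sigma_complex r (cycle_graph n)) \<longleftrightarrow>
    (\<exists>fs :: 'k mpoly list. length fs = n - r \<and>
        regular_list (sr_ideal (Sigma_complex r (cycle_graph n))) fs \<and>
        set fs \<subseteq> sr_irrelevant {0..<n} (Sigma_complex r (cycle_graph n)))"
proof (rule cohen_macaulay_iff)
  let ?\<Delta> = "Sigma_complex r (cycle_graph n)"
  show "card A \<le> n - r" if A: "A \<in> ?\<Delta>" for A
  proof -
    obtain i where "i < n" "A \<subseteq> arc_at n i (n - r)" using A unfolding Sigma_cycle_graph[OF assms(1,2)] by auto
    then show ?thesis using card_mono[of "arc_at n i (n - r)" A] card_arc_at[of i n "n - r"] by simp
  qed
  show "arc_at n 0 (n - r) \<in> ?\<Delta>" unfolding Sigma_cycle_graph[OF assms(1,2)] using assms by blast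
  show "card (arc_at n 0 (n - r)) = n - r" using card_arc_at assms by simp
qed (use Sigma_cycle_graph_facts in auto)

lemma cohen_macaulay_Sigma_cycle_graph:
  fixes K :: "'k::field itself"
  assumes "3 \<le> n" "2 \<le> r" "n \<le> r + 2"
  shows "cohen_macaulay K {0..<n} (Sigma_complex r (cycle_graph n))"
proof (cases "n < r")
  case True
  then show ?thesis unfolding Sigma_cycle_graph_void[OF True] by (intro cohen_macaulay_void) simp
next
  case False
  then have r: "0 < r" "r \<le> n" "0 < n" using assms by auto
  let ?\<Delta> = "Sigma_complex r (cycle_graph n)"
  let ?J = "sr_ideal ?\<Delta> :: 'k mpoly set"
  let ?m = "sr_irrelevant {0..<n} ?\<Delta> :: 'k mpoly set"
  note irr = sr_irrelevant[OF finite_atLeastLessThan[of 0 n] Sigma_cycle_graph_facts(2)[of r n], where 'k='k]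
  note I = ideal_set_sr_ideal[OF Sigma_cycle_graph_facts(2)[of r n], where 'k='k]
  have empty: "{} \<in> ?\<Delta>" unfolding Sigma_cycle_graph[OF r(1,2)] using r by blast
  have one: "1 \<notin> ?m" by (rule one_notin_sr_irrelevant) (use Sigma_cycle_graph_facts(2) empty in auto)
  have J_iff: "p \<in> ?J \<longleftrightarrow> (\<forall>i<n. restr (arc_at n i (n - r)) p = 0)" for p
    using sr_ideal_iff_restr[of ?\<Delta> "(\<lambda>i. arc_at n i (n - r)) ` {..<n}" p] Sigma_cycle_graph[OF r(1,2)] by auto
  define e1 :: "'k mpoly" where "e1 = (\<Sum>v<n. var v)"
  define e2 :: "'k mpoly" where "e2 = (\<Sum>i<n. var i * var (nxt n i))"
  have e1m: "e1 \<in> ?m" unfolding e1_def using irr(3) by (intro ideal_set_sum[OF irr(1)]) auto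
  have e2m: "e2 \<in> ?m" unfolding e2_def using irr(3)
    by (intro ideal_set_sum[OF irr(1)] ideal_set_mult_right[OF irr(1)]) auto
  consider "n = r" | "n = r + 1" | "n = r + 2" using False assms by linarith
  then show ?thesis
  proof cases
    case 1
    have "1 \<notin> ?J" using one irr(2) by blast
    then show ?thesis unfolding cohen_macaulay_cycle_iff[OF r] using 1 by (intro exI[of _ "[]"]) simp
  next
    case 2
    have arc: "arc_at n i (n - r) = {i}" if "i < n" for i using that 2 unfolding arc_at_def by auto
    have "restr {i} e1 = var i" if "i < n" for i
    proof -
      have "restr {i} e1 = (\<Sum>v<n. if v = i then var i else 0)"
        unfolding e1_def restr_sum by (intro sum.cong) (auto simp: restr_var)
      then show ?thesis using that by simp
    qed
    then have "a \<in> ?J" if "e1 * a \<in> ?J" for a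
      using that arc by (auto simp: J_iff restr_mult var_neq_zero)
    moreover have "1 \<notin> add_gen ?J e1" using add_gen_minimal[OF irr(1,2) e1m] one by blast
    ultimately have "regular_list ?J [e1]" by simp
    then show ?thesis unfolding cohen_macaulay_cycle_iff[OF r] using 2 e1m by (intro exI[of _ "[e1]"]) simp
  next
    case 3
    have n4: "4 \<le> n" using 3 assms by simp
    have arc: "arc_at n i (n - r) = {i, nxt n i}" if "i < n" for i
      using that 3 assms unfolding arc_at_def nxt_def by auto
    have J_iff': "p \<in> ?J \<longleftrightarrow> (\<forall>i<n. restr {i, nxt n i} p = 0)" for p using J_iff arc by auto
    have nx: "nxt n i < n" "nxt n i \<noteq> i" if "i < n" for i using that n4 unfolding nxt_def by auto
    have re1: "restr {i, nxt n i} e1 = var i + var (nxt n i)" if "i < n" for i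
    proof -
      have "restr {i, nxt n i} e1 = (\<Sum>v<n. if v \<in> {i, nxt n i} then var v else 0)"
        unfolding e1_def restr_sum by (intro sum.cong) (auto simp: restr_var)
      also have "\<dots> = (\<Sum>v\<in>{i, nxt n i}. var v)"
        using that nx[OF that] by (intro sum.mono_neutral_cong_right) auto
      finally show ?thesis using nx[OF that] by simp
    qed
    have re2: "restr {i, nxt n i} e2 = var i * var (nxt n i)" if i: "i < n" for i
    proof -
      have "restr {i, nxt n i} (var j * var (nxt n j) :: 'k mpoly) = (if j = i then var i * var (nxt n i) else 0)" if "j < n" for j
      proof (cases "j = i")
        case False
        have "j \<notin> {i, nxt n i} \<or> nxt n j \<notin> {i, nxt n i}"
          using False that i n4 unfolding nxt_def by (auto split: if_splits)
        then show ?thesis using False by (auto simp: restr_mult restr_var)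
      qed (simp add: restr_mult restr_var)
      then have "restr {i, nxt n i} e2 = (\<Sum>j<n. if j = i then var i * var (nxt n i) else 0)"
        unfolding e2_def restr_sum by (intro sum.cong) auto
      then show ?thesis using i by simp
    qed
    \<comment> \<open>On each facet \<open>e2\<close> restricts to a nonzero monomial, hence to a
      nonzerodivisor.\<close>
    have "a \<in> ?J" if "e2 * a \<in> ?J" for a
      using that by (auto simp: J_iff' restr_mult re2 var_neq_zero)
    \<comment> \<open>On each edge coprimality yields a local quotient of \<open>a\<close> by
      \<open>e2\<close>. These quotients glue to some \<open>C\<close>, and
      \<open>a - e2 * C\<close> vanishes on every edge.\<close>
    moreover have "a \<in> add_gen ?J e2" if mem: "e1 * a \<in> add_gen ?J e2" for a
    proof -
      obtain j b where jb: "j \<in> ?J" "e1 * a = j + e2 * b" using mem unfolding add_gen_def by blast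
      have eq: "(var i + var (nxt n i)) * restr {i, nxt n i} a = var i * var (nxt n i) * restr {i, nxt n i} b"
        if "i < n" for i
      proof -
        have "restr {i, nxt n i} (e1 * a) = restr {i, nxt n i} (j + e2 * b)" using jb by simp
        then show ?thesis using jb(1) that by (simp add: J_iff' restr_add restr_mult re1 re2)
      qed
      have "\<exists>c. restr {i, nxt n i} a = var i * var (nxt n i) * c \<and>
          restr {i, nxt n i} b = (var i + var (nxt n i)) * c \<and> restr {i, nxt n i} c = c" if i: "i < n" for i
      proof -
        obtain c where c: "restr {i, nxt n i} a = var i * var (nxt n i) * c"
            "restr {i, nxt n i} b = (var i + var (nxt n i)) * c"
          using edge_divisibility[OF _ eq[OF i]] nx[OF i] by auto
        have "restr {i, nxt n i} (restr {i, nxt n i} a) = restr {i, nxt n i} (var i * var (nxt n i) * c)"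
          "restr {i, nxt n i} (restr {i, nxt n i} b) = restr {i, nxt n i} ((var i + var (nxt n i)) * c)"
          using c by simp_all
        then show ?thesis
          by (intro exI[of _ "restr {i, nxt n i} c"]) (simp add: restr_restr restr_mult restr_add restr_var)
      qed
      then obtain c where c: "\<And>i. i < n \<Longrightarrow> restr {i, nxt n i} a = var i * var (nxt n i) * c i"
          "\<And>i. i < n \<Longrightarrow> restr {i, nxt n i} b = (var i + var (nxt n i)) * c i"
          "\<And>i. i < n \<Longrightarrow> restr {i, nxt n i} (c i) = c i" by metis
      \<comment> \<open>At the common vertex \<open>nxt n i\<close>, both local quotients times its
        variable give the restriction of \<open>b\<close>.\<close>
      have agree: "restr {nxt n i} (c i) = restr {nxt n i} (c (nxt n i))" if i: "i < n" for i
      proof -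
        let ?k = "nxt n i"
        have "restr {?k} (restr {i, ?k} b) = restr {?k} (restr {?k, nxt n ?k} b)"
          by (simp add: restr_restr)
        then have "restr {?k} ((var i + var ?k) * c i) = restr {?k} ((var ?k + var (nxt n ?k)) * c ?k)"
          using c(2)[OF i] c(2)[OF nx(1)[OF i]] by simp
        then have "var ?k * restr {?k} (c i) = var ?k * restr {?k} (c ?k)"
          using nx(2)[OF i] nx(2)[OF nx(1)[OF i]] by (simp add: restr_mult restr_add restr_var)
        then show ?thesis using var_neq_zero[of ?k, where 'k='k] by simp
      qed
      obtain C where C: "\<forall>k<n. restr {k, nxt n k} C = c k"
        using glue_cycle[of n c] c(3) agree n4 by auto
      have "a - e2 * C \<in> ?J"
        using C c(1) by (auto simp: J_iff' restr_diff restr_mult re2)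
      moreover have "a = (a - e2 * C) + e2 * C" by simp
      ultimately show ?thesis unfolding add_gen_def by blast
    qed
    moreover have "1 \<notin> add_gen (add_gen ?J e2) e1"
      using add_gen_minimal[OF irr(1) add_gen_minimal[OF irr(1,2) e2m] e1m] one by blast
    ultimately have "regular_list ?J [e2, e1]" by simp
    then show ?thesis unfolding cohen_macaulay_cycle_iff[OF r] using 3 e1m e2m
      by (intro exI[of _ "[e2, e1]"]) simp
  qed
qed

section \<open>Nonzero Koszul classes for large complexes\<close>

text \<open>Powers of the variables generate the irrelevant ideal up to radical, which is what the
  vanishing theorem asks of the sequence \<open>y\<close>.\<close>

lemma koszul_stanley_reisner:
  fixes fs :: "('k::field) mpoly list"
    and y :: "nat \<Rightarrow> 'k mpoly"
  assumes V: "finite V" and \<Delta>: "down_closed \<Delta>"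
    and fs: "regular_list (sr_ideal \<Delta>) fs" "set fs \<subseteq> sr_irrelevant V \<Delta>" "i < length fs"
    and y: "\<And>v. v \<in> V \<Longrightarrow> \<exists>k. y v = var v ^ k" and w: "kcocycle V y (sr_ideal \<Delta>) i w"
  shows "kboundary V y (sr_ideal \<Delta>) i w"
proof (rule koszul_vanishing[OF V ideal_set_sr_ideal[OF \<Delta>] fs(1,3)])
  fix f :: "'k mpoly" and I
  assume f: "f \<in> set fs" and I: "ideal_set I" "sr_ideal \<Delta> \<subseteq> I" "y ` V \<subseteq> I"
  have "sr_irrelevant V \<Delta> \<subseteq> {f. \<exists>k. f ^ k \<in> I}"
  proof (rule sr_irrelevant(4)[OF V \<Delta> ideal_set_radical[OF I(1)]])
    show "sr_ideal \<Delta> \<subseteq> {f. \<exists>k. f ^ k \<in> I}"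
    proof
      fix g :: "'k mpoly" assume "g \<in> sr_ideal \<Delta>"
      then have "g ^ 1 \<in> I" using I(2) by auto
      then show "g \<in> {f. \<exists>k. f ^ k \<in> I}" by blast
    qed
    show "var ` V \<subseteq> {f. \<exists>k. f ^ k \<in> I}"
    proof
      fix g :: "'k mpoly" assume "g \<in> var ` V"
      then obtain v where v: "g = var v" "v \<in> V" by blast
      then obtain k where "y v = g ^ k" using y by blast
      moreover have "y v \<in> I" using I(3) v(2) by blast
      ultimately show "g \<in> {f. \<exists>k. f ^ k \<in> I}" by auto
    qed
  qed
  then show "\<exists>k. f ^ k \<in> I" using f fs(2) by blast
qed (rule w)

lemma lookup_sr_ideal: "p \<in> sr_ideal \<Delta> \<Longrightarrow> kys m \<in> \<Delta> \<Longrightarrow> lkp p m = 0"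
  unfolding sr_ideal_def by (auto simp: in_keys_iff)

lemma prod_var_in_sr_ideal:
  "finite S \<Longrightarrow> S \<notin> \<Delta> \<Longrightarrow> (\<Prod>v\<in>S. var v) \<in> sr_ideal \<Delta>"
  unfolding prod_var sr_ideal_def by (simp add: keys_squarefree_monom)

lemma squarefree_monom_minus:
  assumes "finite S" "v \<in> S"
  shows "squarefree_monom S - sngl v (Suc 0) = squarefree_monom (S - {v})"
  using assms by (intro poly_mapping_eqI)
    (auto simp: lookup_minus lookup_squarefree_monom lookup_single when_def)

lemma squarefree_monom_singleton [simp]: "squarefree_monom {v} = sngl v 1"
  unfolding squarefree_monom_def by simp

lemma kd_triple:
  fixes w :: "nat set \<Rightarrow> 'a::comm_ring_1"
  assumes "a < b" "b < c"
  shows "kd y w {a, b, c} = y a * w {b, c} - y b * w {a, c} + y c * w {a, b}"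
proof -
  have less: "{t \<in> {a, b, c}. t < a} = {}" "{t \<in> {a, b, c}. t < b} = {a}" "{t \<in> {a, b, c}. t < c} = {a, b}"
    using assms by auto
  have "ksgn a {a, b, c} = (1 :: 'a)" "ksgn b {a, b, c} = (- 1 :: 'a)" "ksgn c {a, b, c} = (1 :: 'a)"
    unfolding ksgn_def less using assms by simp_all
  moreover have "{a, b, c} - {a} = {b, c}" "{a, b, c} - {b} = {a, c}" "{a, b, c} - {c} = {a, b}"
    using assms by auto
  ultimately show ?thesis using assms unfolding kd_def by simp
qed

lemma kd_pair:
  fixes w :: "nat set \<Rightarrow> 'a::comm_ring_1"
  assumes "a < b" shows "kd y w {a, b} = y a * w {b} - y b * w {a}"
proof -
  have less: "{t \<in> {a, b}. t < a} = {}" "{t \<in> {a, b}. t < b} = {a}" using assms by auto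
  have "ksgn a {a, b} = (1 :: 'a)" "ksgn b {a, b} = (- 1 :: 'a)"
    unfolding ksgn_def less by simp_all
  moreover have "{a, b} - {a} = {b}" "{a, b} - {b} = {a}" using assms by auto
  ultimately show ?thesis using assms unfolding kd_def by simp
qed

text \<open>In this range the complex has the cohomology of a circle, and the cocycle \<open>w\<close> below encodes the
  generator in degree one, which counts crossings of the cut between \<open>n - 1\<close> and \<open>0\<close>.\<close>

lemma not_cohen_macaulay_Sigma_cycle_graph_small:
  fixes K :: "'k::field itself"
  assumes r: "2 \<le> r" and n: "r + 3 \<le> n" "n \<le> 2 * r + 1"
  shows "\<not> cohen_macaulay K {0..<n} (Sigma_complex r (cycle_graph n))"
proof
  let ?V = "{0..<n}" and ?\<Delta> = "Sigma_complex r (cycle_graph n)"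
  let ?J = "sr_ideal ?\<Delta> :: 'k mpoly set"
  note \<Delta> = Sigma_cycle_graph_iff[of r n]
  note dc = Sigma_cycle_graph_facts(2)[of r n]
  note I = ideal_set_sr_ideal[OF dc, where 'k='k]
  assume "cohen_macaulay K ?V ?\<Delta>"
  then obtain fs :: "'k mpoly list" where
    fs: "length fs = n - r" "regular_list ?J fs" "set fs \<subseteq> sr_irrelevant ?V ?\<Delta>"
    using cohen_macaulay_cycle_iff[of r n K] r n by auto
  \<comment> \<open>The factor \<open>\<Prod>v\<in>S. var v\<close> places the cochain in squarefree
    multidegrees, where the Koszul differential is the simplicial coboundary on faces and nonfaces
    vanish modulo \<open>?J\<close>.\<close>
  define w :: "nat set \<Rightarrow> 'k mpoly" where
    "w S = (if Min S + r + 1 \<le> Max S then \<Prod>v\<in>S. var v else 0)" for S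
  have w: "w {a, b} = (if a + r + 1 \<le> b then var a * var b else 0)" if "a < b" for a b
    using that unfolding w_def by (simp add: min_def max_def)
  have "kcocycle ?V var ?J 2 w" unfolding kcocycle_def
  proof (intro allI impI)
    fix S assume S: "S \<subseteq> ?V \<and> card S = Suc 2"
    then have fin: "finite S" using finite_subset[of S ?V] by blast
    show "kd var w S \<in> ?J"
    proof (cases "S \<in> ?\<Delta>")
      case False
      have prod: "(\<Prod>v\<in>S. var v) \<in> ?J" by (rule prod_var_in_sr_ideal[OF fin False])
      have "ksgn s S * (var s * w (S - {s})) \<in> ?J" if s: "s \<in> S" for s
      proof -
        have "var s * (\<Prod>v\<in>S - {s}. var v) = (\<Prod>v\<in>S. var v :: 'k mpoly)"
          using s fin by (simp add: prod.remove)
        then have "var s * w (S - {s}) \<in> ?J" using prod ideal_set_zero[OF I] unfolding w_def by simp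
        then show ?thesis by (rule ideal_set_mult_left[OF I])
      qed
      then show ?thesis unfolding kd_def mult.assoc by (rule ideal_set_sum[OF I])
    next
      case True
      have "card S = 3" using S by simp
      then obtain a b c where abc: "S = {a, b, c}" "a < b" "b < c" by (rule card_3_sorted)
      obtain i where i: "i < n" "S \<inter> arc_at n i r = {}" using True \<Delta> r n by auto
      then have "S \<subseteq> ?V - arc_at n i r" using S by blast
      then have "{a, b, c} \<subseteq> arc_at n (shift n i r) (n - r)" using compl_arc_at[OF i(1)] n abc by simp
      moreover have "shift n i r < n" using shift_less[OF i(1)] n by simp
      ultimately have "c < a + r + 1 \<or> (a + r + 1 \<le> b \<and> c < b + r + 1) \<or> (b < a + r + 1 \<and> b + r + 1 \<le> c)"
        using triple_in_arc_at[OF n(2) _ _ abc(2,3)] n by simp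
      then have "kd var w S = 0" unfolding abc(1) kd_triple[OF abc(2,3)] using abc by (auto simp: w)
      then show ?thesis using ideal_set_zero[OF I] by simp
    qed
  qed
  moreover have "\<exists>k. (var v :: 'k mpoly) = var v ^ k" for v by (rule exI[of _ 1]) simp
  moreover have "2 < length fs" using fs(1) n by simp
  ultimately have "kboundary ?V var ?J 2 w" using koszul_stanley_reisner[OF _ dc fs(2,3)] by blast
  then obtain z where z: "\<And>S. S \<subseteq> ?V \<Longrightarrow> card S = 2 \<Longrightarrow> w S - kd var z S \<in> ?J"
    unfolding kboundary_def by blast
  \<comment> \<open>The squarefree part of the supposed primitive \<open>z\<close>, a function on
    vertices. Comparing coefficients on an edge shows that its coboundary is the indicator of far
    pairs.\<close>
  define e where "e v = lkp (z {v}) (sngl v 1)" for v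
  have edge: "(if a + r + 1 \<le> b then 1 else 0) = e b - e a" if ab: "a < b" "b < n" "{a, b} \<in> ?\<Delta>" for a b
  proof -
    let ?m = "squarefree_monom {a, b}"
    have "lkp (w {a, b} - kd var z {a, b}) ?m = 0"
    proof (rule lookup_sr_ideal[OF z])
      show "{a, b} \<subseteq> ?V" "card {a, b} = 2" "kys ?m \<in> ?\<Delta>" using ab by (auto simp: keys_squarefree_monom)
    qed
    moreover have "lkp (kd var z {a, b}) ?m = e b - e a"
      using ab(1) by (simp add: kd_pair lookup_minus lookup_var_mult keys_squarefree_monom squarefree_monom_minus e_def insert_Diff_if)
    moreover have "lkp (w {a, b}) ?m = (if a + r + 1 \<le> b then 1 else 0)"
    proof -
      have "var a * var b = (sngl ?m 1 :: 'k mpoly)" using ab(1) prod_var[of "{a, b}"] by simp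
      then show ?thesis using w[OF ab(1)] by simp
    qed
    ultimately show ?thesis by (simp add: lookup_minus)
  qed
  have in_\<Delta>: "{a, b} \<in> ?\<Delta>" if "{a, b} \<subseteq> arc_at n i 2" "i < n" for a b i
  proof -
    have "arc_at n i 2 \<subseteq> arc_at n i (n - r)" using n unfolding arc_at_def by auto
    then show ?thesis using that Sigma_cycle_graph[of r n] r n by auto
  qed
  \<comment> \<open>Along the edges \<open>{k, Suc k}\<close> nothing changes, but the edge
    \<open>{0, n - 1}\<close> across the cut demands a jump by \<open>1\<close>.\<close>
  have const: "e k = e 0" if "k < n" for k
    using that
  proof (induction k)
    case (Suc k)
    have "{k, Suc k} \<subseteq> arc_at n k 2" using Suc.prems unfolding arc_at_def by auto
    then have "{k, Suc k} \<in> ?\<Delta>" using in_\<Delta> Suc.prems by simp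
    then have "e (Suc k) - e k = 0" using edge[of k "Suc k"] Suc.prems r by simp
    then show ?case using Suc by simp
  qed simp
  have "{0, n - 1} \<subseteq> arc_at n (n - 1) 2" using n unfolding arc_at_def by auto
  then have "{0, n - 1} \<in> ?\<Delta>" using in_\<Delta> n by simp
  moreover have "0 + r + 1 \<le> n - 1" "0 < n - 1" "n - 1 < n" using n by linarith+
  ultimately have "1 = e (n - 1) - e 0" using edge[of 0 "n - 1"] by simp
  then show False using const[of "n - 1"] n by simp
qed

text \<open>Here the link of the face \<open>F\<close> is disconnected. Using the squares of the variables of \<open>F\<close> as
  Koszul sequence makes the multidegree of \<open>w\<close> positive on \<open>F\<close>, which is how the Koszul complex
  sees links instead of restrictions.\<close>

lemma not_cohen_macaulay_Sigma_cycle_graph_large: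
  fixes K :: "'k::field itself"
  assumes r: "2 \<le> r" and n: "2 * r + 2 \<le> n"
  shows "\<not> cohen_macaulay K {0..<n} (Sigma_complex r (cycle_graph n))"
proof
  let ?V = "{0..<n}" and ?\<Delta> = "Sigma_complex r (cycle_graph n)"
  let ?J = "sr_ideal ?\<Delta> :: 'k mpoly set"
  define A where "A = {0..<r}"
  define B where "B = {r + 1..<2 * r + 1}"
  define F where "F = ?V - (A \<union> B)"
  have arcs: "arc_at n 0 r = A" "arc_at n (r + 1) r = B" using n unfolding arc_at_def A_def B_def by auto
  have disj: "A \<inter> B = {}" "A \<inter> F = {}" "B \<inter> F = {}" "A \<union> B \<subseteq> ?V" "F \<subseteq> ?V"
    using n unfolding A_def B_def F_def by auto
  have finF: "finite F" unfolding F_def by simp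
  have cardF: "card F = n - 2 * r"
  proof -
    have "card (A \<union> B) = 2 * r" using disj(1) unfolding A_def B_def by (simp add: card_Un_disjoint)
    then show ?thesis using disj(4) unfolding F_def by (subst card_Diff_subset) (auto simp: A_def B_def)
  qed
  have \<Delta>: "S \<in> ?\<Delta> \<longleftrightarrow> S \<subseteq> ?V \<and> (\<exists>i<n. S \<inter> arc_at n i r = {})" for S
    using Sigma_cycle_graph_iff[of r n S] r n by simp
  note dc = Sigma_cycle_graph_facts(2)[of r n]
  note I = ideal_set_sr_ideal[OF dc, where 'k='k]
  assume "cohen_macaulay K ?V ?\<Delta>"
  then obtain fs :: "'k mpoly list" where
    fs: "length fs = n - r" "regular_list ?J fs" "set fs \<subseteq> sr_irrelevant ?V ?\<Delta>"
    using cohen_macaulay_cycle_iff[of r n K] r n by auto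
  define y :: "nat \<Rightarrow> 'k mpoly" where "y v = var v ^ (if v \<in> F then 2 else 1)" for v
  \<comment> \<open>The link of \<open>F\<close> has vertices in \<open>A\<close> and in
    \<open>B\<close>, with no edge between the two sets. The coboundary of \<open>u\<close>
    represents the function \<open>1\<close> on all these vertices, and \<open>w\<close> keeps only
    its part on \<open>A\<close>.\<close>
  define u :: "nat set \<Rightarrow> 'k mpoly" where "u S = (if S = F then \<Prod>v\<in>F. var v else 0)" for S
  define w where "w S = (if S \<inter> B = {} then kd y u S else 0)" for S
  have "kcocycle ?V y ?J (card F + 1) w" unfolding kcocycle_def
  proof (intro allI impI)
    fix S assume S: "S \<subseteq> ?V \<and> card S = Suc (card F + 1)"
    then have fin: "finite S" using finite_subset[of S ?V] by blast
    show "kd y w S \<in> ?J"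
    proof (cases "S \<inter> B = {}")
      case True
      then have "w (S - {s}) = kd y u (S - {s})" for s unfolding w_def by auto
      then have "kd y w S = kd y (kd y u) S" unfolding kd_def[of y w] kd_def[of y "kd y u"] by simp
      then show ?thesis using kd_kd[OF fin, of y u] ideal_set_zero[OF I] by simp
    next
      case False
      \<comment> \<open>A contribution can survive only for \<open>S\<close> equal to
        \<open>F\<close> with one vertex from each of \<open>A\<close> and \<open>B\<close>. Such an
        \<open>S\<close> is a nonface, because the only \<open>r\<close>-arcs disjoint from
        \<open>F\<close> are \<open>A\<close> and \<open>B\<close> themselves.\<close>
      have summand: "y s * w (S - {s}) \<in> ?J" if s: "s \<in> S" for s
      proof (cases "(S - {s}) \<inter> B = {}")
        case True
        then have sB: "s \<in> B" using False by blast
        have "ksgn t (S - {s}) * (y t * (y s * u (S - {s} - {t}))) \<in> ?J" if t: "t \<in> S - {s}" for t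
        proof (cases "S - {s} - {t} = F")
          case F: True
          have tA: "t \<in> A" using t True F S unfolding F_def by blast
          have "s \<notin> F" "t \<notin> F" using sB tA disj by auto
          then have "y t * (y s * u (S - {s} - {t})) = var t * (var s * (\<Prod>v\<in>S - {s} - {t}. var v))"
            unfolding y_def u_def F by simp
          also have "\<dots> = (\<Prod>v\<in>S. var v)" using s t fin by (simp add: prod.remove[of S s] prod.remove[of "S - {s}" t] mult_ac)
          also have "\<dots> \<in> ?J"
          proof (rule prod_var_in_sr_ideal[OF fin])
            show "S \<notin> ?\<Delta>"
            proof
              assume "S \<in> ?\<Delta>"
              then obtain i where i: "i < n" "S \<inter> arc_at n i r = {}" using \<Delta> by blast
              have "F \<subseteq> S" using F by blast
              then have "arc_at n i r \<subseteq> A \<union> B" using i arc_at_subset[of n i r] unfolding F_def by blast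
              then have "i = 0 \<or> i = r + 1"
                using arc_at_within_two_arcs[OF r n i(1)] unfolding A_def B_def by blast
              then have "arc_at n i r = A \<or> arc_at n i r = B" using arcs by metis
              then show False using i(2) tA sB s t by blast
            qed
          qed
          finally show ?thesis by (rule ideal_set_mult_left[OF I])
        qed (simp add: u_def ideal_set_zero[OF I])
        then have "(\<Sum>t\<in>S - {s}. ksgn t (S - {s}) * (y t * (y s * u (S - {s} - {t})))) \<in> ?J"
          by (rule ideal_set_sum[OF I])
        also have "(\<Sum>t\<in>S - {s}. ksgn t (S - {s}) * (y t * (y s * u (S - {s} - {t})))) = y s * kd y u (S - {s})"
          unfolding kd_def sum_distrib_left by (intro sum.cong) (auto simp: mult_ac)
        finally show ?thesis using True unfolding w_def by simp
      qed (simp add: w_def ideal_set_zero[OF I])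
      have "ksgn s S * (y s * w (S - {s})) \<in> ?J" if "s \<in> S" for s
        by (rule ideal_set_mult_left[OF I summand[OF that]])
      then show ?thesis unfolding kd_def mult.assoc by (rule ideal_set_sum[OF I])
    qed
  qed
  moreover have "\<exists>k. y v = var v ^ k" for v unfolding y_def by blast
  \<comment> \<open>This compares \<open>n - 2 * r + 1\<close> with \<open>n - r\<close> and is
    where \<open>r \<ge> 2\<close> is needed.\<close>
  moreover have "card F + 1 < length fs" using fs(1) cardF n r by simp
  ultimately have "kboundary ?V y ?J (card F + 1) w" using koszul_stanley_reisner[OF _ dc fs(2,3)] by blast
  then obtain z where z: "\<And>S. S \<subseteq> ?V \<Longrightarrow> card S = card F + 1 \<Longrightarrow> w S - kd y z S \<in> ?J"
    unfolding kboundary_def by blast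
  \<comment> \<open>In the squarefree multidegree of \<open>insert t F\<close> all terms carrying
    \<open>y v\<close> with \<open>v\<close> in \<open>F\<close> drop out, since they are divisible
    by the square of a variable. The value on \<open>t\<close> is therefore one coefficient of
    \<open>z F\<close>, the same for \<open>A\<close> and \<open>B\<close>.\<close>
  have coeff: "lkp (ksgn t (insert t F) * w (insert t F)) (squarefree_monom (insert t F)) = lkp (z F) (squarefree_monom F)"
    if t: "t \<in> A \<union> B" for t
  proof -
    let ?S = "insert t F" and ?m = "squarefree_monom (insert t F)"
    have tF: "t \<notin> F" using t disj by blast
    have S: "?S \<subseteq> ?V" "card ?S = card F + 1" "finite ?S" using t disj tF finF by auto
    have "?S \<inter> arc_at n 0 r = {} \<or> ?S \<inter> arc_at n (r + 1) r = {}" unfolding arcs using t disj by blast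
    moreover have "0 < n" "r + 1 < n" using n by auto
    ultimately have "?S \<in> ?\<Delta>" using \<Delta> S(1) by blast
    then have "lkp (ksgn t ?S * (w ?S - kd y z ?S)) ?m = 0"
      using ideal_set_mult_left[OF I z[OF S(1,2)]] by (intro lookup_sr_ideal) (auto simp: keys_squarefree_monom finF)
    moreover have "lkp (ksgn t ?S * kd y z ?S) ?m = lkp (z F) (squarefree_monom F)"
    proof -
      have "kd y z ?S = ksgn t ?S * (y t * z F) + (\<Sum>v\<in>F. ksgn v ?S * y v * z (?S - {v}))"
        using tF finF unfolding kd_def by (simp add: mult.assoc)
      then have "ksgn t ?S * kd y z ?S = y t * z F + (\<Sum>v\<in>F. ksgn t ?S * (ksgn v ?S * y v * z (?S - {v})))"
        by (simp add: distrib_left sum_distrib_left)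
      moreover have "lkp (ksgn t ?S * (ksgn v ?S * y v * z (?S - {v}))) ?m = 0" if v: "v \<in> F" for v
      proof -
        have square: "ksgn t ?S * (ksgn v ?S * y v * z (?S - {v})) = var v * (var v * (ksgn t ?S * ksgn v ?S * z (?S - {v})))"
          using v unfolding y_def by (simp add: power2_eq_square mult_ac)
        have "v \<in> kys ?m" "v \<notin> kys (?m - sngl v (Suc 0))"
          using v finF by (auto simp: keys_squarefree_monom squarefree_monom_minus)
        then show ?thesis unfolding square by (simp add: lookup_var_mult)
      qed
      moreover have "lkp (y t * z F) ?m = lkp (z F) (squarefree_monom F)"
        using tF finF by (simp add: y_def lookup_var_mult keys_squarefree_monom squarefree_monom_minus)
      ultimately show ?thesis by (simp add: lookup_add lookup_sum)
    qed
    ultimately show ?thesis by (simp add: right_diff_distrib lookup_minus)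
  qed
  have "0 \<in> A" "r + 1 \<in> B" using r unfolding A_def B_def by auto
  have "w (insert (r + 1) F) = 0" unfolding w_def using \<open>r + 1 \<in> B\<close> by auto
  then have "lkp (z F) (squarefree_monom F) = 0" using coeff[of "r + 1"] \<open>r + 1 \<in> B\<close> by simp
  moreover have "lkp (z F) (squarefree_monom F) = 1"
  proof -
    have F0: "0 \<notin> F" using \<open>0 \<in> A\<close> disj by blast
    have "insert 0 F \<inter> B = {}" using \<open>0 \<in> A\<close> disj by blast
    then have "w (insert 0 F) = kd y u (insert 0 F)" unfolding w_def by simp
    also have "\<dots> = ksgn 0 (insert 0 F) * (var 0 * (\<Prod>v\<in>F. var v))"
    proof -
      have "(\<Sum>v\<in>F. ksgn v (insert 0 F) * y v * u (insert 0 F - {v})) = 0"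
        by (rule sum.neutral) (use F0 in \<open>auto simp: u_def\<close>)
      then show ?thesis using F0 finF unfolding kd_def by (simp add: y_def u_def mult.assoc)
    qed
    also have "var 0 * (\<Prod>v\<in>F. var v) = (\<Prod>v\<in>insert 0 F. var v)" using F0 finF by simp
    finally have "ksgn 0 (insert 0 F) * w (insert 0 F) = sngl (squarefree_monom (insert 0 F)) 1"
      unfolding prod_var by simp
    then show ?thesis using coeff[of 0] \<open>0 \<in> A\<close> by simp
  qed
  ultimately show False by simp
qed

theorem theorem4p11:
  fixes n r :: nat and K :: "'k::field itself"
  assumes "n \<ge> 3" and "r \<ge> 2"
  shows "(vertex_decomposable (Sigma_complex r (cycle_graph n)) \<longleftrightarrow>
          shellable (Sigma_complex r (cycle_graph n))) \<and>
         (shellable (Sigma_complex r (cycle_graph n)) \<longleftrightarrow>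
          cohen_macaulay K (verts (cycle_graph n)) (Sigma_complex r (cycle_graph n))) \<and>
         (cohen_macaulay K (verts (cycle_graph n)) (Sigma_complex r (cycle_graph n)) \<longleftrightarrow>
          n \<le> r + 2) \<and>
         (n \<le> r + 2 \<longleftrightarrow>
          cochordal_clutter r (verts (cycle_graph n)) (Con r (cycle_graph n)))"
proof -
  have vd_sh: "vertex_decomposable (Sigma_complex r (cycle_graph n)) \<Longrightarrow>
      shellable (Sigma_complex r (cycle_graph n))"
    using vertex_decomposable_imp_shellable Sigma_cycle_graph_facts(1-3) by blast
  show ?thesis
  proof (cases "n \<le> r + 2")
    case True
    then show ?thesis
      using vertex_decomposable_Sigma_cycle_graph[OF assms True] vd_sh
        cohen_macaulay_Sigma_cycle_graph[OF assms True, of K] cochordal_Con_cycle_graph[OF assms True]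
      unfolding verts_cycle_graph by blast
  next
    case False
    then have n: "r + 3 \<le> n" by simp
    have "\<not> cohen_macaulay K {0..<n} (Sigma_complex r (cycle_graph n))"
      using not_cohen_macaulay_Sigma_cycle_graph_small[OF assms(2) n, of K]
        not_cohen_macaulay_Sigma_cycle_graph_large[OF assms(2), of n K] by linarith
    moreover have "\<not> cochordal_clutter r (verts (cycle_graph n)) (Con r (cycle_graph n))"
      using not_cochordal_Con_cycle_graph_small[OF assms(2) n]
        not_cochordal_Con_cycle_graph_large[OF assms(2), of n] by linarith
    ultimately show ?thesis
      using not_shellable_Sigma_cycle_graph[OF assms(2) n] vd_sh False unfolding verts_cycle_graph by blast
  qed
qed

end
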